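(* Let $X=(\mathfrak{g}_r)_r$ be one of the families $C=(\mathfrak{sp}_{2r})_r$, $B=(\mathfrak{so}_{2r+1})_r$, $D=(\mathfrak{so}_{2r})_r$. Let $\lambda$ be a partition and let $\theta=(\theta_i)_{i\geq1}$ be a bounded sequence of positive real numbers with $\sup\theta<1$. Then \[S_\lambda^{\mathfrak{g}_r}(\theta_{[r]})\xrightarrow[r\to\infty]{}S_\lambda^A(\theta).\]
   Context: A partition is a weakly decreasing sequence of nonnegative integers with finitely many nonzero terms; $\ell(\lambda)$ is the number of nonzero terms. Lie algebras are complex. For each $r$, let $(\varepsilon_1,\ldots,\varepsilon_r)$ be the standard orthonormal basis of a Euclidean space with inner product $\langle\cdot,\cdot\rangle$, in which the weights of $\mathfrak{g}_r$ live. Put $I=\{1,\ldots,r-1\}$ if $\mathfrak{g}_r=\mathfrak{gl}_r$ and $I=\{1,\ldots,r\}$ if $\mathfrak{g}_r=\mathfrak{sp}_{2r},\mathfrak{so}_{2r+1},\mathfrak{so}_{2r}$. The simple roots $(\alpha_i)_{i\in I}$ are $\alpha_i=\varepsilon_i-\varepsilon_{i+1}$ for $1\leq i<r$, and $\alpha_r=2\varepsilon_r$ for $\mathfrak{sp}_{2r}$, $\alpha_r=\varepsilon_r$ for $\mathfrak{so}_{2r+1}$, $\alpha_r=\varepsilon_{r-1}+\varepsilon_r$ for $\mathfrak{so}_{2r}$. The fundamental weights $(\omega_i)_{i\in I}$ are $\omega_i=\sum_{j=1}^i\varepsilon_j$, except that $\omega_r=\frac12\sum_{j=1}^r\varepsilon_j$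 for $\mathfrak{so}_{2r+1}$ and $\mathfrak{so}_{2r}$, and $\omega_{r-1}=\frac12\left(\sum_{j=1}^{r-1}\varepsilon_j\right)-\frac12\varepsilon_r$ for $\mathfrak{so}_{2r}$. Put $\omega_i^\vee=\frac{2}{\langle\alpha_i,\alpha_i\rangle}\omega_i$, so that $\langle\omega_i^\vee,\alpha_j\rangle=\delta_{ij}$. A partition $\lambda$ with $\ell(\lambda)\leq r$ is identified with the dominant weight $\sum_{i=1}^r\lambda_i\varepsilon_i$ of $\mathfrak{g}_r$; $V^{\mathfrak{g}_r}(\lambda)$ is the corresponding irreducible representation, $P^{\mathfrak{g}_r}(\lambda)$ its set of weights, and $K_{\lambda\,\omega}^{\mathfrak{g}_r}$ the dimension of its $\omega$-weight space. For $\omega\in P^{\mathfrak{g}_r}(\lambda)$, the numbers $\langle\lambda-\omega,\omega_i^\vee\rangle$ are nonnegative integers (the coefficients of $\lambda-\omega$ on the simple roots). With $\theta_{[r]}=(\theta_i)_{i\in I}$ (so $\theta_{[r]}=(\theta_1,\ldots,\theta_{r-1})$ for $\mathfrak{gl}_r$ and $(\theta_1,\ldots,\theta_r)$ in the other cases), set \[S_\lambda^{\mathfrak{g}_r}(\theta_{[r]})=\sum_{\omega\in P^{\mathfrak{g}_r}(\lambda)}K_{\lambda\,\omega}^{\mathfrak{g}_r}\prod_{i\in I}\theta_i^{\langle\lambda-\omega,\omega_i^\vee\rangle}\] for all $r\geq\ell(\lambda)$. When $\sup\theta<1$, the sequence $\left(S_\lambda^{\mathfrak{gl}_r}(\theta_{[r]})\right)_r$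 is convergent, and $S_\lambda^A(\theta)$ denotes its limit as $r\to\infty$. *)

theory Defs
  imports Complex_Main "Jordan_Normal_Form.VS_Connect"
begin

datatype lie_type = Type_A | Type_B | Type_C | Type_D

text \<open>
  The family of type \<open>A\<close>, \<open>B\<close>, \<open>C\<close>, \<open>D\<close> has \<open>r\<close>-th term gl(r), so(2r+1), sp(2r), so(2r) respectively.
  Weight coordinates, simple roots, partitions and \<open>\<theta>\<close> are indexed from 1 as on paper: values at
  index 0 are never used. Matrix and vector indices start from 0.
\<close>

definition lie_size :: "lie_type \<Rightarrow> nat \<Rightarrow> nat" where
  "lie_size X r = (case X of Type_A \<Rightarrow> r | Type_B \<Rightarrow> 2 * r + 1 | Type_C \<Rightarrow> 2 * r | Type_D \<Rightarrow> 2 * r)"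

text \<open>
  The bilinear forms are chosen so that the diagonal matrices of the algebra form a Cartan
  subalgebra: the basis vectors number \<open>i\<close> and \<open>r + i\<close> are paired, and in type \<open>B\<close> the last one is
  paired with itself.
\<close>

definition sym_form :: "nat \<Rightarrow> complex mat" where
  "sym_form r = four_block_mat (0\<^sub>m r r) (1\<^sub>m r) (1\<^sub>m r) (0\<^sub>m r r)"

definition alt_form :: "nat \<Rightarrow> complex mat" where
  "alt_form r = four_block_mat (0\<^sub>m r r) (1\<^sub>m r) (- (1\<^sub>m r)) (0\<^sub>m r r)"

definition odd_sym_form :: "nat \<Rightarrow> complex mat" where
  "odd_sym_form r = four_block_mat (sym_form r) (0\<^sub>m (2 * r) 1) (0\<^sub>m 1 (2 * r)) (1\<^sub>m 1)"

definition preserving_algebra :: "nat \<Rightarrow> complex mat \<Rightarrow> complex mat set" where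
  "preserving_algebra N J = {x \<in> carrier_mat N N. transpose_mat x * J + J * x = 0\<^sub>m N N}"

definition lie_alg :: "lie_type \<Rightarrow> nat \<Rightarrow> complex mat set" where
  "lie_alg X r = (case X of
      Type_A \<Rightarrow> carrier_mat r r
    | Type_B \<Rightarrow> preserving_algebra (2 * r + 1) (odd_sym_form r)
    | Type_C \<Rightarrow> preserving_algebra (2 * r) (alt_form r)
    | Type_D \<Rightarrow> preserving_algebra (2 * r) (sym_form r))"

definition bracket :: "complex mat \<Rightarrow> complex mat \<Rightarrow> complex mat" where
  "bracket x y = x * y - y * x"

text \<open>
  The element of the Cartan subalgebra on which \<open>\<epsilon>\<^sub>i\<close> takes the value \<open>t i\<close>, that is,
  \<open>diag(t\<^sub>1, \<dots>, t\<^sub>r)\<close>, \<open>diag(t\<^sub>1, \<dots>, t\<^sub>r, -t\<^sub>1, \<dots>, -t\<^sub>r, 0)\<close> or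
  \<open>diag(t\<^sub>1, \<dots>, t\<^sub>r, -t\<^sub>1, \<dots>, -t\<^sub>r)\<close>.
\<close>

definition cartan_elt :: "lie_type \<Rightarrow> nat \<Rightarrow> (nat \<Rightarrow> complex) \<Rightarrow> complex mat" where
  "cartan_elt X r t = mat_diag (lie_size X r)
     (\<lambda>k. if k < r then t (k + 1) else if k < 2 * r then - t (k - r + 1) else 0)"

type_synonym weight = "nat \<Rightarrow> real"

definition weight_space_E :: "nat \<Rightarrow> weight set" where
  "weight_space_E r = {\<omega>. \<forall>i. i \<notin> {1..r} \<longrightarrow> \<omega> i = 0}"

definition inner_E :: "nat \<Rightarrow> weight \<Rightarrow> weight \<Rightarrow> real" where
  "inner_E r \<mu> \<nu> = (\<Sum>i = 1..r. \<mu> i * \<nu> i)"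

definition eps :: "nat \<Rightarrow> weight" where
  "eps i = (\<lambda>j. if j = i then 1 else 0)"

definition weight_eval :: "nat \<Rightarrow> weight \<Rightarrow> (nat \<Rightarrow> complex) \<Rightarrow> complex" where
  "weight_eval r \<omega> t = (\<Sum>i = 1..r. of_real (\<omega> i) * t i)"

definition index_set :: "lie_type \<Rightarrow> nat \<Rightarrow> nat set" where
  "index_set X r = (if X = Type_A then {1..<r} else {1..r})"

text \<open>In type \<open>D\<close> these are the usual notions for \<open>r \<ge> 2\<close>; smaller \<open>r\<close> are irrelevant to limits.\<close>

definition simple_root :: "lie_type \<Rightarrow> nat \<Rightarrow> nat \<Rightarrow> weight" where
  "simple_root X r i =
    (if i < r then (\<lambda>j. eps i j - eps (i + 1) j)
     else (case X of
        Type_B \<Rightarrow> eps r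
      | Type_C \<Rightarrow> (\<lambda>j. 2 * eps r j)
      | Type_D \<Rightarrow> (\<lambda>j. eps (r - 1) j + eps r j)
      | Type_A \<Rightarrow> (\<lambda>j. 0)))"

definition fund_weight :: "lie_type \<Rightarrow> nat \<Rightarrow> nat \<Rightarrow> weight" where
  "fund_weight X r i =
    (if (X = Type_B \<or> X = Type_D) \<and> i = r then (\<lambda>j. 1 / 2 * (\<Sum>k = 1..r. eps k j))
     else if X = Type_D \<and> i = r - 1 then (\<lambda>j. 1 / 2 * (\<Sum>k = 1..r - 1. eps k j) - 1 / 2 * eps r j)
     else (\<lambda>j. \<Sum>k = 1..i. eps k j))"

definition fund_coweight :: "lie_type \<Rightarrow> nat \<Rightarrow> nat \<Rightarrow> weight" where
  "fund_coweight X r i =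
    (\<lambda>j. 2 / inner_E r (simple_root X r i) (simple_root X r i) * fund_weight X r i j)"

definition root_space :: "lie_type \<Rightarrow> nat \<Rightarrow> weight \<Rightarrow> complex mat set" where
  "root_space X r \<beta> =
    {x \<in> lie_alg X r. \<forall>t. bracket (cartan_elt X r t) x = weight_eval r \<beta> t \<cdot>\<^sub>m x}"

definition positive_roots :: "lie_type \<Rightarrow> nat \<Rightarrow> weight set" where
  "positive_roots X r =
    {\<beta>. \<beta> \<noteq> (\<lambda>j. 0)
       \<and> (\<exists>c :: nat \<Rightarrow> nat. \<beta> = (\<lambda>j. \<Sum>i\<in>index_set X r. real (c i) * simple_root X r i j))
       \<and> root_space X r \<beta> \<noteq> {0\<^sub>m (lie_size X r) (lie_size X r)}}"

text \<open>
  A representation on \<open>\<complex>\<^sup>d\<close> is given by the pair of \<open>d\<close> and the action map; up to isomorphism these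
  are all finite-dimensional representations.
\<close>

type_synonym lie_rep = "nat \<times> (complex mat \<Rightarrow> complex mat)"

definition is_rep :: "complex mat set \<Rightarrow> lie_rep \<Rightarrow> bool" where
  "is_rep \<gg> V = (case V of (d, \<rho>) \<Rightarrow>
      (\<forall>x\<in>\<gg>. \<rho> x \<in> carrier_mat d d)
    \<and> (\<forall>x\<in>\<gg>. \<forall>y\<in>\<gg>. \<rho> (x + y) = \<rho> x + \<rho> y)
    \<and> (\<forall>c. \<forall>x\<in>\<gg>. \<rho> (c \<cdot>\<^sub>m x) = c \<cdot>\<^sub>m \<rho> x)
    \<and> (\<forall>x\<in>\<gg>. \<forall>y\<in>\<gg>. \<rho> (bracket x y) = bracket (\<rho> x) (\<rho> y)))"

definition irreducible_rep :: "complex mat set \<Rightarrow> lie_rep \<Rightarrow> bool" where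
  "irreducible_rep \<gg> V = (case V of (d, \<rho>) \<Rightarrow>
      is_rep \<gg> V \<and> 0 < d
    \<and> (\<forall>W. subspace class_ring W (module_vec TYPE(complex) d)
           \<and> (\<forall>x\<in>\<gg>. \<forall>w\<in>W. \<rho> x *\<^sub>v w \<in> W)
         \<longrightarrow> W = {0\<^sub>v d} \<or> W = carrier_vec d))"

definition weight_space :: "lie_type \<Rightarrow> nat \<Rightarrow> lie_rep \<Rightarrow> weight \<Rightarrow> complex vec set" where
  "weight_space X r V \<omega> = (case V of (d, \<rho>) \<Rightarrow>
     {v \<in> carrier_vec d. \<forall>t. \<rho> (cartan_elt X r t) *\<^sub>v v = weight_eval r \<omega> t \<cdot>\<^sub>v v})"

definition weight_mult :: "lie_type \<Rightarrow> nat \<Rightarrow> lie_rep \<Rightarrow> weight \<Rightarrow> nat" where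
  "weight_mult X r V \<omega> =
     vectorspace.dim class_ring
       ((module_vec TYPE(complex) (fst V))\<lparr>carrier := weight_space X r V \<omega>\<rparr>)"

definition has_highest_weight :: "lie_type \<Rightarrow> nat \<Rightarrow> lie_rep \<Rightarrow> weight \<Rightarrow> bool" where
  "has_highest_weight X r V \<mu> = (case V of (d, \<rho>) \<Rightarrow>
     \<exists>v \<in> weight_space X r V \<mu>. v \<noteq> 0\<^sub>v d
       \<and> (\<forall>\<beta>\<in>positive_roots X r. \<forall>x\<in>root_space X r \<beta>. \<rho> x *\<^sub>v v = 0\<^sub>v d))"

definition is_partition :: "(nat \<Rightarrow> nat) \<Rightarrow> bool" where
  "is_partition lam \<longleftrightarrow> (\<forall>i\<ge>1. lam (i + 1) \<le> lam i) \<and> finite {i. i \<ge> 1 \<and> lam i \<noteq> 0}"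

text \<open>The truncation to \<open>{1..r}\<close> loses nothing when \<open>r\<close> is at least the length of the partition.\<close>

definition partition_weight :: "nat \<Rightarrow> (nat \<Rightarrow> nat) \<Rightarrow> weight" where
  "partition_weight r lam = (\<lambda>i. if i \<in> {1..r} then real (lam i) else 0)"

text \<open>
  For \<open>r\<close> at least the length of the partition (and \<open>r \<ge> 2\<close> in type \<open>D\<close>) such a representation
  exists and is unique up to isomorphism, so that its weight multiplicities do not depend on the
  choice.
\<close>

definition irrep :: "lie_type \<Rightarrow> nat \<Rightarrow> (nat \<Rightarrow> nat) \<Rightarrow> lie_rep" where
  "irrep X r lam =
    (SOME V. irreducible_rep (lie_alg X r) V \<and> has_highest_weight X r V (partition_weight r lam))"

definition weights :: "lie_type \<Rightarrow> nat \<Rightarrow> (nat \<Rightarrow> nat) \<Rightarrow> weight set" where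
  "weights X r lam =
    {\<omega> \<in> weight_space_E r. weight_space X r (irrep X r lam) \<omega> \<noteq> {0\<^sub>v (fst (irrep X r lam))}}"

definition K_mult :: "lie_type \<Rightarrow> nat \<Rightarrow> (nat \<Rightarrow> nat) \<Rightarrow> weight \<Rightarrow> nat" where
  "K_mult X r lam \<omega> = weight_mult X r (irrep X r lam) \<omega>"

text \<open>
  The exponents are nonnegative integers and the \<open>\<theta> i\<close> are positive, so that \<open>powr\<close> is the ordinary
  power.
\<close>

definition S_sum :: "lie_type \<Rightarrow> nat \<Rightarrow> (nat \<Rightarrow> nat) \<Rightarrow> (nat \<Rightarrow> real) \<Rightarrow> real" where
  "S_sum X r lam \<theta> =
    (\<Sum>\<omega>\<in>weights X r lam. real (K_mult X r lam \<omega>) *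
       (\<Prod>i\<in>index_set X r.
          \<theta> i powr inner_E r (\<lambda>j. partition_weight r lam j - \<omega> j) (fund_coweight X r i)))"

definition S_limit_A :: "(nat \<Rightarrow> nat) \<Rightarrow> (nat \<Rightarrow> real) \<Rightarrow> real" where
  "S_limit_A lam \<theta> = lim (\<lambda>r. S_sum Type_A r lam \<theta>)"

end

theory Submission
  imports Defs "HOL-Library.Function_Algebras"
begin

text \<open>
  Let \<open>\<lambda>\<close> be a partition of \<open>n\<close> and \<open>q = sup \<theta> < 1\<close>. A weight of \<open>V(\<lambda>)\<close> for one of the algebras
  of type \<open>B\<close>, \<open>C\<close>, \<open>D\<close> has coordinate sum at most \<open>n\<close>. The weights with sum exactly \<open>n\<close> are those
  for which the last simple root does not occur in \<open>\<lambda> - \<omega>\<close>. Together they form the module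
  \<open>V(\<lambda>)\<close> of the Levi subalgebra \<open>gl(r)\<close>, so they contribute exactly the sum of type \<open>A\<close>. The
  remaining weights are negligible: \<open>V(\<lambda>)\<close> sits inside the \<open>n\<close>-th tensor power of the vector
  representation, whose basis consists of the words of length \<open>n\<close> in \<open>lie_size X r\<close> letters, and a
  remaining weight belongs to a word with a letter that is not among the first \<open>r\<close>. Up to a
  factor that does not depend on \<open>r\<close>, a word contributes the product of the contributions of its
  letters. The first \<open>r\<close> letters contribute at most \<open>1, q, q\<^sup>2, \<dots>\<close>, with sum \<open>a\<^sub>r\<close>; each of the at
  most \<open>r + 1\<close> others contributes at most \<open>q\<close> to the power \<open>r - 2\<close>, with sum \<open>b\<^sub>r\<close>. The sums of type
  \<open>X\<close> and of type \<open>A\<close> thus differ by at most a constant times the difference of the \<open>n\<close>-th powers of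
  \<open>a\<^sub>r + b\<^sub>r\<close> and of \<open>a\<^sub>r\<close> (\<open>S_sum_bounds\<close>), and \<open>b\<^sub>r\<close> tends to \<open>0\<close>. The comparison of \<open>gl(r)\<close> with
  \<open>gl(r + 1)\<close> shows in the same way that the sums of type \<open>A\<close> increase; they are bounded by a constant
  times the \<open>n\<close>-th power of \<open>a\<^sub>r\<close>, hence convergent.

  The multiplicities are defined through an arbitrary choice of an irreducible module with the
  given highest weight, so existence and uniqueness of this module have to be shown. The concrete
  model is the submodule \<open>W\<close> of the tensor power that is generated by \<open>col_tensor ks\<close>, the tensor product
  of the antisymmetrisers of the columns of the Young diagram. The Lie algebras are closed under
  conjugate transposition, so the standard Hermitian form is contravariant, and this makes \<open>W\<close>
  irreducible (\<open>W_irreducible\<close>). If \<open>v\<close> is a highest weight vector of any irreducible module \<open>V\<close> of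
  the same highest weight, then the submodule of the direct sum of \<open>V\<close> and the tensor power that is
  generated by the pair of \<open>v\<close> and \<open>col_tensor ks\<close> is the graph of an isomorphism from \<open>V\<close> to \<open>W\<close>
  (\<open>R_zero_left\<close>, \<open>R_zero_right\<close>). Hence all multiplicities can be computed in \<open>W\<close>
  (\<open>irrep_multiplicities\<close>).

  Both parts rest on one fact about graded Lie algebras (\<open>triangular\<close>): a subspace that is stable
  under degree \<open>0\<close> and killed by positive degrees generates nothing but itself and vectors obtained
  by lowering. For the grading by height this says that the highest weight space is a line, for
  the grading by the coordinate sum that the top part of \<open>W\<close> is the module of the Levi subalgebra.
\<close>

section \<open>Graded Lie algebras of matrices and cyclic modules\<close>

definition smul :: "complex \<Rightarrow> ('a \<Rightarrow> complex) \<Rightarrow> 'a \<Rightarrow> complex" where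
  "smul c f = (\<lambda>i. c * f i)"

lemma smul_apply: "smul c f i = c * f i"
  by (simp add: smul_def)

text \<open>
  Functions are added as vectors. Without this declaration the simplifier would evaluate sums
  pointwise, also inside the arguments of linear maps.
\<close>

declare plus_fun_apply [simp del] zero_fun_apply [simp del] minus_apply [simp del]

lemmas fun_simps = fun_eq_iff smul_apply plus_fun_apply zero_fun_apply minus_apply

interpretation fs: vector_space smul
  by unfold_locales (auto simp: fun_simps algebra_simps)

text \<open>
  Grading an index set by \<open>\<delta>\<close> grades matrices: the entry \<open>(i, j)\<close> has degree \<open>\<delta> i - \<delta> j\<close>. The degrees
  are integers or weights, whence the general group.
\<close>

definition homog :: "(nat \<Rightarrow> 'g::ab_group_add) \<Rightarrow> 'g \<Rightarrow> complex mat \<Rightarrow> bool" where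
  "homog \<delta> k x \<longleftrightarrow> (\<forall>i<dim_row x. \<forall>j<dim_col x. x $$ (i,j) \<noteq> 0 \<longrightarrow> \<delta> i - \<delta> j = k)"

definition hom_part :: "(nat \<Rightarrow> 'g::ab_group_add) \<Rightarrow> 'g \<Rightarrow> complex mat \<Rightarrow> complex mat" where
  "hom_part \<delta> k x = mat (dim_row x) (dim_col x) (\<lambda>(i,j). if \<delta> i - \<delta> j = k then x $$ (i,j) else 0)"

lemma homog_hom_part: "homog \<delta> k (hom_part \<delta> k x)"
  by (auto simp: homog_def hom_part_def split: if_splits)

locale matrix_lie =
  fixes N :: nat and G :: "complex mat set"
  assumes carrier: "x \<in> G \<Longrightarrow> x \<in> carrier_mat N N"
    and zero: "0\<^sub>m N N \<in> G"
    and add: "x \<in> G \<Longrightarrow> y \<in> G \<Longrightarrow> x + y \<in> G"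
    and smult: "x \<in> G \<Longrightarrow> c \<cdot>\<^sub>m x \<in> G"
    and brack: "x \<in> G \<Longrightarrow> y \<in> G \<Longrightarrow> bracket x y \<in> G"
begin

lemma homog_bracket:
  assumes x: "x \<in> G" "homog \<delta> k x" and y: "y \<in> G" "homog \<delta> l y"
  shows "homog \<delta> (k + l) (bracket x y)"
proof -
  note c = carrier[OF x(1)] carrier[OF y(1)]
  have "\<delta> i - \<delta> j = k + l" if ij: "i < N" "j < N" and n: "bracket x y $$ (i,j) \<noteq> 0" for i j
  proof -
    have "bracket x y $$ (i,j) = (\<Sum>p<N. x $$ (i,p) * y $$ (p,j)) - (\<Sum>p<N. y $$ (i,p) * x $$ (p,j))"
      using c ij by (simp add: bracket_def scalar_prod_def atLeast0LessThan)
    then have "(\<Sum>p<N. x $$ (i,p) * y $$ (p,j)) \<noteq> 0 \<or> (\<Sum>p<N. y $$ (i,p) * x $$ (p,j)) \<noteq> 0"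
      using n by auto
    then obtain p where p: "p < N" "x $$ (i,p) * y $$ (p,j) \<noteq> 0 \<or> y $$ (i,p) * x $$ (p,j) \<noteq> 0"
      by (auto elim!: sum.not_neutral_contains_not_neutral)
    then show ?thesis
    proof (elim disjE)
      assume "x $$ (i,p) * y $$ (p,j) \<noteq> 0"
      then have "\<delta> i - \<delta> p = k" "\<delta> p - \<delta> j = l"
        using x(2) y(2) c ij p(1) by (auto simp: homog_def)
      then show ?thesis by (auto simp: algebra_simps)
    next
      assume "y $$ (i,p) * x $$ (p,j) \<noteq> 0"
      then have "\<delta> i - \<delta> p = l" "\<delta> p - \<delta> j = k"
        using x(2) y(2) c ij p(1) by (auto simp: homog_def)
      then show ?thesis by (auto simp: algebra_simps)
    qed
  qed
  then show ?thesis using c by (auto simp: homog_def bracket_def)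
qed

end

locale graded_lie = matrix_lie +
  fixes \<delta> :: "nat \<Rightarrow> 'g::ab_group_add"
  assumes hom_part_closed: "x \<in> G \<Longrightarrow> hom_part \<delta> k x \<in> G"
begin

text \<open>
  A matrix is the sum of its finitely many homogeneous components, so an additive property has to
  be checked on these components only.
\<close>

lemma graded_induct:
  assumes x: "x \<in> G" and P0: "P (0\<^sub>m N N)"
    and Padd: "\<And>x y. x \<in> G \<Longrightarrow> y \<in> G \<Longrightarrow> P x \<Longrightarrow> P y \<Longrightarrow> P (x + y)"
    and Pc: "\<And>k. P (hom_part \<delta> k x)"
  shows "P x"
proof -
  define part where "part D = mat N N (\<lambda>(i,j). if \<delta> i - \<delta> j \<in> D then x $$ (i,j) else 0)" for D
  note c = carrier[OF x]
  \<comment> \<open>the sum of the components of degree in \<open>D\<close>, one degree added at a time\<close>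
  have *: "finite D \<Longrightarrow> part D \<in> G \<and> P (part D)" for D
  proof (induction D rule: finite_induct)
    case empty
    have "part {} = 0\<^sub>m N N" by (auto simp: part_def)
    then show ?case using zero P0 by simp
  next
    case (insert k D)
    have "part (insert k D) = part D + hom_part \<delta> k x"
      using insert.hyps c by (auto simp: part_def hom_part_def)
    then show ?case using insert.IH add Padd Pc hom_part_closed[OF x] by metis
  qed
  have "part ((\<lambda>(i,j). \<delta> i - \<delta> j) ` ({..<N} \<times> {..<N})) = x"
    using c by (intro eq_matI) (auto simp: part_def)
  then show ?thesis using *[of "(\<lambda>(i,j). \<delta> i - \<delta> j) ` ({..<N} \<times> {..<N})"] by simp
qed

end

text \<open>
  The submodule generated by a vector.
\<close>

inductive_set cyc :: "(complex mat \<Rightarrow> ('a \<Rightarrow> complex) \<Rightarrow> 'a \<Rightarrow> complex) \<Rightarrow> complex mat set \<Rightarrow>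
    ('a \<Rightarrow> complex) \<Rightarrow> ('a \<Rightarrow> complex) set"
  for act G v where
  cyc_base: "v \<in> cyc act G v"
| cyc_add: "f \<in> cyc act G v \<Longrightarrow> g \<in> cyc act G v \<Longrightarrow> f + g \<in> cyc act G v"
| cyc_smul: "f \<in> cyc act G v \<Longrightarrow> smul c f \<in> cyc act G v"
| cyc_act: "x \<in> G \<Longrightarrow> f \<in> cyc act G v \<Longrightarrow> act x f \<in> cyc act G v"

lemma cyc_subspace: "fs.subspace (cyc act G v)"
proof (rule fs.subspaceI)
  have "smul 0 v \<in> cyc act G v" by (intro cyc.intros)
  then show "0 \<in> cyc act G v" by (simp add: fs.scale_zero_left)
qed (auto intro: cyc.intros)

locale lie_module = matrix_lie +
  fixes act :: "complex mat \<Rightarrow> ('a \<Rightarrow> complex) \<Rightarrow> 'a \<Rightarrow> complex"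
  assumes act_add: "x \<in> G \<Longrightarrow> act x (f + g) = act x f + act x g"
    and act_smul: "x \<in> G \<Longrightarrow> act x (smul c f) = smul c (act x f)"
    and add_act: "x \<in> G \<Longrightarrow> y \<in> G \<Longrightarrow> act (x + y) f = act x f + act y f"
    and smult_act: "x \<in> G \<Longrightarrow> act (c \<cdot>\<^sub>m x) f = smul c (act x f)"
    and bracket_act: "x \<in> G \<Longrightarrow> y \<in> G \<Longrightarrow> act (bracket x y) f = act x (act y f) - act y (act x f)"
begin

lemma act_zero [simp]: "x \<in> G \<Longrightarrow> act x 0 = 0"
  using act_smul[of x 0 0] by simp

lemma zero_act [simp]: "act (0\<^sub>m N N) f = 0"
proof -
  have "(0::complex) \<cdot>\<^sub>m (0\<^sub>m N N) = 0\<^sub>m N N" by auto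
  then show ?thesis using smult_act[OF zero, of 0 f] by simp
qed

lemma act_diff: "x \<in> G \<Longrightarrow> act x (f - g) = act x f - act x g"
proof -
  assume x: "x \<in> G"
  have m: "f - g = f + smul (-1) g" for f g :: "'a \<Rightarrow> complex"
    by (simp add: fun_simps)
  show ?thesis unfolding m act_add[OF x] act_smul[OF x] ..
qed

end

locale graded_module = lie_module + graded_lie N G \<delta>
  for \<delta> :: "nat \<Rightarrow> int"
begin

lemma act_mem_homog:
  assumes x: "x \<in> G" and S: "fs.subspace S"
    and c: "\<And>k y. y \<in> G \<Longrightarrow> homog \<delta> k y \<Longrightarrow> act y f \<in> S"
  shows "act x f \<in> S"
proof (rule graded_induct[OF x])
  show "act (0\<^sub>m N N) f \<in> S" using S by (simp add: fs.subspace_0)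
  show "act (x + y) f \<in> S" if "x \<in> G" "y \<in> G" "act x f \<in> S" "act y f \<in> S" for x y
    using that S by (simp add: add_act fs.subspace_add)
  show "act (hom_part \<delta> k x) f \<in> S" for k
    using x by (intro c[of _ k] hom_part_closed homog_hom_part)
qed

inductive_set lowered :: "('a \<Rightarrow> complex) set \<Rightarrow> ('a \<Rightarrow> complex) set" for A where
  lowered_base: "a \<in> A \<Longrightarrow> a \<in> lowered A"
| lowered_add: "f \<in> lowered A \<Longrightarrow> g \<in> lowered A \<Longrightarrow> f + g \<in> lowered A"
| lowered_act: "x \<in> G \<Longrightarrow> homog \<delta> k x \<Longrightarrow> k < 0 \<Longrightarrow> f \<in> lowered A \<Longrightarrow> act x f \<in> lowered A"

text \<open>
  By induction on lowered vectors: a lowering operator \<open>y\<close> and a homogeneous operator \<open>x\<close> satisfy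
  \<open>x y = [x, y] + y x\<close>, so \<open>lowered A\<close> is stable under the whole algebra once \<open>A\<close> is stable under degree
  \<open>0\<close> and killed by positive degrees. This replaces the Poincare-Birkhoff-Witt theorem.
\<close>

lemma triangular:
  assumes A: "fs.subspace A"
    and A0: "\<And>x a. x \<in> G \<Longrightarrow> homog \<delta> 0 x \<Longrightarrow> a \<in> A \<Longrightarrow> act x a \<in> A"
    and Ap: "\<And>x k a. x \<in> G \<Longrightarrow> homog \<delta> k x \<Longrightarrow> k > 0 \<Longrightarrow> a \<in> A \<Longrightarrow> act x a = 0"
    and L: "fs.subspace L"
    and Lm: "\<And>x k a l. x \<in> G \<Longrightarrow> homog \<delta> k x \<Longrightarrow> k < 0 \<Longrightarrow> a \<in> A \<Longrightarrow> l \<in> L \<Longrightarrow> act x (a + l) \<in> L"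
    and v: "v \<in> A" and w: "w \<in> cyc act G v"
  obtains a l where "a \<in> A" "l \<in> L" "w = a + l"
proof -
  have smulS: "smul c s \<in> lowered A" if "s \<in> lowered A" for c s
    using that
  proof induction
    case (lowered_base a)
    then show ?case by (intro lowered.lowered_base fs.subspace_scale[OF A])
  next
    case (lowered_add f g)
    then show ?case by (simp add: fs.scale_right_distrib lowered.lowered_add)
  next
    case (lowered_act x k f)
    show ?case unfolding act_smul[OF lowered_act.hyps(1), symmetric]
      by (rule lowered.lowered_act[OF lowered_act.hyps(1-3) lowered_act.IH])
  qed
  have zA: "0 \<in> A" using A by (simp add: fs.subspace_0)
  have S: "fs.subspace (lowered A)"
    by (rule fs.subspaceI) (simp_all add: lowered.lowered_base zA lowered.lowered_add smulS)
  have step: "act x s \<in> lowered A" if "s \<in> lowered A" "x \<in> G" "homog \<delta> k x" for x s k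
    using that
  proof (induction arbitrary: x k)
    case (lowered_base a)
    consider "k < 0" | "k = 0" | "k > 0" by linarith
    then show ?case
    proof cases
      case 1
      then show ?thesis
        by (rule lowered.lowered_act[OF lowered_base(2,3) _ lowered.lowered_base[OF lowered_base(1)]])
    next
      case 2
      then show ?thesis using A0 lowered_base by (simp add: lowered.lowered_base)
    next
      case 3
      then show ?thesis using Ap[OF lowered_base(2,3)] lowered_base(1) zA by (simp add: lowered.lowered_base)
    qed
  next
    case (lowered_add f g)
    show ?case unfolding act_add[OF lowered_add.prems(1)]
      by (rule lowered.lowered_add[OF lowered_add.IH(1)[OF lowered_add.prems]
            lowered_add.IH(2)[OF lowered_add.prems]])
  next
    case (lowered_act y m s)
    show ?case
    proof (cases "k < 0")
      case True
      then show ?thesis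
        by (intro lowered.lowered_act[OF lowered_act.prems True]
            lowered.lowered_act[OF lowered_act.hyps(1-3)] lowered_act.hyps(4))
    next
      case False
      have "act x (act y s) = act (bracket x y) s + act y (act x s)"
        using lowered_act.prems(1) lowered_act.hyps(1) by (simp add: bracket_act)
      moreover have "act (bracket x y) s \<in> lowered A"
        by (rule lowered_act.IH[OF brack homog_bracket,
              OF lowered_act.prems(1) lowered_act.hyps(1) lowered_act.prems lowered_act.hyps(1,2)])
      moreover have "act y (act x s) \<in> lowered A"
        by (rule lowered.lowered_act[OF lowered_act.hyps(1-3) lowered_act.IH[OF lowered_act.prems]])
      ultimately show ?thesis by (simp add: lowered.lowered_add)
    qed
  qed
  have wS: "w \<in> lowered A" using w
  proof induction
    case cyc_base then show ?case using v by (rule lowered.lowered_base)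
  next
    case (cyc_add f g) then show ?case by (rule_tac lowered.lowered_add)
  next
    case (cyc_smul f c) then show ?case by (rule_tac smulS)
  next
    case (cyc_act x f)
    show ?case by (rule act_mem_homog[OF cyc_act(1) S]) (rule step[OF cyc_act(3)])
  qed
  have "\<exists>a l. a \<in> A \<and> l \<in> L \<and> w = a + l" using wS
  proof induction
    case (lowered_base a)
    then show ?case using fs.subspace_0[OF L] by (intro exI[of _ a] exI[of _ 0]) simp
  next
    case (lowered_add f g)
    then obtain a l a' l' where "a \<in> A" "l \<in> L" "f = a + l" "a' \<in> A" "l' \<in> L" "g = a' + l'" by blast
    then have "a + a' \<in> A \<and> l + l' \<in> L \<and> f + g = (a + a') + (l + l')"
      by (simp add: fs.subspace_add[OF A] fs.subspace_add[OF L] add_ac)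
    then show ?case by blast
  next
    case (lowered_act x k f)
    obtain a l where "a \<in> A" "l \<in> L" "f = a + l" using lowered_act.IH by blast
    then have "act x f \<in> L" using Lm[OF lowered_act(1-3)] by simp
    then show ?case using zA by (intro exI[of _ 0] exI[of _ "act x f"]) simp
  qed
  then show thesis by (elim exE conjE) (rule that)
qed

end

text \<open>
  Applying \<open>h - (c - k)\<close> for \<open>k\<close> in \<open>ks\<close> successively kills sums of eigenvectors of \<open>h\<close> whose
  eigenvalues are among the \<open>c - k\<close>, and multiplies an eigenvector with eigenvalue \<open>c\<close> by the product
  of the \<open>k\<close>. With positive \<open>ks\<close> this separates the eigenvalue \<open>c\<close> from lower ones without a
  decomposition into eigenspaces.
\<close>

definition shifts :: "(complex mat \<Rightarrow> ('a \<Rightarrow> complex) \<Rightarrow> 'a \<Rightarrow> complex) \<Rightarrow> complex mat \<Rightarrow> complex \<Rightarrow> int list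
    \<Rightarrow> ('a \<Rightarrow> complex) \<Rightarrow> 'a \<Rightarrow> complex" where
  "shifts act h c ks = foldr (\<lambda>k f. act h f - smul (c - of_int k) f) ks"

lemma shifts_Nil [simp]: "shifts act h c [] f = f"
  and shifts_Cons [simp]: "shifts act h c (k # ks) f =
    act h (shifts act h c ks f) - smul (c - of_int k) (shifts act h c ks f)"
  and shifts_append: "shifts act h c (ks @ ks') f = shifts act h c ks (shifts act h c ks' f)"
  by (simp_all add: shifts_def)

context lie_module
begin

lemma shifts_add: "h \<in> G \<Longrightarrow> shifts act h c ks (f + g) = shifts act h c ks f + shifts act h c ks g"
  by (induction ks) (simp_all add: act_add fs.scale_right_distrib)

lemma shifts_smul: "h \<in> G \<Longrightarrow> shifts act h c ks (smul t f) = smul t (shifts act h c ks f)"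
  by (induction ks) (simp_all add: act_smul fs.scale_right_diff_distrib mult.commute)

lemma shifts_zero: "h \<in> G \<Longrightarrow> shifts act h c ks 0 = 0"
  using shifts_smul[of h c ks 0 0] by simp

lemma shifts_swap:
  assumes h: "h \<in> G"
  shows "shifts act h c ks (act h f - smul k f) = act h (shifts act h c ks f) - smul k (shifts act h c ks f)"
proof (induction ks)
  case (Cons a ks)
  show ?case unfolding shifts_Cons Cons.IH act_diff[OF h] act_smul[OF h]
    by (simp add: fun_simps algebra_simps)
qed simp

lemma shifts_commute:
  assumes h: "h \<in> G"
  shows "shifts act h c ks (shifts act h c ks' f) = shifts act h c ks' (shifts act h c ks f)"
proof (induction ks)
  case (Cons a ks)
  show ?case unfolding shifts_Cons Cons.IH shifts_swap[OF h] ..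
qed simp

lemma shifts_eigen:
  assumes h: "h \<in> G" and v: "act h v = smul c v"
  shows "shifts act h c ks v = smul (of_int (prod_list ks)) v"
proof (induction ks)
  case (Cons a ks)
  show ?case unfolding shifts_Cons Cons.IH act_smul[OF h] v
    by (simp add: fun_simps algebra_simps)
qed simp

lemma shifts_lower:
  assumes h: "h \<in> G" and y: "y \<in> G" and hy: "bracket h y = of_int k \<cdot>\<^sub>m y"
  shows "shifts act h c (map (\<lambda>j. j - k) ks) (act y f) = act y (shifts act h c ks f)"
proof (induction ks)
  case (Cons a ks)
  have swap: "act h (act y g) = act y (act h g) + smul (of_int k) (act y g)" for g
    using bracket_act[OF h y, of g] smult_act[OF y] hy by (simp add: algebra_simps)
  show ?case unfolding list.map shifts_Cons Cons.IH swap act_diff[OF y] act_smul[OF y]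
    by (simp add: fun_simps algebra_simps)
qed simp

end

lemma prod_list_pos: "\<forall>k\<in>set ks. k > 0 \<Longrightarrow> prod_list ks > (0::int)"
  by (induction ks) auto

context graded_module
begin

text \<open>
  The instance of \<open>triangular\<close> for a highest weight vector: up to vectors of lower height, a
  cyclic module contains only the multiples of the generator.
\<close>

lemma cyc_highest:
  assumes h: "h \<in> G" and hy: "\<And>x k. x \<in> G \<Longrightarrow> homog \<delta> k x \<Longrightarrow> bracket h x = of_int k \<cdot>\<^sub>m x"
    and v0: "\<And>x. x \<in> G \<Longrightarrow> homog \<delta> 0 x \<Longrightarrow> \<exists>t. act x v = smul t v"
    and vp: "\<And>x k. x \<in> G \<Longrightarrow> homog \<delta> k x \<Longrightarrow> k > 0 \<Longrightarrow> act x v = 0"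
    and col_tensor: "act h v = smul c v"
    and w: "w \<in> cyc act G v"
  obtains t l ks where "w = smul t v + l" "\<forall>k\<in>set ks. k > 0" "shifts act h c ks l = 0"
proof -
  define L where "L = {l. \<exists>ks. (\<forall>k\<in>set ks. k > 0) \<and> shifts act h c ks l = 0}"
  have LI: "l \<in> L" if "\<forall>k\<in>set ks. k > 0" "shifts act h c ks l = 0" for ks l
    using that L_def by auto
  have L0: "0 \<in> L" by (rule LI[of "[]"]) auto
  have Ladd: "f + g \<in> L" if fg: "f \<in> L" "g \<in> L" for f g
  proof -
    obtain ks ks' where *: "\<forall>k\<in>set ks. k > 0" "shifts act h c ks f = 0"
      "\<forall>k\<in>set ks'. k > 0" "shifts act h c ks' g = 0"
      using fg by (auto simp: L_def)
    have "shifts act h c (ks @ ks') (f + g) =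
      shifts act h c ks' (shifts act h c ks f) + shifts act h c ks (shifts act h c ks' g)"
      unfolding shifts_append shifts_add[OF h] shifts_commute[OF h, of c ks ks' f] ..
    then show ?thesis
      by (intro LI[of "ks @ ks'"]) (use * h in \<open>auto simp: shifts_zero\<close>)
  qed
  have L: "fs.subspace L"
  proof (rule fs.subspaceI)
    show "smul t l \<in> L" if l: "l \<in> L" for t l
    proof -
      obtain ks where *: "\<forall>k\<in>set ks. k > 0" "shifts act h c ks l = 0"
        using l by (auto simp: L_def)
      then show ?thesis by (intro LI[OF *(1)]) (simp add: shifts_smul[OF h])
    qed
  qed (use L0 Ladd in auto)
  have Lact: "act y l \<in> L" if y: "y \<in> G" "homog \<delta> k y" "k < 0" and l: "l \<in> L" for y k l
  proof -
    obtain ks where *: "\<forall>k\<in>set ks. k > 0" "shifts act h c ks l = 0"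
      using l by (auto simp: L_def)
    have "shifts act h c (map (\<lambda>j. j - k) ks) (act y l) = 0"
      unfolding shifts_lower[OF h y(1) hy[OF y(1,2)]] *(2) using y by simp
    moreover have "\<forall>k'\<in>set (map (\<lambda>j. j - k) ks). k' > 0" using *(1) y(3) by force
    ultimately show ?thesis by (rule LI[rotated])
  qed
  have Lv: "act y v \<in> L" if y: "y \<in> G" "homog \<delta> k y" "k < 0" for y k
  \<comment> \<open>\<open>y v\<close> has eigenvalue \<open>c + k\<close> with \<open>k\<close> negative\<close>
  proof (rule LI[of "[0 - k]"])
    have "shifts act h c (map (\<lambda>j. j - k) [0]) (act y v) = act y (shifts act h c [0] v)"
      by (rule shifts_lower[OF h y(1) hy[OF y(1,2)]])
    also have "shifts act h c [0] v = 0" by (simp add: col_tensor)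
    finally show "shifts act h c [0 - k] (act y v) = 0" using y by simp
  qed (use y in auto)
  define A where "A = {smul t v | t. True}"
  have A: "fs.subspace A"
  proof (rule fs.subspaceI)
    show "0 \<in> A" by (auto simp: A_def intro!: exI[of _ 0])
  next
    fix x y assume "x \<in> A" "y \<in> A"
    then obtain s t where "x = smul s v" "y = smul t v" by (auto simp: A_def)
    then have "x + y = smul (s + t) v" by (simp add: fs.scale_left_distrib)
    then show "x + y \<in> A" by (auto simp: A_def)
  next
    fix k x assume "x \<in> A"
    then show "smul k x \<in> A" by (auto simp: A_def)
  qed
  have vA: "v \<in> A" by (auto simp: A_def intro!: exI[of _ 1])
  obtain a l where al: "a \<in> A" "l \<in> L" "w = a + l"
  proof (rule triangular[OF A _ _ L _ vA w])
    fix x a assume "x \<in> G" "homog \<delta> 0 x" "a \<in> A"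
    then obtain s where s: "a = smul s v" by (auto simp: A_def)
    obtain t where t: "act x v = smul t v" using v0[OF \<open>x \<in> G\<close> \<open>homog \<delta> 0 x\<close>] by (elim exE)
    have "act x a = smul (s * t) v" unfolding s act_smul[OF \<open>x \<in> G\<close>] t by simp
    then show "act x a \<in> A" by (auto simp: A_def)
  next
    fix x k a assume "x \<in> G" "homog \<delta> k x" "0 < k" "a \<in> A"
    then obtain s where s: "a = smul s v" by (auto simp: A_def)
    show "act x a = 0"
      unfolding s act_smul[OF \<open>x \<in> G\<close>] vp[OF \<open>x \<in> G\<close> \<open>homog \<delta> k x\<close> \<open>0 < k\<close>] by simp
  next
    fix x k a l assume *: "x \<in> G" "homog \<delta> k x" "k < 0" "a \<in> A" "l \<in> L"
    then obtain s where s: "a = smul s v" by (auto simp: A_def)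
    have "act x (a + l) = smul s (act x v) + act x l"
      unfolding s act_add[OF *(1)] act_smul[OF *(1)] ..
    then show "act x (a + l) \<in> L"
      using fs.subspace_add[OF L fs.subspace_scale[OF L Lv[OF *(1-3)]] Lact[OF *(1-3,5)]] by simp
  qed
  obtain t where "a = smul t v" using al(1) by (auto simp: A_def)
  moreover obtain ks where "\<forall>k\<in>set ks. k > 0" "shifts act h c ks l = 0"
    using al(2) by (auto simp: L_def)
  ultimately show thesis using al(3) by (intro that[of t l ks]) auto
qed

end

section \<open>Tensor powers of the vector representation\<close>

definition ent :: "complex mat \<Rightarrow> nat \<Rightarrow> nat \<Rightarrow> complex" where
  "ent x i j = (if i < dim_row x \<and> j < dim_col x then x $$ (i,j) else 0)"

text \<open>
  A tensor is the function of its coordinates in the basis of words. A matrix acts as a derivation,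
  letter by letter.
\<close>

fun tact :: "complex mat \<Rightarrow> (nat list \<Rightarrow> complex) \<Rightarrow> nat list \<Rightarrow> complex" where
  "tact x f [] = 0"
| "tact x f (a # w) = (\<Sum>j<dim_col x. ent x a j * f (j # w)) + tact x (\<lambda>u. f (a # u)) w"

lemma tact_sum:
  "finite K \<Longrightarrow> tact x (\<lambda>u. \<Sum>k\<in>K. c k * F k u) w = (\<Sum>k\<in>K. c k * tact x (F k) w)"
proof (induction w arbitrary: F)
  case (Cons a w)
  have "(\<Sum>j<dim_col x. ent x a j * (\<Sum>k\<in>K. c k * F k (j # w))) =
    (\<Sum>k\<in>K. c k * (\<Sum>j<dim_col x. ent x a j * F k (j # w)))"
    by (simp add: sum_distrib_left sum.swap[of _ K] algebra_simps)
  then show ?case using Cons by (simp add: sum.distrib[symmetric] distrib_left[symmetric])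
qed simp

lemma tact_add: "tact x (f + g) = tact x f + tact x g"
proof
  fix w show "tact x (f + g) w = (tact x f + tact x g) w"
  proof (induction w arbitrary: f g)
    case (Cons a w)
    have "(\<lambda>u. (f + g) (a # u)) = (\<lambda>u. f (a # u)) + (\<lambda>u. g (a # u))"
      by (simp add: fun_simps)
    then show ?case using Cons[of "\<lambda>u. f (a # u)" "\<lambda>u. g (a # u)"]
      by (simp add: plus_fun_apply sum.distrib algebra_simps)
  qed (simp add: plus_fun_apply)
qed

lemma tact_smul: "tact x (smul c f) = smul c (tact x f)"
proof
  fix w show "tact x (smul c f) w = smul c (tact x f) w"
    using tact_sum[of "{()}" x "\<lambda>_. c" "\<lambda>_. f" w] by (simp add: smul_def)
qed

lemma add_tact:
  assumes "x \<in> carrier_mat N N" "y \<in> carrier_mat N N"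
  shows "tact (x + y) f = tact x f + tact y f"
proof
  fix w show "tact (x + y) f w = (tact x f + tact y f) w"
  proof (induction w arbitrary: f)
    case (Cons a w)
    have "ent (x + y) a j = ent x a j + ent y a j" for j
      using assms by (simp add: ent_def)
    then show ?case using Cons[of "\<lambda>u. f (a # u)"] assms
      by (simp add: plus_fun_apply sum.distrib algebra_simps)
  qed (simp add: plus_fun_apply)
qed

lemma smult_tact: "tact (c \<cdot>\<^sub>m x) f = smul c (tact x f)"
proof
  fix w show "tact (c \<cdot>\<^sub>m x) f w = smul c (tact x f) w"
  proof (induction w arbitrary: f)
    case (Cons a w)
    have "ent (c \<cdot>\<^sub>m x) a j = c * ent x a j" for j
      by (simp add: ent_def)
    then show ?case using Cons[of "\<lambda>u. f (a # u)"]
      by (simp add: smul_apply sum_distrib_left algebra_simps)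
  qed (simp add: smul_apply)
qed

lemma bracket_tact:
  assumes c: "x \<in> carrier_mat N N" "y \<in> carrier_mat N N"
  shows "tact (bracket x y) f = tact x (tact y f) - tact y (tact x f)"
proof
  fix w show "tact (bracket x y) f w = (tact x (tact y f) - tact y (tact x f)) w"
  proof (induction w arbitrary: f)
    case (Cons a w)
    have e: "ent (bracket x y) i j = (\<Sum>k<N. ent x i k * ent y k j) - (\<Sum>k<N. ent y i k * ent x k j)" for i j
      using c by (simp add: ent_def bracket_def scalar_prod_def atLeast0LessThan)
    have double: "tact x (tact y f) (a # w) =
        (\<Sum>j<N. (\<Sum>k<N. ent x a k * ent y k j) * f (j # w))
        + (\<Sum>j<N. ent x a j * tact y (\<lambda>u. f (j # u)) w)
        + (\<Sum>j<N. ent y a j * tact x (\<lambda>u. f (j # u)) w)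
        + tact x (tact y (\<lambda>u. f (a # u))) w"
      if "x \<in> carrier_mat N N" "y \<in> carrier_mat N N" for x y
    proof -
      have "tact x (\<lambda>u. (\<Sum>j<N. ent y a j * f (j # u)) + tact y (\<lambda>u. f (a # u)) u) w
        = (tact x (\<lambda>u. \<Sum>j<N. ent y a j * f (j # u)) + tact x (tact y (\<lambda>u. f (a # u)))) w"
        unfolding tact_add[symmetric] by (simp add: plus_fun_def)
      moreover have "(\<Sum>j<N. ent x a j * (\<Sum>k<N. ent y j k * f (k # w))) =
        (\<Sum>j<N. (\<Sum>k<N. ent x a k * ent y k j) * f (j # w))"
        by (simp add: sum_distrib_left sum_distrib_right mult.assoc, rule sum.swap)
      ultimately show ?thesis using that
        by (simp add: plus_fun_apply tact_sum[of "{..<N}" _ _ "\<lambda>j u. f (j # u)"]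
            distrib_left sum.distrib)
    qed
    have "tact (bracket x y) f (a # w) = (\<Sum>j<N. ent (bracket x y) a j * f (j # w))
        + tact (bracket x y) (\<lambda>u. f (a # u)) w"
      using c by (simp add: bracket_def)
    also have "\<dots> = tact x (tact y f) (a # w) - tact y (tact x f) (a # w)"
      unfolding double[OF c] double[OF c(2,1)] Cons.IH e
      by (simp add: minus_apply left_diff_distrib sum_subtractf)
    finally show ?case by (simp only: minus_apply)
  qed (simp add: minus_apply)
qed

lemma (in matrix_lie) tensor_module: "lie_module N G tact"
  by unfold_locales (auto simp: tact_add tact_smul smult_tact
      intro: add_tact[OF carrier carrier] bracket_tact[OF carrier carrier])

text \<open>
  The same action as a sum over the position of the letter that is changed.
\<close>

lemma tact_positions:
  "tact x f w = (\<Sum>p<length w. \<Sum>j<dim_col x. ent x (w ! p) j * f (w[p := j]))"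
proof (induction w arbitrary: f)
  case (Cons a w)
  show ?case
    by (simp add: Cons.IH sum.lessThan_Suc_shift del: sum.lessThan_Suc)
qed simp

text \<open>
  The tensor product, with the factors read off from the first \<open>k\<close> letters and from the others.
\<close>

definition tens :: "nat \<Rightarrow> (nat list \<Rightarrow> complex) \<Rightarrow> (nat list \<Rightarrow> complex) \<Rightarrow> nat list \<Rightarrow> complex" where
  "tens k f g w = f (take k w) * g (drop k w)"

lemma tact_tens: "tact x (tens k f g) = tens k (tact x f) g + tens k f (tact x g)"
proof
  fix w show "tact x (tens k f g) w = (tens k (tact x f) g + tens k f (tact x g)) w"
  proof (induction k arbitrary: f w)
    case 0
    have "tens 0 f g = smul (f []) g" by (simp add: tens_def smul_apply fun_eq_iff)
    then show ?case by (simp add: tact_smul) (simp add: plus_fun_apply tens_def smul_apply)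
  next
    case (Suc k)
    show ?case
    proof (cases w)
      case (Cons a u)
      have "(\<lambda>v. tens (Suc k) f g (a # v)) = tens k (\<lambda>v. f (a # v)) g"
        by (simp add: tens_def fun_eq_iff)
      then show ?thesis using Cons Suc[of "\<lambda>v. f (a # v)" u]
        by (simp add: plus_fun_apply tens_def algebra_simps sum_distrib_left sum_distrib_right)
    qed (simp add: tens_def plus_fun_apply)
  qed
qed

definition words :: "nat \<Rightarrow> nat \<Rightarrow> nat list set" where
  "words N n = {w. set w \<subseteq> {..<N} \<and> length w = n}"

lemma finite_words [simp]: "finite (words N n)"
  unfolding words_def by (rule finite_lists_length_eq) simp

lemma words_Suc: "words N (Suc n) = (\<lambda>(a, w). a # w) ` ({..<N} \<times> words N n)"
  by (force simp: words_def length_Suc_conv image_iff)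

lemma sum_words_Suc: "(\<Sum>w\<in>words N (Suc n). F w) = (\<Sum>a<N. \<Sum>w\<in>words N n. F (a # w))"
  unfolding words_Suc
  by (subst sum.reindex) (auto simp: inj_on_def sum.cartesian_product case_prod_unfold)

definition tensors :: "nat \<Rightarrow> nat \<Rightarrow> (nat list \<Rightarrow> complex) set" where
  "tensors N n = {f. \<forall>w. f w \<noteq> 0 \<longrightarrow> w \<in> words N n}"

lemma tensors_subspace: "fs.subspace (tensors N n)"
  by (rule fs.subspaceI) (auto simp: tensors_def fun_simps, force)

lemma tact_tensors:
  assumes x: "x \<in> carrier_mat N N" and f: "f \<in> tensors N n"
  shows "tact x f \<in> tensors N n"
  unfolding tensors_def
proof (intro CollectI allI impI)
  fix w assume "tact x f w \<noteq> 0"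
  then have "(\<Sum>p<length w. \<Sum>j<N. ent x (w ! p) j * f (w[p := j])) \<noteq> 0"
    using x unfolding tact_positions by simp
  then obtain p where p: "p \<in> {..<length w}" "(\<Sum>j<N. ent x (w ! p) j * f (w[p := j])) \<noteq> 0"
    by (rule sum.not_neutral_contains_not_neutral)
  from p(2) obtain j where "j \<in> {..<N}" "ent x (w ! p) j * f (w[p := j]) \<noteq> 0"
    by (rule sum.not_neutral_contains_not_neutral)
  then have j: "j < N" "ent x (w ! p) j \<noteq> 0" "f (w[p := j]) \<noteq> 0" by auto
  then have w: "w[p := j] \<in> words N n" using f by (auto simp: tensors_def)
  have "w ! q < N" if q: "q < length w" for q
  proof (cases "q = p")
    case True
    then show ?thesis using j(2) x by (auto simp: ent_def split: if_splits)
  next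
    case False
    have "w[p := j] ! q \<in> set (w[p := j])" using q by (simp del: nth_list_update)
    then show ?thesis using w False by (auto simp: words_def)
  qed
  then show "w \<in> words N n" using w by (auto simp: words_def in_set_conv_nth)
qed

lemma cyc_tensors:
  assumes "G \<subseteq> carrier_mat N N" "v \<in> tensors N n"
  shows "cyc tact G v \<subseteq> tensors N n"
proof
  fix f assume "f \<in> cyc tact G v"
  then show "f \<in> tensors N n"
    by induction (use assms tensors_subspace in \<open>auto intro: fs.subspace_add fs.subspace_scale tact_tensors\<close>)
qed

definition form :: "nat \<Rightarrow> nat \<Rightarrow> (nat list \<Rightarrow> complex) \<Rightarrow> (nat list \<Rightarrow> complex) \<Rightarrow> complex" where
  "form N n f g = (\<Sum>w\<in>words N n. f w * cnj (g w))"

definition dag :: "complex mat \<Rightarrow> complex mat" where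
  "dag x = mat (dim_col x) (dim_row x) (\<lambda>(i,j). cnj (x $$ (j,i)))"

lemma form_add_left: "form N n (f + f') g = form N n f g + form N n f' g"
  and form_add_right: "form N n f (g + g') = form N n f g + form N n f g'"
  and form_smul_left: "form N n (smul c f) g = c * form N n f g"
  and form_smul_right: "form N n f (smul c g) = cnj c * form N n f g"
  by (simp_all add: form_def plus_fun_apply smul_apply algebra_simps sum.distrib sum_distrib_left)

text \<open>
  Contravariance. The form on words of length \<open>n + 1\<close> is the sum over the first letter of the
  form on words of length \<open>n\<close>, which matches the recursion of the action.
\<close>

lemma form_tact:
  assumes x: "x \<in> carrier_mat N N"
  shows "form N n (tact x f) g = form N n f (tact (dag x) g)"
proof (induction n arbitrary: f g)
  case 0
  have "words N 0 = {[]}" by (auto simp: words_def)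
  then show ?case by (simp add: form_def)
next
  case (Suc n)
  have d: "ent (dag x) i j = cnj (ent x j i)" for i j
    using x by (simp add: ent_def dag_def)
  have S: "form N (Suc n) f g = (\<Sum>a<N. form N n (\<lambda>w. f (a # w)) (\<lambda>w. g (a # w)))" for f g
    unfolding form_def sum_words_Suc ..
  have "(\<Sum>a<N. \<Sum>w\<in>words N n. (\<Sum>j<N. ent x a j * f (j # w)) * cnj (g (a # w))) =
    (\<Sum>a<N. \<Sum>w\<in>words N n. \<Sum>j<N. ent x a j * f (j # w) * cnj (g (a # w)))"
    by (simp add: sum_distrib_right)
  also have "\<dots> = (\<Sum>a<N. \<Sum>j<N. \<Sum>w\<in>words N n. ent x a j * f (j # w) * cnj (g (a # w)))"
    by (intro sum.cong refl sum.swap)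
  also have "\<dots> = (\<Sum>j<N. \<Sum>a<N. \<Sum>w\<in>words N n. ent x a j * f (j # w) * cnj (g (a # w)))"
    by (rule sum.swap)
  also have "\<dots> = (\<Sum>j<N. \<Sum>w\<in>words N n. \<Sum>a<N. ent x a j * f (j # w) * cnj (g (a # w)))"
    by (intro sum.cong refl sum.swap)
  also have "\<dots> = (\<Sum>j<N. \<Sum>w\<in>words N n. f (j # w) * cnj (\<Sum>a<N. ent (dag x) j a * g (a # w)))"
    by (simp add: d sum_distrib_left algebra_simps)
  finally have 1: "(\<Sum>a<N. \<Sum>w\<in>words N n. (\<Sum>j<N. ent x a j * f (j # w)) * cnj (g (a # w))) = \<dots>" .
  have "form N (Suc n) (tact x f) g =
      (\<Sum>a<N. \<Sum>w\<in>words N n. (\<Sum>j<N. ent x a j * f (j # w)) * cnj (g (a # w)))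
    + (\<Sum>a<N. form N n (tact x (\<lambda>u. f (a # u))) (\<lambda>w. g (a # w)))"
    using x unfolding S by (simp add: form_def algebra_simps sum.distrib)
  also have "\<dots> = (\<Sum>j<N. \<Sum>w\<in>words N n. f (j # w) * cnj (\<Sum>a<N. ent (dag x) j a * g (a # w)))
    + (\<Sum>a<N. form N n (\<lambda>u. f (a # u)) (tact (dag x) (\<lambda>w. g (a # w))))"
    unfolding 1 Suc.IH ..
  also have "\<dots> = form N (Suc n) f (tact (dag x) g)"
    using x unfolding S by (simp add: form_def dag_def algebra_simps sum.distrib)
  finally show ?case .
qed

lemma form_definite:
  assumes f: "f \<in> tensors N n" and 0: "form N n f f = 0"
  shows "f = 0"
proof -
  have "form N n f f = of_real (\<Sum>w\<in>words N n. (cmod (f w))\<^sup>2)"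
    by (simp add: form_def complex_norm_square[symmetric])
  then have "(\<Sum>w\<in>words N n. (cmod (f w))\<^sup>2) = 0" using 0 by (metis of_real_eq_0_iff)
  then have "\<forall>w\<in>words N n. f w = 0" by (subst (asm) sum_nonneg_eq_0_iff) auto
  then show ?thesis using f by (auto simp: tensors_def fun_simps)
qed

text \<open>
  The antisymmetriser of the first \<open>k\<close> basis vectors: the sign of the word as a permutation.
\<close>

definition col :: "nat \<Rightarrow> nat list \<Rightarrow> complex" where
  "col k w = (if length w = k \<and> set w = {..<k}
     then det (mat k k (\<lambda>(i,j). if w ! i = j then 1 else 0)) else 0)"

lemma col_swap:
  assumes w: "length w = k" and p: "p < k" "q < k" "p \<noteq> q"
  shows "col k (w[p := w ! q, q := w ! p]) = - col k w"
proof -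
  let ?w = "w[p := w ! q, q := w ! p]"
  let ?M = "\<lambda>w. mat k k (\<lambda>(i,j). if w ! i = j then 1 else 0 :: complex)"
  have "?M ?w = swaprows p q (?M w)"
    using p w by (intro eq_matI) (auto simp: mat_swaprows_def nth_list_update)
  moreover have "set ?w = set w" using p w by (simp add: set_swap)
  moreover have "det (swaprows p q (?M w)) = - det (?M w)"
    by (rule det_swaprows[OF p(1,2,3)]) simp
  ultimately show ?thesis using w by (simp add: col_def)
qed

text \<open>
  Turning a letter \<open>j\<close> into a smaller letter \<open>a\<close> produces words with the letter \<open>a\<close> at two positions;
  the two ways to obtain such a word carry opposite signs.
\<close>

lemma col_raise:
  assumes "a < j" "j < k"
  shows "(\<Sum>p<length w. if w ! p = a then col k (w[p := j]) else 0) = 0"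
proof (cases "\<exists>p<length w. w ! p = a \<and> col k (w[p := j]) \<noteq> 0")
  case False
  then have "(\<Sum>p<length w. if w ! p = a then col k (w[p := j]) else 0) = (\<Sum>p<length w. 0)"
    by (intro sum.cong) auto
  then show ?thesis by simp
next
  case True
  then obtain p where p: "p < length w" "w ! p = a" "col k (w[p := j]) \<noteq> 0" by blast
  define u where "u = w[p := j]"
  have u: "length u = k" "set u = {..<k}" using p(3) by (auto simp: col_def u_def split: if_splits)
  have d: "distinct u" using u by (simp add: card_distinct)
  have letter_wt: "length w = k" using u by (simp add: u_def)
  obtain q where q: "q < k" "u ! q = a" using u assms by (metis in_set_conv_nth lessThan_iff less_trans)
  have qp: "q \<noteq> p" using q p assms letter_wt by (auto simp: u_def)
  have wq: "w ! q = a" using q qp by (simp add: u_def)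
  have only: "s = p \<or> s = q" if s: "s < k" "w ! s = a" for s
  proof (cases "s = p")
    case False
    then have "u ! s = u ! q" using s q by (simp add: u_def)
    then show ?thesis using nth_eq_iff_index_eq[OF d, of s q] u s q by simp
  qed simp
  have up: "u ! p = j" using p letter_wt by (simp add: u_def)
  have "w[q := j] = u[p := u ! q, q := u ! p]"
    using p(2) unfolding q up by (simp add: u_def) (metis list_update_id)
  then have "col k (w[q := j]) = - col k u"
    using col_swap[OF u(1), of p q] p q qp letter_wt by simp
  moreover have "(\<Sum>s<length w. if w ! s = a then col k (w[s := j]) else 0)
    = (\<Sum>s\<in>{p, q}. col k (w[s := j]))"
    by (rule sum.mono_neutral_cong_right) (use p q wq only letter_wt in auto)
  ultimately show ?thesis using qp by (simp add: u_def)
qed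

lemma tact_col:
  assumes x: "\<And>a j. j < k \<Longrightarrow> a \<ge> j \<Longrightarrow> ent x a j = 0"
  shows "tact x (col k) = 0"
proof
  fix w
  have z: "(\<Sum>p<length w. ent x (w ! p) j * col k (w[p := j])) = 0" for j
  proof (cases "j < k")
    case False
    then have "col k (w[p := j]) = 0" if "p < length w" for p
      using set_update_memI[OF that, of j] by (auto simp: col_def)
    then show ?thesis by simp
  next
    case True
    have "(\<Sum>p<length w. ent x (w ! p) j * col k (w[p := j])) =
      (\<Sum>p<length w. \<Sum>a<j. ent x a j * (if w ! p = a then col k (w[p := j]) else 0))"
      using x[OF True] by (intro sum.cong refl) (auto simp: if_distrib[of "(*) _"] sum.delta cong: if_cong)
    also have "\<dots> = (\<Sum>a<j. ent x a j * (\<Sum>p<length w. if w ! p = a then col k (w[p := j]) else 0))"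
      by (subst sum.swap) (simp add: sum_distrib_left)
    also have "\<dots> = 0" using col_raise[OF _ True] by simp
    finally show ?thesis .
  qed
  show "tact x (col k) w = 0 w"
    unfolding tact_positions by (subst sum.swap) (simp add: z zero_fun_apply)
qed

text \<open>
  The highest weight vector attached to the list \<open>ks\<close> of column lengths.
\<close>

fun col_tensor :: "nat list \<Rightarrow> nat list \<Rightarrow> complex" where
  "col_tensor [] = (\<lambda>w. if w = [] then 1 else 0)"
| "col_tensor (k # ks) = tens k (col k) (col_tensor ks)"

lemma tact_col_tensor:
  assumes "\<And>a j k. k \<in> set ks \<Longrightarrow> j < k \<Longrightarrow> a \<ge> j \<Longrightarrow> ent x a j = 0"
  shows "tact x (col_tensor ks) = 0"
  using assms
proof (induction ks)
  case Nil
  have "tact x (col_tensor []) w = 0" for w unfolding tact_positions by (simp add: sum.neutral)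
  then show ?case by (simp add: fun_simps)
next
  case (Cons k ks)
  have "tact x (col k) = 0" by (rule tact_col, rule Cons.prems[of k]) auto
  moreover have "tact x (col_tensor ks) = 0" by (rule Cons.IH, rule Cons.prems) auto
  ultimately show ?case by (simp add: tact_tens) (simp add: tens_def fun_simps)
qed

lemma count_list_distinct: "distinct xs \<Longrightarrow> count_list xs i = (if i \<in> set xs then 1 else 0)"
  by (induction xs) auto

lemma col_tensor_support:
  "col_tensor ks w \<noteq> 0 \<Longrightarrow> length w = sum_list ks \<and> (\<forall>i. count_list w i = length (filter (\<lambda>k. i < k) ks))"
proof (induction ks arbitrary: w)
  case Nil
  then show ?case by (auto split: if_splits)
next
  case (Cons k ks)
  then have c: "length (take k w) = k" "set (take k w) = {..<k}" "col_tensor ks (drop k w) \<noteq> 0"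
    by (auto simp: tens_def col_def split: if_splits)
  have "distinct (take k w)" using c by (simp only: card_distinct card_lessThan)
  then have "count_list (take k w) i = (if i < k then 1 else 0)" for i
    using c(2) by (simp add: count_list_distinct)
  moreover have "count_list w i = count_list (take k w) i + count_list (drop k w) i" for i
    using count_list_append[of "take k w" "drop k w" i] by simp
  moreover have "k \<le> length w" using c(1) by simp
  ultimately show ?case using Cons.IH[OF c(3)] by simp arith
qed

lemma col_tensor_nonzero: "col_tensor ks (concat (map (\<lambda>k. [0..<k]) ks)) = 1"
proof (induction ks)
  case (Cons k ks)
  have "mat k k (\<lambda>(i,j). if [0..<k] ! i = j then 1 else 0) = (1\<^sub>m k :: complex mat)"
    by (rule eq_matI) simp_all
  then have "col k [0..<k] = 1" by (simp add: col_def atLeast0LessThan det_one)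
  then show ?case using Cons by (simp add: tens_def)
qed simp

lemma tact_diag:
  "tact (mat_diag N \<tau>) f w = (\<Sum>a\<leftarrow>w. if a < N then \<tau> a else 0) * f w"
proof (induction w arbitrary: f)
  case (Cons a w)
  have "(\<Sum>j<N. ent (mat_diag N \<tau>) a j * f (j # w)) = (\<Sum>j<N. if j = a then \<tau> a * f (a # w) else 0)"
    by (intro sum.cong refl) (auto simp: ent_def mat_diag_def)
  also have "\<dots> = (if a < N then \<tau> a else 0) * f (a # w)"
    by simp
  finally have "(\<Sum>j<N. ent (mat_diag N \<tau>) a j * f (j # w)) = (if a < N then \<tau> a else 0) * f (a # w)" .
  moreover have "dim_col (mat_diag N \<tau>) = N" by (simp add: mat_diag_def)
  ultimately show ?case using Cons by (simp add: distrib_right)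
qed simp

definition corner :: "nat \<Rightarrow> complex mat \<Rightarrow> complex mat" where
  "corner r x = mat r r (\<lambda>(i,j). x $$ (i,j))"

text \<open>
  On tensors in the first \<open>r\<close> letters a block triangular matrix acts through its upper left
  block.
\<close>

lemma tact_corner:
  assumes f: "f \<in> tensors r n" and r: "r \<le> N" and x: "x \<in> carrier_mat N N"
    and z: "\<And>a j. r \<le> a \<Longrightarrow> a < N \<Longrightarrow> j < r \<Longrightarrow> x $$ (a,j) = 0"
  shows "tact x f = tact (corner r x) f"
proof
  fix w
  have "(\<Sum>j<N. ent x (w ! p) j * f (w[p := j])) = (\<Sum>j<r. ent (corner r x) (w ! p) j * f (w[p := j]))"
    if p: "p < length w" for p
  proof (rule sum.mono_neutral_cong_right)
    show "\<forall>i\<in>{..<N} - {..<r}. ent x (w ! p) i * f (w[p := i]) = 0"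
    proof
      fix i assume i: "i \<in> {..<N} - {..<r}"
      then have "w[p := i] \<notin> words r n" using set_update_memI[OF p, of i] by (auto simp: words_def)
      then show "ent x (w ! p) i * f (w[p := i]) = 0" using f by (auto simp: tensors_def)
    qed
  qed (use r x z in \<open>auto simp: ent_def corner_def not_less\<close>)
  then show "tact x f w = tact (corner r x) f w"
    using x unfolding tact_positions by (simp add: corner_def)
qed

section \<open>The classical Lie algebras in coordinates\<close>

text \<open>
  The bilinear form pairs the basis vector \<open>i\<close> with \<open>dual_idx r i\<close>, with sign \<open>dual_sgn X r i\<close>.
\<close>

definition dual_idx :: "nat \<Rightarrow> nat \<Rightarrow> nat" where
  "dual_idx r i = (if i < r then i + r else if i < 2 * r then i - r else i)"

definition dual_sgn :: "lie_type \<Rightarrow> nat \<Rightarrow> nat \<Rightarrow> complex" where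
  "dual_sgn X r i = (if X = Type_C \<and> r \<le> i then -1 else 1)"

definition pairing :: "lie_type \<Rightarrow> nat \<Rightarrow> complex mat" where
  "pairing X r = (case X of Type_B \<Rightarrow> odd_sym_form r | Type_C \<Rightarrow> alt_form r | _ \<Rightarrow> sym_form r)"

lemma lie_size_bounds: "X \<noteq> Type_A \<Longrightarrow> lie_size X r \<in> {2 * r, 2 * r + 1}"
  "r \<le> lie_size X r"
  by (cases X; simp add: lie_size_def)+

lemma lie_size_less: "i < lie_size X r \<Longrightarrow> i < 2 * r + 1"
  by (cases X) (auto simp: lie_size_def)

lemma dual_idx_less: "X \<noteq> Type_A \<Longrightarrow> i < lie_size X r \<Longrightarrow> dual_idx r i < lie_size X r"
  by (cases X) (auto simp: lie_size_def dual_idx_def)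

lemma dual_idx_dual_idx [simp]: "dual_idx r (dual_idx r i) = i"
  by (auto simp: dual_idx_def)

lemma dual_sgn_sq: "dual_sgn X r i * dual_sgn X r i = 1"
  by (simp add: dual_sgn_def)

lemma pairing_carrier: "X \<noteq> Type_A \<Longrightarrow> pairing X r \<in> carrier_mat (lie_size X r) (lie_size X r)"
  by (cases X) (auto simp: pairing_def lie_size_def sym_form_def alt_form_def odd_sym_form_def)

lemma pairing_entry:
  assumes "X \<noteq> Type_A" "i < lie_size X r" "j < lie_size X r"
  shows "pairing X r $$ (i,j) = (if j = dual_idx r i then dual_sgn X r i else 0)"
  using assms
  by (cases X) (auto simp: pairing_def lie_size_def sym_form_def alt_form_def odd_sym_form_def
      dual_idx_def dual_sgn_def)

lemma lie_alg_pairing: "X \<noteq> Type_A \<Longrightarrow> lie_alg X r = preserving_algebra (lie_size X r) (pairing X r)"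
  by (cases X) (auto simp: lie_alg_def lie_size_def pairing_def)

text \<open>
  Each entry of the defining equation of the algebra involves two entries of \<open>x\<close>, exchanged by an
  involution. All closure properties of the algebras are read off from this form.
\<close>

lemma lie_alg_iff:
  assumes X: "X \<noteq> Type_A"
  shows "x \<in> lie_alg X r \<longleftrightarrow> x \<in> carrier_mat (lie_size X r) (lie_size X r) \<and>
    (\<forall>a<lie_size X r. \<forall>b<lie_size X r.
      x $$ (a,b) = - (dual_sgn X r a * dual_sgn X r b) * x $$ (dual_idx r b, dual_idx r a))"
    (is "_ \<longleftrightarrow> x \<in> carrier_mat ?N ?N \<and> ?R")
proof (cases "x \<in> carrier_mat ?N ?N")
  case c: True
  let ?J = "pairing X r"
  note J = pairing_carrier[OF X, of r]
  have entry: "(transpose_mat x * ?J + ?J * x) $$ (i,j) =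
      x $$ (dual_idx r j, i) * dual_sgn X r (dual_idx r j) + dual_sgn X r i * x $$ (dual_idx r i, j)"
    if ij: "i < ?N" "j < ?N" for i j
  proof -
    have o: "dual_idx r k < ?N" if "k < ?N" for k using dual_idx_less[OF X that] .
    have "(transpose_mat x * ?J) $$ (i,j) = (\<Sum>k<?N. x $$ (k,i) * ?J $$ (k,j))"
      using c J ij by (simp add: scalar_prod_def atLeast0LessThan)
    also have "\<dots> = (\<Sum>k<?N. if k = dual_idx r j then x $$ (dual_idx r j,i) * dual_sgn X r (dual_idx r j) else 0)"
      by (intro sum.cong) (use ij in \<open>auto simp: pairing_entry[OF X]\<close>)
    also have "\<dots> = x $$ (dual_idx r j, i) * dual_sgn X r (dual_idx r j)" using o[OF ij(2)] by simp
    finally have 1: "(transpose_mat x * ?J) $$ (i,j) = \<dots>" .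
    have "(?J * x) $$ (i,j) = (\<Sum>k<?N. ?J $$ (i,k) * x $$ (k,j))"
      using c J ij by (simp add: scalar_prod_def atLeast0LessThan)
    also have "\<dots> = (\<Sum>k<?N. if k = dual_idx r i then dual_sgn X r i * x $$ (dual_idx r i,j) else 0)"
      by (intro sum.cong) (use ij in \<open>auto simp: pairing_entry[OF X]\<close>)
    also have "\<dots> = dual_sgn X r i * x $$ (dual_idx r i, j)" using o[OF ij(1)] by simp
    finally have 2: "(?J * x) $$ (i,j) = \<dots>" .
    show ?thesis using 1 2 c J ij by simp
  qed
  have solve: "(x $$ (a,b) * dual_sgn X r a + dual_sgn X r b * x $$ (dual_idx r b, dual_idx r a) = 0) \<longleftrightarrow>
      x $$ (a,b) = - (dual_sgn X r a * dual_sgn X r b) * x $$ (dual_idx r b, dual_idx r a)" for a b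
    by (auto simp: dual_sgn_def add_eq_0_iff)
  have "x \<in> lie_alg X r \<longleftrightarrow> (\<forall>i<?N. \<forall>j<?N.
      x $$ (dual_idx r j, i) * dual_sgn X r (dual_idx r j) + dual_sgn X r i * x $$ (dual_idx r i, j) = 0)"
    (is "_ \<longleftrightarrow> ?Q")
  proof
    assume "x \<in> lie_alg X r"
    then have "transpose_mat x * ?J + ?J * x = 0\<^sub>m ?N ?N"
      by (simp add: lie_alg_pairing[OF X] preserving_algebra_def)
    then show ?Q using entry by (metis index_zero_mat(1))
  next
    assume ?Q
    then have "transpose_mat x * ?J + ?J * x = 0\<^sub>m ?N ?N"
      using c J by (intro eq_matI) (auto simp del: index_mult_mat index_add_mat(1) simp: entry, auto)
    then show "x \<in> lie_alg X r"
      using c by (simp add: lie_alg_pairing[OF X] preserving_algebra_def)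
  qed
  also have "\<dots> \<longleftrightarrow> (\<forall>a<?N. \<forall>b<?N.
      x $$ (a,b) * dual_sgn X r a + dual_sgn X r b * x $$ (dual_idx r b, dual_idx r a) = 0)" (is "_ \<longleftrightarrow> ?P")
  proof
    assume q: ?Q
    show ?P
    proof (intro allI impI)
      fix a b assume "a < ?N" "b < ?N"
      then show "x $$ (a,b) * dual_sgn X r a + dual_sgn X r b * x $$ (dual_idx r b, dual_idx r a) = 0"
        using q dual_idx_less[OF X, of a r] by (metis dual_idx_dual_idx)
    qed
  next
    assume p: ?P
    show ?Q
    proof (intro allI impI)
      fix i j assume "i < ?N" "j < ?N"
      then show "x $$ (dual_idx r j, i) * dual_sgn X r (dual_idx r j) + dual_sgn X r i * x $$ (dual_idx r i, j) = 0"
        using p dual_idx_less[OF X, of j r] by (metis dual_idx_dual_idx)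
    qed
  qed
  finally show ?thesis using c solve by simp
next
  case False
  then show ?thesis by (simp add: lie_alg_pairing[OF X] preserving_algebra_def)
qed

lemma lie_alg_carrier: "x \<in> lie_alg X r \<Longrightarrow> x \<in> carrier_mat (lie_size X r) (lie_size X r)"
  by (cases X) (simp_all add: lie_alg_def lie_size_def preserving_algebra_def)

lemma lie_alg_A: "lie_alg Type_A r = carrier_mat r r" "lie_size Type_A r = r"
  by (auto simp: lie_alg_def lie_size_def)

lemma lie_alg_entry:
  assumes "X \<noteq> Type_A" "x \<in> lie_alg X r" "a < lie_size X r" "b < lie_size X r"
  shows "x $$ (a,b) = - (dual_sgn X r a * dual_sgn X r b) * x $$ (dual_idx r b, dual_idx r a)"
  using assms lie_alg_iff by blast

lemma lie_algI:
  assumes "x \<in> carrier_mat (lie_size X r) (lie_size X r)"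
    and "\<And>a b. X \<noteq> Type_A \<Longrightarrow> a < lie_size X r \<Longrightarrow> b < lie_size X r \<Longrightarrow>
      x $$ (a,b) = - (dual_sgn X r a * dual_sgn X r b) * x $$ (dual_idx r b, dual_idx r a)"
  shows "x \<in> lie_alg X r"
proof (cases "X = Type_A")
  case True
  then show ?thesis using assms(1) by (simp add: lie_alg_A)
next
  case False
  then show ?thesis using assms by (simp add: lie_alg_iff)
qed

lemma lie_alg_bracket:
  assumes x: "x \<in> lie_alg X r" and y: "y \<in> lie_alg X r"
  shows "bracket x y \<in> lie_alg X r"
proof (rule lie_algI)
  note c = lie_alg_carrier[OF x] lie_alg_carrier[OF y]
  let ?N = "lie_size X r"
  show "bracket x y \<in> carrier_mat ?N ?N" 
    unfolding bracket_def by (rule minus_carrier_mat[OF mult_carrier_mat[OF c(2) c(1)]])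
  fix a b assume X: "X \<noteq> Type_A" and ab: "a < ?N" "b < ?N"
  note o = dual_idx_less[OF X]
  have prod: "(x * y) $$ (a,b) = dual_sgn X r a * dual_sgn X r b * (y * x) $$ (dual_idx r b, dual_idx r a)"
    if x: "x \<in> lie_alg X r" and y: "y \<in> lie_alg X r" for x y
  proof -
    note c = lie_alg_carrier[OF x] lie_alg_carrier[OF y]
    have "(x * y) $$ (a,b) = (\<Sum>k<?N. x $$ (a,k) * y $$ (k,b))"
      using c ab by (simp add: scalar_prod_def atLeast0LessThan)
    also have "\<dots> = (\<Sum>k<?N. (dual_sgn X r a * dual_sgn X r k * x $$ (dual_idx r k, dual_idx r a))
        * (dual_sgn X r k * dual_sgn X r b * y $$ (dual_idx r b, dual_idx r k)))"
      using lie_alg_entry[OF X x ab(1)] lie_alg_entry[OF X y _ ab(2)] by (intro sum.cong) auto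
    also have "\<dots> = (\<Sum>k<?N. dual_sgn X r a * dual_sgn X r b * (y $$ (dual_idx r b, dual_idx r k) * x $$ (dual_idx r k, dual_idx r a)))"
      by (intro sum.cong) (auto simp: dual_sgn_def)
    also have "\<dots> = (\<Sum>k<?N. dual_sgn X r a * dual_sgn X r b * (y $$ (dual_idx r b, k) * x $$ (k, dual_idx r a)))"
      by (rule sum.reindex_bij_witness[of _ "dual_idx r" "dual_idx r"]) (auto simp: o)
    also have "\<dots> = dual_sgn X r a * dual_sgn X r b * (y * x) $$ (dual_idx r b, dual_idx r a)"
      using c ab o by (simp add: scalar_prod_def atLeast0LessThan sum_distrib_left)
    finally show ?thesis .
  qed
  show "bracket x y $$ (a,b) = - (dual_sgn X r a * dual_sgn X r b) * bracket x y $$ (dual_idx r b, dual_idx r a)"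
    using c ab o prod[OF x y] prod[OF y x] unfolding bracket_def
    by (simp del: index_mult_mat(1) add: right_diff_distrib)
qed

lemma lie_alg_matrix_lie: "matrix_lie (lie_size X r) (lie_alg X r)"
proof
  show "x \<in> carrier_mat (lie_size X r) (lie_size X r)" if "x \<in> lie_alg X r" for x
    using that by (rule lie_alg_carrier)
  show "0\<^sub>m (lie_size X r) (lie_size X r) \<in> lie_alg X r"
    by (rule lie_algI) (auto simp: dual_idx_less)
  show "x + y \<in> lie_alg X r" if xy: "x \<in> lie_alg X r" "y \<in> lie_alg X r" for x y
  proof (rule lie_algI)
    fix a b assume *: "X \<noteq> Type_A" "a < lie_size X r" "b < lie_size X r"
    show "(x + y) $$ (a,b) = - (dual_sgn X r a * dual_sgn X r b) * (x + y) $$ (dual_idx r b, dual_idx r a)"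
      using lie_alg_entry[OF *(1) xy(1) *(2,3)] lie_alg_entry[OF *(1) xy(2) *(2,3)]
        lie_alg_carrier[OF xy(1)] lie_alg_carrier[OF xy(2)] * dual_idx_less[OF *(1)]
      by (simp add: algebra_simps)
  qed (use xy lie_alg_carrier in auto)
  show "c \<cdot>\<^sub>m x \<in> lie_alg X r" if x: "x \<in> lie_alg X r" for c x
  proof (rule lie_algI)
    fix a b assume *: "X \<noteq> Type_A" "a < lie_size X r" "b < lie_size X r"
    show "(c \<cdot>\<^sub>m x) $$ (a,b) = - (dual_sgn X r a * dual_sgn X r b) * (c \<cdot>\<^sub>m x) $$ (dual_idx r b, dual_idx r a)"
      using lie_alg_entry[OF *(1) x *(2,3)] lie_alg_carrier[OF x] * dual_idx_less[OF *(1)]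
      by (simp add: algebra_simps)
  qed (use x lie_alg_carrier in auto)
qed (rule lie_alg_bracket)

lemma dag_lie_alg:
  assumes x: "x \<in> lie_alg X r" shows "dag x \<in> lie_alg X r"
proof (rule lie_algI)
  note c = lie_alg_carrier[OF x]
  show "dag x \<in> carrier_mat (lie_size X r) (lie_size X r)" using c by (simp add: dag_def)
  fix a b assume *: "X \<noteq> Type_A" "a < lie_size X r" "b < lie_size X r"
  show "dag x $$ (a,b) = - (dual_sgn X r a * dual_sgn X r b) * dag x $$ (dual_idx r b, dual_idx r a)"
    using c * dual_idx_less[OF *(1)] lie_alg_entry[OF *(1) x *(3,2)]
    by (simp add: dag_def) (simp add: dual_sgn_def)
qed

lemma lie_alg_graded:
  assumes \<delta>: "\<And>i. X \<noteq> Type_A \<Longrightarrow> i < lie_size X r \<Longrightarrow> \<delta> (dual_idx r i) = - \<delta> i"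
  shows "graded_lie (lie_size X r) (lie_alg X r) \<delta>"
proof -
  interpret matrix_lie "lie_size X r" "lie_alg X r" by (rule lie_alg_matrix_lie)
  show ?thesis
  proof
    fix x k assume x: "x \<in> lie_alg X r"
    note c = lie_alg_carrier[OF x]
    show "hom_part \<delta> k x \<in> lie_alg X r"
    proof (rule lie_algI)
      show "hom_part \<delta> k x \<in> carrier_mat (lie_size X r) (lie_size X r)" using c by (simp add: hom_part_def)
      fix a b assume *: "X \<noteq> Type_A" "a < lie_size X r" "b < lie_size X r"
      have "\<delta> (dual_idx r b) - \<delta> (dual_idx r a) = \<delta> a - \<delta> b" using \<delta> * by simp
      then show "hom_part \<delta> k x $$ (a,b) = - (dual_sgn X r a * dual_sgn X r b) * hom_part \<delta> k x $$ (dual_idx r b, dual_idx r a)"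
        using c * dual_idx_less[OF *(1)] lie_alg_entry[OF *(1) x *(2,3)] by (simp add: hom_part_def)
    qed
  qed
qed

text \<open>
  The weights of the vector representation, their heights shifted so that the grading is odd under
  \<open>dual_idx\<close>, and the grading whose degree \<open>0\<close> part is the Levi subalgebra \<open>gl(r)\<close>.
\<close>

definition letter_wt :: "nat \<Rightarrow> nat \<Rightarrow> weight" where
  "letter_wt r i = (if i < r then eps (i + 1) else if i < 2 * r then - eps (i - r + 1) else 0)"

definition letter_ht :: "nat \<Rightarrow> nat \<Rightarrow> int" where
  "letter_ht r i = (if i < r then int r - int i else if i < 2 * r then int (i - r) - int r else 0)"

definition levi_deg :: "nat \<Rightarrow> nat \<Rightarrow> int" where
  "levi_deg r i = (if i < r then 1 else if i < 2 * r then -1 else 0)"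

lemma dual_idx_grading:
  assumes "X \<noteq> Type_A" "i < lie_size X r"
  shows "letter_wt r (dual_idx r i) = - letter_wt r i" "letter_ht r (dual_idx r i) = - letter_ht r i" "levi_deg r (dual_idx r i) = - levi_deg r i"
  using assms by (cases X; auto simp: letter_wt_def letter_ht_def levi_deg_def dual_idx_def lie_size_def)+

lemma weight_eval_diff: "weight_eval r (\<mu> - \<nu>) t = weight_eval r \<mu> t - weight_eval r \<nu> t"
  and weight_eval_minus: "weight_eval r (- \<mu>) t = - weight_eval r \<mu> t"
  and weight_eval_zero: "weight_eval r 0 t = 0"
  by (simp_all add: weight_eval_def minus_apply zero_fun_apply sum_subtractf[symmetric]
      sum_negf[symmetric] algebra_simps)

lemma weight_eval_eps: "i \<in> {1..r} \<Longrightarrow> weight_eval r (eps i) t = t i"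
proof -
  assume i: "i \<in> {1..r}"
  have "weight_eval r (eps i) t = (\<Sum>j = 1..r. if j = i then t i else 0)"
    unfolding weight_eval_def by (intro sum.cong) (auto simp: eps_def)
  then show ?thesis using i by simp
qed

lemma cartan_elt_diag: "cartan_elt X r t = mat_diag (lie_size X r) (\<lambda>i. weight_eval r (letter_wt r i) t)"
proof -
  have "(if k < r then t (k + 1) else if k < 2 * r then - t (k - r + 1) else 0)
      = weight_eval r (letter_wt r k) t" for k
    by (simp add: letter_wt_def weight_eval_eps weight_eval_minus weight_eval_zero)
  then show ?thesis by (simp add: cartan_elt_def)
qed

lemma cartan_in_lie_alg: "cartan_elt X r t \<in> lie_alg X r"
proof (rule lie_algI)
  show "cartan_elt X r t \<in> carrier_mat (lie_size X r) (lie_size X r)"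
    by (simp add: cartan_elt_diag mat_diag_def)
  fix a b assume *: "X \<noteq> Type_A" "a < lie_size X r" "b < lie_size X r"
  have e: "cartan_elt X r t $$ (i,j) = (if i = j then weight_eval r (letter_wt r i) t else 0)"
    if "i < lie_size X r" "j < lie_size X r" for i j
    using that by (simp add: cartan_elt_diag mat_diag_def)
  show "cartan_elt X r t $$ (a,b) = - (dual_sgn X r a * dual_sgn X r b) * cartan_elt X r t $$ (dual_idx r b, dual_idx r a)"
  proof (cases "a = b")
    case True
    then show ?thesis
      using e[OF *(2,3)] e[OF dual_idx_less[OF *(1,3)] dual_idx_less[OF *(1,2)]] dual_idx_grading(1)[OF *(1,2)]
      by (simp add: weight_eval_minus dual_sgn_sq)
  next
    case False
    then have "dual_idx r b \<noteq> dual_idx r a" by (metis dual_idx_dual_idx)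
    then show ?thesis
      using e[OF *(2,3)] e[OF dual_idx_less[OF *(1,3)] dual_idx_less[OF *(1,2)]] False by simp
  qed
qed

lemma bracket_diag:
  assumes "x \<in> carrier_mat N N"
  shows "bracket (mat_diag N \<tau>) x = mat N N (\<lambda>(i,j). (\<tau> i - \<tau> j) * x $$ (i,j))"
  using assms unfolding bracket_def mat_diag_mult_left[OF assms] mat_diag_mult_right[OF assms]
  by (auto simp: algebra_simps)

text \<open>
  The element of the Cartan subalgebra that acts on a root space through the degree for
  \<open>letter_ht\<close>.
\<close>

definition height_elt :: "nat \<Rightarrow> nat \<Rightarrow> complex" where
  "height_elt r i = of_nat (r + 1 - i)"

lemma weight_eval_letter_wt_height: "i < 2 * r + 1 \<Longrightarrow> weight_eval r (letter_wt r i) (height_elt r) = of_int (letter_ht r i)"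
  by (auto simp: letter_wt_def letter_ht_def weight_eval_eps weight_eval_minus weight_eval_zero height_elt_def
      of_nat_diff)

lemma bracket_height:
  assumes x: "x \<in> lie_alg X r" and h: "homog (letter_ht r) k x"
  shows "bracket (cartan_elt X r (height_elt r)) x = of_int k \<cdot>\<^sub>m x"
proof -
  note c = lie_alg_carrier[OF x]
  note le = lie_size_less[of _ X r]
  have "(weight_eval r (letter_wt r i) (height_elt r) - weight_eval r (letter_wt r j) (height_elt r)) * x $$ (i,j)
     = of_int k * x $$ (i,j)" if ij: "i < lie_size X r" "j < lie_size X r" for i j
  proof (cases "x $$ (i,j) = 0")
    case False
    then have "k = letter_ht r i - letter_ht r j" using h c ij by (auto simp: homog_def)
    then show ?thesis using le ij by (simp add: weight_eval_letter_wt_height)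
  qed simp
  then show ?thesis unfolding cartan_elt_diag bracket_diag[OF c] using c
    by (intro eq_matI) auto
qed

lemma letter_ht_inj: "i < 2 * r + 1 \<Longrightarrow> j < 2 * r + 1 \<Longrightarrow> letter_ht r i = letter_ht r j \<longleftrightarrow> i = j"
  by (auto simp: letter_ht_def split: if_splits)

text \<open>
  The letters have distinct heights, so degree \<open>0\<close> means diagonal.
\<close>

lemma homog_zero_cartan:
  assumes x: "x \<in> lie_alg X r" and h: "homog (letter_ht r) 0 x"
  shows "x = cartan_elt X r (\<lambda>k. x $$ (k - 1, k - 1))"
proof -
  note c = lie_alg_carrier[OF x]
  note le = lie_size_less[of _ X r]
  have off: "x $$ (i,j) = 0" if "i < lie_size X r" "j < lie_size X r" "i \<noteq> j" for i j
    using h c that le letter_ht_inj[of i r j] by (auto simp: homog_def)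
  have diag: "x $$ (i,i) = - x $$ (dual_idx r i, dual_idx r i)" if "X \<noteq> Type_A" "i < lie_size X r" for i
    using lie_alg_entry[OF that(1) x that(2,2)] by (simp add: dual_sgn_sq)
  show ?thesis
  proof (rule eq_matI)
    fix i j assume "i < dim_row (cartan_elt X r (\<lambda>k. x $$ (k - 1, k - 1)))"
      "j < dim_col (cartan_elt X r (\<lambda>k. x $$ (k - 1, k - 1)))"
    then have ij: "i < lie_size X r" "j < lie_size X r"
      by (simp_all add: cartan_elt_def mat_diag_def)
    have "x $$ (i,i) = (if i < r then x $$ (i,i) else if i < 2 * r then - x $$ (i - r, i - r) else 0)"
    proof (cases "i < r")
      case False
      then have "X \<noteq> Type_A" using ij by (auto simp: lie_size_def)
      from diag[OF this ij(1)] have d: "x $$ (i,i) = - x $$ (dual_idx r i, dual_idx r i)" .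
      show ?thesis
      proof (cases "i < 2 * r")
        case True
        then have "dual_idx r i = i - r" using False by (simp add: dual_idx_def)
        then show ?thesis using d True False by presburger
      next
        case 2: False
        then have "dual_idx r i = i" by (simp add: dual_idx_def)
        then have "x $$ (i,i) = - x $$ (i,i)" using d by presburger
        then have "x $$ (i,i) = 0" by (simp add: eq_neg_iff_add_eq_0)
        then show ?thesis using 2 by simp
      qed
    qed simp
    then show "x $$ (i,j) = cartan_elt X r (\<lambda>k. x $$ (k - 1, k - 1)) $$ (i,j)"
      using ij off[of i j] by (auto simp: cartan_elt_def mat_diag_def)
  qed (use c in \<open>simp_all add: cartan_elt_def mat_diag_def\<close>)
qed

definition root_cone :: "lie_type \<Rightarrow> nat \<Rightarrow> weight set" where
  "root_cone X r =
    {\<beta>. \<exists>c :: nat \<Rightarrow> nat. \<beta> = (\<lambda>j. \<Sum>i\<in>index_set X r. real (c i) * simple_root X r i j)}"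

lemma finite_index_set [simp]: "finite (index_set X r)"
  by (simp add: index_set_def)

lemma root_coneI:
  "\<beta> = (\<lambda>j. \<Sum>i\<in>index_set X r. real (c i) * simple_root X r i j) \<Longrightarrow> \<beta> \<in> root_cone X r"
  unfolding root_cone_def by (rule CollectI, rule exI)

lemma root_cone_add: "\<beta> \<in> root_cone X r \<Longrightarrow> \<gamma> \<in> root_cone X r \<Longrightarrow> \<beta> + \<gamma> \<in> root_cone X r"
proof -
  assume "\<beta> \<in> root_cone X r" "\<gamma> \<in> root_cone X r"
  then obtain b c :: "nat \<Rightarrow> nat"
    where "\<beta> = (\<lambda>j. \<Sum>i\<in>index_set X r. real (b i) * simple_root X r i j)"
      "\<gamma> = (\<lambda>j. \<Sum>i\<in>index_set X r. real (c i) * simple_root X r i j)"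
    unfolding root_cone_def by blast
  then have "\<beta> + \<gamma> = (\<lambda>j. \<Sum>i\<in>index_set X r. real (b i + c i) * simple_root X r i j)"
    by (simp add: plus_fun_def distrib_right sum.distrib)
  then show ?thesis by (rule root_coneI)
qed

lemma simple_root_cone:
  assumes i: "i \<in> index_set X r" shows "simple_root X r i \<in> root_cone X r"
proof -
  have "simple_root X r i = (\<lambda>j. \<Sum>k\<in>index_set X r. real (if k = i then 1 else 0) * simple_root X r k j)"
  proof
    fix j
    have "(\<Sum>k\<in>index_set X r. real (if k = i then 1 else 0) * simple_root X r k j)
      = (\<Sum>k\<in>index_set X r. if k = i then simple_root X r i j else 0)"
      by (intro sum.cong) auto
    then show "simple_root X r i j = (\<Sum>k\<in>index_set X r. real (if k = i then 1 else 0) * simple_root X r k j)"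
      using i by simp
  qed
  then show ?thesis by (rule root_coneI)
qed

lemma root_cone_zero: "0 \<in> root_cone X r"
  unfolding root_cone_def by (auto simp: zero_fun_def intro!: exI[of _ "\<lambda>_. 0"])

lemma eps_diff_cone: "1 \<le> a \<Longrightarrow> a \<le> b \<Longrightarrow> b \<le> r \<Longrightarrow> eps a - eps b \<in> root_cone X r"
proof (induction "b - a" arbitrary: a)
  case 0
  then show ?case using root_cone_zero by simp
next
  case (Suc n)
  then have "eps (a + 1) - eps b \<in> root_cone X r" by simp
  moreover have a: "a < r" using Suc.hyps(2) Suc.prems by linarith
  then have "simple_root X r a = eps a - eps (a + 1)"
    by (simp add: simple_root_def fun_eq_iff minus_apply)
  then have "eps a - eps (a + 1) \<in> root_cone X r"
    using simple_root_cone[of a X r] Suc.prems(1) a by (simp add: index_set_def)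
  ultimately have "(eps a - eps (a + 1)) + (eps (a + 1) - eps b) \<in> root_cone X r"
    by (rule_tac root_cone_add)
  then show ?case by simp
qed

lemma eps_cone_B: "a \<in> {1..r} \<Longrightarrow> eps a \<in> root_cone Type_B r"
proof -
  assume a: "a \<in> {1..r}"
  have "eps r \<in> root_cone Type_B r"
    using simple_root_cone[of r Type_B r] a by (simp add: index_set_def simple_root_def)
  then have "(eps a - eps r) + eps r \<in> root_cone Type_B r"
    using a by (intro root_cone_add eps_diff_cone) auto
  then show ?thesis by simp
qed

lemma eps_sum_cone:
  assumes a: "a \<in> {1..r}" "b \<in> {1..r}" and X: "X \<noteq> Type_A" "X = Type_D \<Longrightarrow> a \<noteq> b"
  shows "eps a + eps b \<in> root_cone X r"
proof -
  consider "X = Type_B" | "X = Type_C" | "X = Type_D" using X by (cases X) auto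
  then show ?thesis
  proof cases
    case 1
    then show ?thesis using a eps_cone_B root_cone_add by blast
  next
    case 2
    have "simple_root X r r = eps r + eps r"
      using 2 by (simp add: simple_root_def fun_eq_iff plus_fun_apply)
    then have "eps r + eps r \<in> root_cone X r"
      using simple_root_cone[of r X r] a 2 by (simp add: index_set_def)
    moreover have "(eps a - eps r) + (eps b - eps r) \<in> root_cone X r"
      using a by (intro root_cone_add eps_diff_cone) auto
    ultimately have "(eps r + eps r) + ((eps a - eps r) + (eps b - eps r)) \<in> root_cone X r"
      by (rule root_cone_add)
    moreover have "(eps r + eps r) + ((eps a - eps r) + (eps b - eps r)) = eps a + eps b"
      by (simp add: fun_eq_iff plus_fun_apply minus_apply)
    ultimately show ?thesis by simp
  next
    case 3
    have main: "eps a + eps b \<in> root_cone X r" if ab: "1 \<le> a" "a < b" "b \<le> r" for a b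
    proof -
      have "simple_root X r r = eps (r - 1) + eps r"
        using 3 by (simp add: simple_root_def fun_eq_iff plus_fun_apply)
      then have "eps (r - 1) + eps r \<in> root_cone X r"
        using simple_root_cone[of r X r] ab 3 by (simp add: index_set_def)
      moreover have "(eps a - eps (r - 1)) + (eps b - eps r) \<in> root_cone X r"
        using ab by (intro root_cone_add eps_diff_cone) auto
      ultimately have "(eps (r - 1) + eps r) + ((eps a - eps (r - 1)) + (eps b - eps r)) \<in> root_cone X r"
        by (rule root_cone_add)
      moreover have "(eps (r - 1) + eps r) + ((eps a - eps (r - 1)) + (eps b - eps r)) = eps a + eps b"
        by (simp add: fun_eq_iff plus_fun_apply minus_apply)
      ultimately show ?thesis by simp
    qed
    show ?thesis using main[of a b] main[of b a] a X(2) 3 by (cases "a < b") (auto simp: add.commute)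
  qed
qed

text \<open>
  A matrix entry of positive height lies in a positive root space. In type \<open>D\<close> the entries
  \<open>(i, dual_idx r i)\<close> vanish; \<open>2\<epsilon>\<^sub>r\<close> would not be in the cone.
\<close>

lemma positive_entry_cone:
  assumes x: "x \<in> lie_alg X r" and ij: "i < lie_size X r" "j < lie_size X r"
    and n: "x $$ (i,j) \<noteq> 0" and d: "letter_ht r i > letter_ht r j"
  shows "letter_wt r i - letter_wt r j \<in> root_cone X r"
proof (cases "j < r")
  case j: True
  then have "i < j" using d by (auto simp: letter_ht_def split: if_splits)
  then show ?thesis using j eps_diff_cone[of "i + 1" "j + 1" r X] by (simp add: letter_wt_def)
next
  case j: False
  then have X: "X \<noteq> Type_A" using ij by (auto simp: lie_size_def)
  show ?thesis
  proof (cases "j < 2 * r")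
    case j2: True
    consider "i < r" | "r \<le> i" "i < 2 * r" | "i \<ge> 2 * r" by linarith
    then show ?thesis
    proof cases
      case 1
      have "i + 1 \<noteq> j - r + 1" if "X = Type_D"
      proof
        assume "i + 1 = j - r + 1"
        then have "j = i + r" using j by simp
        then show False
          using lie_alg_entry[OF X x ij] n 1 that by (simp add: dual_idx_def dual_sgn_def)
      qed
      then have "eps (i + 1) + eps (j - r + 1) \<in> root_cone X r"
        using 1 j j2 X by (intro eps_sum_cone) auto
      then show ?thesis using 1 j j2 by (simp add: letter_wt_def)
    next
      case 2
      then have "j < i" using d j by (auto simp: letter_ht_def split: if_splits)
      then show ?thesis using 2 j eps_diff_cone[of "j - r + 1" "i - r + 1" r X] by (simp add: letter_wt_def)
    next
      case 3
      then have "X = Type_B" using ij by (cases X) (auto simp: lie_size_def)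
      then show ?thesis using 3 j j2 eps_cone_B[of "j - r + 1" r] by (simp add: letter_wt_def)
    qed
  next
    case j2: False
    then have "X = Type_B" using ij by (cases X) (auto simp: lie_size_def)
    moreover have "i < r" using d j j2 by (auto simp: letter_ht_def split: if_splits)
    ultimately show ?thesis using j2 eps_cone_B[of "i + 1" r] by (simp add: letter_wt_def)
  qed
qed

definition wheight :: "nat \<Rightarrow> weight \<Rightarrow> real" where
  "wheight r \<omega> = (\<Sum>i = 1..r. \<omega> i * real (r + 1 - i))"

lemma weight_eval_height: "weight_eval r \<omega> (height_elt r) = of_real (wheight r \<omega>)"
  by (simp add: weight_eval_def wheight_def height_elt_def)

lemma wheight_eps: "i \<in> {1..r} \<Longrightarrow> wheight r (eps i) = real (r + 1 - i)"
proof -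
  assume i: "i \<in> {1..r}"
  have "wheight r (eps i) = (\<Sum>j = 1..r. if j = i then real (r + 1 - i) else 0)"
    unfolding wheight_def by (intro sum.cong) (auto simp: eps_def)
  then show ?thesis using i by simp
qed

lemma wheight_simple_root:
  assumes i: "i \<in> index_set X r"
  shows "wheight r (simple_root X r i) \<ge> 1"
proof (cases "i < r")
  case True
  then have "i \<ge> 1" using i by (auto simp: index_set_def split: if_splits)
  have "wheight r (simple_root X r i) = wheight r (eps i) - wheight r (eps (i + 1))"
    using True by (simp add: simple_root_def wheight_def sum_subtractf[symmetric] left_diff_distrib)
  then show ?thesis using True \<open>i \<ge> 1\<close> by (simp add: wheight_eps of_nat_diff)
next
  case False
  then have *: "i = r" "X \<noteq> Type_A" "r \<ge> 1" using i by (auto simp: index_set_def split: if_splits)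
  have e: "wheight r (eps r) = 1" using * by (simp add: wheight_eps)
  have nn: "wheight r (eps (r - 1)) \<ge> 0"
    by (auto simp: wheight_def eps_def intro!: sum_nonneg)
  show ?thesis
  proof (cases X)
    case Type_C
    have "wheight r (simple_root X r i) = 2 * wheight r (eps r)"
      using * Type_C by (simp add: simple_root_def wheight_def sum_distrib_left mult.assoc)
    then show ?thesis using e by simp
  next
    case Type_D
    have "wheight r (simple_root X r i) = wheight r (eps (r - 1)) + wheight r (eps r)"
      using * Type_D by (simp add: simple_root_def wheight_def sum.distrib distrib_right)
    then show ?thesis using e nn by simp
  qed (use * e in \<open>simp_all add: simple_root_def\<close>)
qed

lemma root_cone_height:
  assumes b: "\<beta> \<in> root_cone X r" and n: "\<beta> \<noteq> 0"
  shows "wheight r \<beta> > 0"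
proof -
  obtain c :: "nat \<Rightarrow> nat" where c: "\<beta> = (\<lambda>j. \<Sum>i\<in>index_set X r. real (c i) * simple_root X r i j)"
    using b unfolding root_cone_def by blast
  have h: "wheight r \<beta> = (\<Sum>i\<in>index_set X r. real (c i) * wheight r (simple_root X r i))"
  proof -
    have "wheight r \<beta> = (\<Sum>k = 1..r. \<Sum>i\<in>index_set X r. real (c i) * simple_root X r i k * real (r + 1 - k))"
      unfolding wheight_def c by (simp add: sum_distrib_right)
    also have "\<dots> = (\<Sum>i\<in>index_set X r. \<Sum>k = 1..r. real (c i) * simple_root X r i k * real (r + 1 - k))"
      by (rule sum.swap)
    finally show ?thesis by (simp add: wheight_def sum_distrib_left mult.assoc)
  qed
  have "\<exists>i\<in>index_set X r. c i \<noteq> 0"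
  proof (rule ccontr)
    assume "\<not> ?thesis"
    then have "\<beta> = 0" unfolding c by (simp add: zero_fun_def)
    then show False using n by simp
  qed
  then obtain i where i: "i \<in> index_set X r" "c i \<noteq> 0" by blast
  have nn: "wheight r (simple_root X r k) \<ge> 0" if "k \<in> index_set X r" for k
    using wheight_simple_root[OF that] by simp
  show ?thesis unfolding h
  proof (rule sum_pos2[OF finite_index_set i(1)])
    show "0 < real (c i) * wheight r (simple_root X r i)"
      using i wheight_simple_root[OF i(1)] by simp
  qed (use nn in auto)
qed

lemma positive_root_space_entry:
  assumes b: "\<beta> \<in> positive_roots X r" and x: "x \<in> root_space X r \<beta>"
    and ij: "i < lie_size X r" "j < lie_size X r" "x $$ (i,j) \<noteq> 0"
  shows "letter_ht r i > letter_ht r j"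
proof -
  note le = lie_size_less[of _ X r]
  have xl: "x \<in> lie_alg X r" using x by (simp add: root_space_def)
  note c = lie_alg_carrier[OF xl]
  have "bracket (cartan_elt X r (height_elt r)) x = weight_eval r \<beta> (height_elt r) \<cdot>\<^sub>m x"
    using x by (simp add: root_space_def)
  from arg_cong[OF this, of "\<lambda>y. y $$ (i,j)"]
  have "complex_of_int (letter_ht r i - letter_ht r j) = of_real (wheight r \<beta>)"
    using c ij le unfolding cartan_elt_diag bracket_diag[OF c] weight_eval_height[of r \<beta>]
    by (simp add: weight_eval_letter_wt_height)
  then have "complex_of_real (of_int (letter_ht r i - letter_ht r j)) = of_real (wheight r \<beta>)" by simp
  then have "real_of_int (letter_ht r i - letter_ht r j) = wheight r \<beta>" by (simp only: of_real_eq_iff)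
  moreover have "wheight r \<beta> > 0"
    using b by (intro root_cone_height[of _ X]) (auto simp: positive_roots_def root_cone_def zero_fun_def)
  ultimately show ?thesis by linarith
qed

lemma homog_root_space:
  assumes x: "x \<in> lie_alg X r" and h: "homog (letter_wt r) \<beta> x"
  shows "x \<in> root_space X r \<beta>"
proof -
  note c = lie_alg_carrier[OF x]
  have "(weight_eval r (letter_wt r i) t - weight_eval r (letter_wt r j) t) * x $$ (i,j) = weight_eval r \<beta> t * x $$ (i,j)"
    if ij: "i < lie_size X r" "j < lie_size X r" for i j t
  proof (cases "x $$ (i,j) = 0")
    case False
    then have "letter_wt r i - letter_wt r j = \<beta>" using h c ij by (auto simp: homog_def)
    then show ?thesis by (metis weight_eval_diff)
  qed simp
  then have "bracket (cartan_elt X r t) x = weight_eval r \<beta> t \<cdot>\<^sub>m x" for t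
    unfolding cartan_elt_diag bracket_diag[OF c] using c by (intro eq_matI) auto
  then show ?thesis using x by (simp add: root_space_def)
qed

text \<open>
  An element of positive height is a sum of root vectors for positive roots. So a highest weight
  vector is killed by all elements of positive height.
\<close>

lemma positive_part_induct:
  assumes x: "x \<in> lie_alg X r"
    and d: "\<And>i j. i < lie_size X r \<Longrightarrow> j < lie_size X r \<Longrightarrow> x $$ (i,j) \<noteq> 0 \<Longrightarrow> letter_ht r i > letter_ht r j"
    and P0: "P (0\<^sub>m (lie_size X r) (lie_size X r))"
    and Padd: "\<And>x y. x \<in> lie_alg X r \<Longrightarrow> y \<in> lie_alg X r \<Longrightarrow> P x \<Longrightarrow> P y \<Longrightarrow> P (x + y)"
    and Pr: "\<And>\<beta> x. \<beta> \<in> positive_roots X r \<Longrightarrow> x \<in> root_space X r \<beta> \<Longrightarrow> P x"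
  shows "P x"
proof -
  interpret graded_lie "lie_size X r" "lie_alg X r" "letter_wt r"
    by (rule lie_alg_graded) (rule dual_idx_grading)
  note c = lie_alg_carrier[OF x]
  let ?N = "lie_size X r"
  show ?thesis
  proof (rule graded_induct[OF x P0 Padd])
    fix \<beta>
    let ?y = "hom_part (letter_wt r) \<beta> x"
    have y: "?y \<in> lie_alg X r" by (rule hom_part_closed[OF x])
    have yr: "?y \<in> root_space X r \<beta>" by (rule homog_root_space[OF y homog_hom_part])
    show "P ?y"
    proof (cases "?y = 0\<^sub>m ?N ?N")
      case False
      have "\<exists>i<?N. \<exists>j<?N. ?y $$ (i,j) \<noteq> 0"
      proof (rule ccontr)
        assume "\<not> ?thesis"
        then have "?y = 0\<^sub>m ?N ?N" using c by (intro eq_matI) (auto simp: hom_part_def)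
        then show False using False by simp
      qed
      then obtain i j where ij: "i < ?N" "j < ?N" "?y $$ (i,j) \<noteq> 0" by blast
      then have b: "letter_wt r i - letter_wt r j = \<beta>" "x $$ (i,j) \<noteq> 0"
        using c by (auto simp: hom_part_def split: if_splits)
      then have cone: "\<beta> \<in> root_cone X r" using positive_entry_cone[OF x ij(1,2)] d[OF ij(1,2)] by blast
      have "letter_wt r i \<noteq> letter_wt r j"
      proof
        assume e: "letter_wt r i = letter_wt r j"
        have "i < 2 * r + 1" "j < 2 * r + 1"
          using ij(1,2)[THEN lie_size_less] by simp_all
        then have "letter_ht r i = letter_ht r j"
          using weight_eval_letter_wt_height[of i r] weight_eval_letter_wt_height[of j r] e by simp
        then show False using d[OF ij(1,2) b(2)] by simp
      qed
      then have "\<beta> \<noteq> (\<lambda>j. 0)" using b(1) by (auto simp: zero_fun_def[symmetric])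
      then have "\<beta> \<in> positive_roots X r"
        using cone yr False by (auto simp: positive_roots_def root_cone_def)
      then show ?thesis using yr Pr by blast
    qed (use P0 in simp)
  qed
qed

lemma levi_deg_corner:
  assumes X: "X \<noteq> Type_A" and B: "B \<in> carrier_mat r r"
  obtains x where "x \<in> lie_alg X r" "homog (levi_deg r) 0 x" "corner r x = B"
proof -
  let ?N = "lie_size X r"
  define x where "x = mat ?N ?N (\<lambda>(a,b). if a < r \<and> b < r then B $$ (a,b)
    else if r \<le> a \<and> a < 2 * r \<and> r \<le> b \<and> b < 2 * r then - B $$ (b - r, a - r) else 0)"
  have c: "x \<in> carrier_mat ?N ?N" by (simp add: x_def)
  have "x \<in> lie_alg X r"
  proof (rule lie_algI[OF c])
    fix a b assume *: "X \<noteq> Type_A" "a < ?N" "b < ?N"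
    then show "x $$ (a,b) = - (dual_sgn X r a * dual_sgn X r b) * x $$ (dual_idx r b, dual_idx r a)"
      using dual_idx_less[OF *(1), of a r] dual_idx_less[OF *(1), of b r]
      by (simp add: x_def) (auto simp: dual_idx_def dual_sgn_def)
  qed
  moreover have "homog (levi_deg r) 0 x"
    by (auto simp: homog_def x_def levi_deg_def split: if_splits)
  moreover have "corner r x = B"
    using B lie_size_bounds(2)[of r X] by (intro eq_matI) (auto simp: corner_def x_def)
  ultimately show thesis using that by blast
qed

section \<open>Matrix representations on coordinate functions\<close>

text \<open>
  Vectors of dimension \<open>d\<close> are turned into functions that vanish from \<open>d\<close> on. These functions lie in
  a vector space that is a type, as do tensors, and both can be treated alike.
\<close>

definition vec_fun :: "complex vec \<Rightarrow> nat \<Rightarrow> complex" where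
  "vec_fun v = (\<lambda>i. if i < dim_vec v then v $ i else 0)"

definition coords :: "nat \<Rightarrow> (nat \<Rightarrow> complex) set" where
  "coords d = {f. \<forall>i\<ge>d. f i = 0}"

lemma vec_fun_inj: "v \<in> carrier_vec d \<Longrightarrow> w \<in> carrier_vec d \<Longrightarrow> vec_fun v = vec_fun w \<longleftrightarrow> v = w"
  by (auto simp: vec_fun_def fun_eq_iff intro!: eq_vecI)

lemma vec_fun_add: "v \<in> carrier_vec d \<Longrightarrow> w \<in> carrier_vec d \<Longrightarrow> vec_fun (v + w) = vec_fun v + vec_fun w"
  and vec_fun_smult: "vec_fun (c \<cdot>\<^sub>v v) = smul c (vec_fun v)"
  and vec_fun_zero: "vec_fun (0\<^sub>v d) = 0"
  by (auto simp: vec_fun_def fun_simps)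

lemma vec_fun_coords: "v \<in> carrier_vec d \<Longrightarrow> vec_fun v \<in> coords d"
  by (auto simp: vec_fun_def coords_def)

lemma vec_fun_vec: "f \<in> coords d \<Longrightarrow> vec_fun (vec d f) = f"
  by (auto simp: vec_fun_def coords_def fun_eq_iff)

lemma coords_subspace: "fs.subspace (coords d)"
  by (rule fs.subspaceI) (auto simp: coords_def fun_simps)

definition unit :: "'a \<Rightarrow> 'a \<Rightarrow> complex" where
  "unit s = (\<lambda>i. if i = s then 1 else 0)"

lemma finite_support_span:
  assumes S: "finite S" and f: "\<And>i. f i \<noteq> 0 \<Longrightarrow> i \<in> S"
  shows "f \<in> fs.span (unit ` S)"
proof -
  have "f = (\<Sum>s\<in>S. smul (f s) (unit s))"
  proof
    fix i
    have "(\<Sum>s\<in>S. smul (f s) (unit s)) i = (\<Sum>s\<in>S. smul (f s) (unit s) i)"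
      by (induction S rule: infinite_finite_induct) (simp_all add: plus_fun_apply zero_fun_apply)
    also have "\<dots> = (\<Sum>s\<in>S. if s = i then f i else 0)"
      by (intro sum.cong) (auto simp: smul_apply unit_def)
    also have "\<dots> = f i" using S f by (simp add: sum.delta) metis
    finally show "f i = (\<Sum>s\<in>S. smul (f s) (unit s)) i" by simp
  qed
  also have "\<dots> \<in> fs.span (unit ` S)"
    by (intro fs.span_sum fs.span_scale fs.span_base) auto
  finally show ?thesis .
qed

lemma sum_fun_apply: "(\<Sum>s\<in>S. F s) i = (\<Sum>s\<in>S. F s i)" for F :: "'b \<Rightarrow> 'a \<Rightarrow> complex"
  by (induction S rule: infinite_finite_induct) (simp_all add: plus_fun_apply zero_fun_apply)

lemma dim_support_le:
  assumes "finite S" "\<And>f i. f \<in> U \<Longrightarrow> f i \<noteq> 0 \<Longrightarrow> i \<in> S"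
  shows "fs.dim U \<le> card S"
proof -
  have "U \<subseteq> fs.span (unit ` S)" using assms finite_support_span by blast
  then have "fs.dim U \<le> card (unit ` S)" using assms(1) by (intro fs.dim_le_card) auto
  also have "\<dots> \<le> card S" using assms(1) by (rule card_image_le)
  finally show ?thesis .
qed

lemma finite_basis:
  assumes "finite S" "\<And>f i. f \<in> U \<Longrightarrow> f i \<noteq> 0 \<Longrightarrow> i \<in> S"
  obtains b where "finite b" "b \<subseteq> U" "fs.independent b" "U \<subseteq> fs.span b" "card b = fs.dim U"
proof -
  obtain b where b: "b \<subseteq> U" "fs.independent b" "U \<subseteq> fs.span b" "card b = fs.dim U"
    by (rule fs.basis_exists)
  have "U \<subseteq> fs.span (unit ` S)" using assms finite_support_span by blast
  then have "finite b" using fs.independent_span_bound[of "unit ` S" b] assms(1) b by auto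
  then show thesis using that b by simp
qed

lemma vec_fun_mult_mat_vec:
  assumes "v \<in> carrier_vec d" "M \<in> carrier_mat d d" "i < d"
  shows "vec_fun (M *\<^sub>v v) i = (\<Sum>j<d. M $$ (i,j) * vec_fun v j)"
  using assms by (simp add: vec_fun_def scalar_prod_def atLeast0LessThan)

lemma vectorspace_dim_eq:
  assumes U: "subspace class_ring U (module_vec TYPE(complex) d)"
  shows "vectorspace.dim class_ring ((module_vec TYPE(complex) d)\<lparr>carrier := U\<rparr>) = fs.dim (vec_fun ` U)"
proof -
  interpret vec_space "TYPE(complex)" d .
  have Uc: "U \<subseteq> carrier_vec d" using U by (auto simp: subspace_def submodule_def module_vec_simps)
  have sm: "submodule class_ring U V" using U by (simp add: subspace_def)
  interpret W: vectorspace class_ring "V\<lparr>carrier := U\<rparr>" by (rule subspace_is_vs[OF U])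
  obtain b where b: "finite b" "b \<subseteq> vec_fun ` U" "fs.independent b" "vec_fun ` U \<subseteq> fs.span b"
    "card b = fs.dim (vec_fun ` U)"
  proof (rule finite_basis[of "{..<d}" "vec_fun ` U"])
    fix f i assume "f \<in> vec_fun ` U" "f i \<noteq> 0"
    then obtain u where "u \<in> U" "f = vec_fun u" by blast
    then show "i \<in> {..<d}" using \<open>f i \<noteq> 0\<close> Uc by (auto simp: vec_fun_def split: if_splits)
  qed auto
  define B where "B = {u \<in> U. vec_fun u \<in> b}"
  have inj: "inj_on vec_fun B"
  proof (rule inj_onI)
    fix u w assume "u \<in> B" "w \<in> B" "vec_fun u = vec_fun w"
    then show "u = w" using vec_fun_inj[of u d w] Uc by (auto simp: B_def)
  qed
  have im: "vec_fun ` B = b" using b(2) by (auto simp: B_def)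
  have fB: "finite B" using b(1) im inj by (simp add: finite_image_iff[symmetric])
  have cB: "card B = card b" using card_image[OF inj] im by simp
  have BU: "B \<subseteq> U" "B \<subseteq> carrier_vec d" using Uc by (auto simp: B_def)
  have lc: "vec_fun (lincomb a B) = (\<Sum>u\<in>B. smul (a u) (vec_fun u))" for a
  proof
    fix i
    have l: "lincomb a B \<in> carrier_vec d" using BU by auto
    show "vec_fun (lincomb a B) i = (\<Sum>u\<in>B. smul (a u) (vec_fun u)) i"
    proof (cases "i < d")
      case True
      have "(\<Sum>u\<in>B. smul (a u) (vec_fun u)) i = (\<Sum>u\<in>B. a u * u $ i)"
        unfolding sum_fun_apply by (intro sum.cong) (use True BU in \<open>auto simp: smul_apply vec_fun_def\<close>)
      then show ?thesis using True l lincomb_index[OF True BU(2)] by (simp add: vec_fun_def)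
    next
      case False
      have "vec_fun u i = 0" if "u \<in> B" for u using that BU False by (auto simp: vec_fun_def)
      then show ?thesis using False l by (simp add: vec_fun_def sum_fun_apply smul_apply)
    qed
  qed
  have "lin_indpt B"
  proof (rule finite_lin_indpt2[OF fB])
    show "B \<subseteq> carrier_vec d" by (rule BU)
    fix a :: "complex vec \<Rightarrow> complex" assume "lincomb a B = 0\<^sub>v d"
    then have "(\<Sum>u\<in>B. smul (a u) (vec_fun u)) = 0" using lc[of a] vec_fun_zero by metis
    then have "(\<Sum>f\<in>b. smul (a (the_inv_into B vec_fun f)) f) = 0"
      unfolding im[symmetric] using inj by (subst sum.reindex) (simp_all add: the_inv_into_f_f cong: sum.cong)
    then have "a (the_inv_into B vec_fun f) = 0" if "f \<in> b" for f
      using fs.independentD[OF b(3,1) subset_refl] that by fastforce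
    then show "\<forall>v\<in>B. a v = 0" using inj im by (metis imageI the_inv_into_f_f)
  qed
  then have 1: "\<not> module.lin_dep class_ring (V\<lparr>carrier := U\<rparr>) B"
    using span_li_not_depend(2)[OF BU(1) sm] by simp
  have "U \<subseteq> span B"
  proof
    fix u assume u: "u \<in> U"
    then have "vec_fun u \<in> fs.span b" using b(4) by auto
    then obtain c where c: "vec_fun u = (\<Sum>f\<in>b. smul (c f) f)"
      unfolding fs.span_finite[OF b(1)] by auto
    have "(\<Sum>f\<in>b. smul (c f) f) = (\<Sum>w\<in>B. smul (c (vec_fun w)) (vec_fun w))"
      unfolding im[symmetric] using inj by (subst sum.reindex) simp_all
    then have "vec_fun u = vec_fun (lincomb (\<lambda>w. c (vec_fun w)) B)" using c lc[of "\<lambda>w. c (vec_fun w)"] by simp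
    then have "u = lincomb (\<lambda>w. c (vec_fun w)) B" using u Uc vec_fun_inj[of u d] BU by auto
    then show "u \<in> span B" unfolding span_def using fB by auto
  qed
  moreover have "span B \<subseteq> U" by (rule span_is_subset[OF BU(1) sm])
  ultimately have 2: "LinearCombinations.module.span class_ring (V\<lparr>carrier := U\<rparr>) B = U"
    using span_li_not_depend(1)[OF BU(1) sm] by auto
  have "W.basis B" using 1 2 BU by (simp add: W.basis_def)
  then have "W.dim = card B" by (rule W.dim_basis[OF fB])
  then show ?thesis using cB b(5) by simp
qed

definition mat_act :: "nat \<Rightarrow> complex mat \<Rightarrow> (nat \<Rightarrow> complex) \<Rightarrow> nat \<Rightarrow> complex" where
  "mat_act d M f = (\<lambda>i. if i < d then \<Sum>j<d. M $$ (i,j) * f j else 0)"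

lemma vec_fun_mult: "v \<in> carrier_vec d \<Longrightarrow> M \<in> carrier_mat d d \<Longrightarrow> vec_fun (M *\<^sub>v v) = mat_act d M (vec_fun v)"
  using vec_fun_mult_mat_vec[of v d M] by (auto simp: mat_act_def fun_eq_iff) (simp add: vec_fun_def)

lemma mat_act_coords: "mat_act d M f \<in> coords d"
  by (simp add: mat_act_def coords_def)

lemma mat_act_add: "mat_act d M (f + g) = mat_act d M f + mat_act d M g"
  and mat_act_smul: "mat_act d M (smul c f) = smul c (mat_act d M f)"
  by (simp_all add: mat_act_def fun_simps distrib_left sum.distrib sum_distrib_left mult.left_commute)

lemma mat_act_add_mat: "A \<in> carrier_mat d d \<Longrightarrow> B \<in> carrier_mat d d \<Longrightarrow> mat_act d (A + B) f = mat_act d A f + mat_act d B f"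
  and mat_act_diff_mat: "A \<in> carrier_mat d d \<Longrightarrow> B \<in> carrier_mat d d \<Longrightarrow> mat_act d (A - B) f = mat_act d A f - mat_act d B f"
  and mat_act_smult_mat: "A \<in> carrier_mat d d \<Longrightarrow> mat_act d (c \<cdot>\<^sub>m A) f = smul c (mat_act d A f)"
  by (simp_all add: mat_act_def fun_simps distrib_right sum.distrib left_diff_distrib sum_subtractf
      sum_distrib_left mult.assoc)

lemma mat_act_mult_mat:
  assumes "A \<in> carrier_mat d d" "B \<in> carrier_mat d d"
  shows "mat_act d (A * B) f = mat_act d A (mat_act d B f)"
proof
  fix i
  have "(\<Sum>j<d. (A * B) $$ (i,j) * f j) = (\<Sum>k<d. A $$ (i,k) * (\<Sum>j<d. B $$ (k,j) * f j))"
    if i: "i < d"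
  proof -
    have "(\<Sum>j<d. (A * B) $$ (i,j) * f j) = (\<Sum>j<d. \<Sum>k<d. A $$ (i,k) * (B $$ (k,j) * f j))"
      using assms i
      by (intro sum.cong) (auto simp: scalar_prod_def atLeast0LessThan sum_distrib_right mult.assoc)
    also have "\<dots> = (\<Sum>k<d. \<Sum>j<d. A $$ (i,k) * (B $$ (k,j) * f j))" by (rule sum.swap)
    finally show ?thesis by (simp add: sum_distrib_left)
  qed
  then show "mat_act d (A * B) f i = mat_act d A (mat_act d B f) i" by (auto simp: mat_act_def)
qed

lemma rep_module:
  assumes G: "matrix_lie N G" and V: "is_rep G (d, \<rho>)"
  shows "lie_module N G (\<lambda>x. mat_act d (\<rho> x))"
proof -
  interpret matrix_lie N G by (rule G)
  have c: "\<rho> x \<in> carrier_mat d d" if "x \<in> G" for x using V that by (simp add: is_rep_def)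
  show ?thesis
  proof
    fix x y f g k assume x: "x \<in> G"
    show "mat_act d (\<rho> x) (f + g) = mat_act d (\<rho> x) f + mat_act d (\<rho> x) g"
      by (rule mat_act_add)
    show "mat_act d (\<rho> x) (smul k f) = smul k (mat_act d (\<rho> x) f)"
      by (rule mat_act_smul)
    have "\<rho> (k \<cdot>\<^sub>m x) = k \<cdot>\<^sub>m \<rho> x" using V x by (simp add: is_rep_def)
    then show "mat_act d (\<rho> (k \<cdot>\<^sub>m x)) f = smul k (mat_act d (\<rho> x) f)"
      using mat_act_smult_mat[OF c[OF x]] by simp
    assume y: "y \<in> G"
    have "\<rho> (x + y) = \<rho> x + \<rho> y" using V x y by (simp add: is_rep_def)
    then show "mat_act d (\<rho> (x + y)) f = mat_act d (\<rho> x) f + mat_act d (\<rho> y) f"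
      using mat_act_add_mat[OF c[OF x] c[OF y]] by simp
    have "\<rho> (bracket x y) = \<rho> x * \<rho> y - \<rho> y * \<rho> x"
      using V x y by (simp add: is_rep_def bracket_def[of "\<rho> x"])
    then show "mat_act d (\<rho> (bracket x y)) f =
        mat_act d (\<rho> x) (mat_act d (\<rho> y) f) - mat_act d (\<rho> y) (mat_act d (\<rho> x) f)"
      using mat_act_diff_mat[OF mult_carrier_mat[OF c[OF x] c[OF y]] mult_carrier_mat[OF c[OF y] c[OF x]]]
        mat_act_mult_mat[OF c[OF x] c[OF y]] mat_act_mult_mat[OF c[OF y] c[OF x]] by simp
  qed
qed

lemma vec_subspaceI:
  assumes "W \<subseteq> carrier_vec d" "0\<^sub>v d \<in> W" "\<And>v w. v \<in> W \<Longrightarrow> w \<in> W \<Longrightarrow> v + w \<in> W"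
    "\<And>c v. v \<in> W \<Longrightarrow> c \<cdot>\<^sub>v v \<in> W"
  shows "subspace class_ring W (module_vec TYPE(complex) d)"
proof -
  interpret vec_space "TYPE(complex)" d .
  have "submodule class_ring W V"
    unfolding submodule_def using assms module_axioms by (auto simp: module_vec_simps)
  then show ?thesis using vectorspace_axioms by (simp add: subspace_def)
qed

lemma vec_subspaceD:
  assumes "subspace class_ring W (module_vec TYPE(complex) d)"
  shows "W \<subseteq> carrier_vec d" "0\<^sub>v d \<in> W" "\<And>v w. v \<in> W \<Longrightarrow> w \<in> W \<Longrightarrow> v + w \<in> W"
    "\<And>c v. v \<in> W \<Longrightarrow> c \<cdot>\<^sub>v v \<in> W"
  using assms by (auto simp: subspace_def submodule_def module_vec_simps)

lemma vec_fun_image_subspace: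
  assumes W: "subspace class_ring W (module_vec TYPE(complex) d)"
  shows "fs.subspace (vec_fun ` W)"
proof (rule fs.subspaceI)
  note w = vec_subspaceD[OF W]
  show "0 \<in> vec_fun ` W" using w(2) vec_fun_zero by (metis imageI)
  show "f + g \<in> vec_fun ` W" if fg: "f \<in> vec_fun ` W" "g \<in> vec_fun ` W" for f g
  proof -
    obtain u v where uv: "u \<in> W" "v \<in> W" "f = vec_fun u" "g = vec_fun v" using fg by blast
    then have "f + g = vec_fun (u + v)" using w(1) by (simp add: vec_fun_add[of u d v] subset_iff)
    then show ?thesis using w(3) uv by blast
  qed
  show "smul c f \<in> vec_fun ` W" if f: "f \<in> vec_fun ` W" for c f
  proof -
    obtain u where "u \<in> W" "f = vec_fun u" using f by blast
    then show ?thesis using w(4)[of u c] by (simp add: vec_fun_smult[symmetric])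
  qed
qed

lemma irreducible_stable:
  assumes V: "irreducible_rep G (d, \<rho>)" and S: "fs.subspace S" "S \<subseteq> coords d"
    and st: "\<And>x f. x \<in> G \<Longrightarrow> f \<in> S \<Longrightarrow> mat_act d (\<rho> x) f \<in> S"
  shows "S = {0} \<or> S = coords d"
proof -
  define W where "W = {v \<in> carrier_vec d. vec_fun v \<in> S}"
  have im: "vec_fun ` W = S"
  proof
    show "S \<subseteq> vec_fun ` W"
    proof
      fix f assume "f \<in> S"
      then have "vec_fun (vec d f) = f" "f \<in> S" using S(2) vec_fun_vec by auto
      then show "f \<in> vec_fun ` W" unfolding W_def by (intro image_eqI[of _ _ "vec d f"]) auto
    qed
  qed (auto simp: W_def)
  have "subspace class_ring W (module_vec TYPE(complex) d)"
    by (rule vec_subspaceI)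
      (use S(1) in \<open>auto simp: W_def vec_fun_zero vec_fun_smult vec_fun_add fs.subspace_0 fs.subspace_scale fs.subspace_add\<close>)
  moreover have "\<forall>x\<in>G. \<forall>w\<in>W. \<rho> x *\<^sub>v w \<in> W"
  proof (intro ballI)
    fix x w assume x: "x \<in> G" and w: "w \<in> W"
    have "\<rho> x \<in> carrier_mat d d" using V x by (simp add: irreducible_rep_def is_rep_def)
    then show "\<rho> x *\<^sub>v w \<in> W" using w st[OF x] vec_fun_mult[of w d "\<rho> x"] by (auto simp: W_def)
  qed
  ultimately have "W = {0\<^sub>v d} \<or> W = carrier_vec d" using V by (auto simp: irreducible_rep_def)
  then show ?thesis
  proof
    assume "W = {0\<^sub>v d}"
    then have "S = {0}" using im vec_fun_zero by force
    then show ?thesis ..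
  next
    assume W: "W = carrier_vec d"
    have "coords d \<subseteq> S"
    proof
      fix f assume "f \<in> coords d"
      then have "vec_fun (vec d f) = f" by (rule vec_fun_vec)
      moreover have "vec_fun (vec d f) \<in> S" using W im by auto
      ultimately show "f \<in> S" by simp
    qed
    then show ?thesis using S(2) by blast
  qed
qed

text \<open>
  A linear relation with trivial kernel on one side maps a basis of \<open>A\<close> to a spanning set of \<open>B\<close>.
  Isomorphisms occur below only as such relations.
\<close>

lemma dim_relation_le:
  fixes A :: "('a \<Rightarrow> complex) set" and B :: "('b \<Rightarrow> complex) set"
  assumes fin: "finite S" "\<And>f i. f \<in> A \<Longrightarrow> f i \<noteq> 0 \<Longrightarrow> i \<in> S"
    and radd: "\<And>f g f' g'. R f g \<Longrightarrow> R f' g' \<Longrightarrow> R (f + f') (g + g')"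
    and rsmul: "\<And>c f g. R f g \<Longrightarrow> R (smul c f) (smul c g)"
    and r0: "\<And>g. R 0 g \<Longrightarrow> g = 0"
    and AB: "\<And>f. f \<in> A \<Longrightarrow> \<exists>g. R f g" and BA: "\<And>g. g \<in> B \<Longrightarrow> \<exists>f\<in>A. R f g"
  shows "fs.dim B \<le> fs.dim A"
proof -
  obtain b where b: "finite b" "b \<subseteq> A" "fs.independent b" "A \<subseteq> fs.span b" "card b = fs.dim A"
    by (rule finite_basis[OF fin])
  define \<Psi> where "\<Psi> f = (SOME g. R f g)" for f
  have \<Psi>: "R f (\<Psi> f)" if f: "f \<in> b" for f
  proof -
    have "f \<in> A" using f b(2) by auto
    then have "\<exists>g. R f g" by (rule AB)
    then show ?thesis unfolding \<Psi>_def by (rule someI_ex)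
  qed
  have "B \<subseteq> fs.span (\<Psi> ` b)"
  proof
    fix g assume "g \<in> B"
    then have "\<exists>f\<in>A. R f g" by (rule BA)
    then obtain f where f: "f \<in> A" "R f g" by (elim bexE)
    then have "f \<in> fs.span b" using b(4) by auto
    then obtain c where c: "f = (\<Sum>v\<in>b. smul (c v) v)" unfolding fs.span_finite[OF b(1)] by auto
    have R0: "R 0 0" using rsmul[OF f(2), of 0] by simp
    have "b' \<subseteq> b \<Longrightarrow> finite b' \<Longrightarrow> R (\<Sum>v\<in>b'. smul (c v) v) (\<Sum>v\<in>b'. smul (c v) (\<Psi> v))" for b'
      by (rotate_tac, induction b' rule: finite_induct) (auto simp: R0 intro!: radd rsmul \<Psi>)
    then have "R f (\<Sum>v\<in>b. smul (c v) (\<Psi> v))" using b(1) c by simp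
    then have "R (smul (-1) f + f) (smul (-1) g + (\<Sum>v\<in>b. smul (c v) (\<Psi> v)))"
      by (intro radd rsmul f(2))
    moreover have "smul (-1) f + f = 0" by (simp add: fun_simps)
    ultimately have "R 0 (smul (-1) g + (\<Sum>v\<in>b. smul (c v) (\<Psi> v)))" by (simp only:)
    from r0[OF this] have "g = (\<Sum>v\<in>b. smul (c v) (\<Psi> v))"
      by (simp add: fs.scale_minus_left eq_neg_iff_add_eq_0 add.commute)
    also have "\<dots> \<in> fs.span (\<Psi> ` b)" by (intro fs.span_sum fs.span_scale fs.span_base) auto
    finally show "g \<in> fs.span (\<Psi> ` b)" .
  qed
  then have "fs.dim B \<le> card (\<Psi> ` b)" using b(1) by (intro fs.dim_le_card) auto
  also have "\<dots> \<le> card b" using b(1) by (rule card_image_le)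
  finally show ?thesis using b(5) by simp
qed

section \<open>The highest weight module inside a tensor power\<close>

text \<open>
  Elements of a direct sum of two modules of functions are functions on the disjoint union.
\<close>

definition join :: "('a \<Rightarrow> complex) \<Rightarrow> ('b \<Rightarrow> complex) \<Rightarrow> 'a + 'b \<Rightarrow> complex" where
  "join f g = case_sum f g"

definition sum_act where
  "sum_act a b x h = join (a x (\<lambda>i. h (Inl i))) (b x (\<lambda>j. h (Inr j)))"

lemma join_proj: "(\<lambda>i. join f g (Inl i)) = f" "(\<lambda>j. join f g (Inr j)) = g"
  by (simp_all add: join_def)

lemma join_eq: "join f g = join f' g' \<longleftrightarrow> f = f' \<and> g = g'"
  by (metis join_proj)

lemma join_surj: obtains f g where "h = join f g"
proof
  show "h = join (\<lambda>i. h (Inl i)) (\<lambda>j. h (Inr j))"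
    by (auto simp: join_def fun_eq_iff split: sum.split)
qed

lemma sum_act_join: "sum_act a b x (join f g) = join (a x f) (b x g)"
  by (simp add: sum_act_def join_proj)

lemma join_add: "join f g + join f' g' = join (f + f') (g + g')"
  and join_diff: "join f g - join f' g' = join (f - f') (g - g')"
  and join_smul: "smul c (join f g) = join (smul c f) (smul c g)"
  and join_zero: "join 0 0 = 0"
  by (auto simp: join_def fun_simps split: sum.split)

lemma sum_module:
  fixes a :: "complex mat \<Rightarrow> ('a \<Rightarrow> complex) \<Rightarrow> 'a \<Rightarrow> complex"
    and b :: "complex mat \<Rightarrow> ('b \<Rightarrow> complex) \<Rightarrow> 'b \<Rightarrow> complex"
  assumes "lie_module N G a" "lie_module N G b"
  shows "lie_module N G (sum_act a b)"
proof -
  interpret A: lie_module N G a by fact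
  interpret B: lie_module N G b by fact
  show ?thesis
  proof
    fix x y c and f g :: "'a + 'b \<Rightarrow> complex" assume x: "x \<in> G"
    obtain f1 f2 where f: "f = join f1 f2" by (rule join_surj)
    obtain g1 g2 where g: "g = join g1 g2" by (rule join_surj)
    show "sum_act a b x (f + g) = sum_act a b x f + sum_act a b x g"
      unfolding f g join_add sum_act_join A.act_add[OF x] B.act_add[OF x] ..
    show "sum_act a b x (smul c f) = smul c (sum_act a b x f)"
      unfolding f join_smul sum_act_join A.act_smul[OF x] B.act_smul[OF x] ..
    show "sum_act a b (c \<cdot>\<^sub>m x) f = smul c (sum_act a b x f)"
      unfolding f join_smul sum_act_join A.smult_act[OF x] B.smult_act[OF x] ..
    assume y: "y \<in> G"
    show "sum_act a b (x + y) f = sum_act a b x f + sum_act a b y f"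
      unfolding f join_add sum_act_join A.add_act[OF x y] B.add_act[OF x y] ..
    show "sum_act a b (bracket x y) f = sum_act a b x (sum_act a b y f) - sum_act a b y (sum_act a b x f)"
      unfolding f join_diff sum_act_join A.bracket_act[OF x y] B.bracket_act[OF x y] ..
  qed
qed

lemma shifts_join:
  "shifts (sum_act a b) h c ks (join f g) = join (shifts a h c ks f) (shifts b h c ks g)"
  by (induction ks) (simp_all add: sum_act_join join_smul join_diff)

definition word_wt :: "nat \<Rightarrow> nat list \<Rightarrow> weight" where
  "word_wt r w = (\<lambda>j. \<Sum>a\<leftarrow>w. letter_wt r a j)"

lemma weight_eval_word_wt: "weight_eval r (word_wt r w) t = (\<Sum>a\<leftarrow>w. weight_eval r (letter_wt r a) t)"
proof (induction w)
  case (Cons a w)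
  have "weight_eval r (word_wt r (a # w)) t = weight_eval r (letter_wt r a) t + weight_eval r (word_wt r w) t"
    by (simp add: weight_eval_def word_wt_def distrib_right sum.distrib)
  then show ?case using Cons by simp
qed (simp add: weight_eval_def word_wt_def)

lemma letter_wt_E: "letter_wt r i \<in> weight_space_E r"
  by (auto simp: weight_space_E_def letter_wt_def eps_def zero_fun_apply)

lemma word_wt_E: "word_wt r w \<in> weight_space_E r"
proof -
  have "word_wt r w j = 0" if "j \<notin> {1..r}" for j
    unfolding word_wt_def using that letter_wt_E by (induction w) (auto simp: weight_space_E_def)
  then show ?thesis by (simp add: weight_space_E_def)
qed

lemma weight_eval_inject:
  assumes "\<mu> \<in> weight_space_E r" "\<nu> \<in> weight_space_E r"
    and "\<And>t. weight_eval r \<mu> t = weight_eval r \<nu> t"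
  shows "\<mu> = \<nu>"
proof
  fix j
  show "\<mu> j = \<nu> j"
  proof (cases "j \<in> {1..r}")
    case True
    have "weight_eval r \<omega> (\<lambda>i. if i = j then 1 else 0) = of_real (\<omega> j)" for \<omega>
    proof -
      have "weight_eval r \<omega> (\<lambda>i. if i = j then 1 else 0) = (\<Sum>i = 1..r. if i = j then of_real (\<omega> j) else 0)"
        unfolding weight_eval_def by (intro sum.cong) auto
      then show ?thesis using True by simp
    qed
    then show ?thesis using assms(3)[of "\<lambda>i. if i = j then 1 else 0"] by simp
  next
    case False
    then show ?thesis using assms(1,2) by (simp add: weight_space_E_def)
  qed
qed

definition wspace :: "lie_type \<Rightarrow> nat \<Rightarrow> nat \<Rightarrow> weight \<Rightarrow> (nat list \<Rightarrow> complex) set" where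
  "wspace X r n \<omega> = {f \<in> tensors (lie_size X r) n.
     \<forall>t. tact (cartan_elt X r t) f = smul (weight_eval r \<omega> t) f}"

lemma tact_cartan:
  assumes "f \<in> tensors (lie_size X r) n"
  shows "tact (cartan_elt X r t) f w = weight_eval r (word_wt r w) t * f w"
proof (cases "f w = 0")
  case False
  then have "set w \<subseteq> {..<lie_size X r}" using assms by (auto simp: tensors_def words_def)
  then have "(\<Sum>a\<leftarrow>w. if a < lie_size X r then weight_eval r (letter_wt r a) t else 0)
      = (\<Sum>a\<leftarrow>w. weight_eval r (letter_wt r a) t)"
    by (intro arg_cong[of _ _ sum_list] map_cong) auto
  then show ?thesis by (simp add: cartan_elt_diag tact_diag weight_eval_word_wt)
qed (simp add: cartan_elt_diag tact_diag)

text \<open>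
  Basis words are weight vectors, and the functionals \<open>weight_eval r \<omega>\<close> separate weights.
\<close>

lemma wspace_iff:
  assumes "\<omega> \<in> weight_space_E r"
  shows "f \<in> wspace X r n \<omega> \<longleftrightarrow> f \<in> tensors (lie_size X r) n \<and> (\<forall>w. f w \<noteq> 0 \<longrightarrow> word_wt r w = \<omega>)"
proof
  assume f: "f \<in> wspace X r n \<omega>"
  then have ft: "f \<in> tensors (lie_size X r) n" by (simp add: wspace_def)
  have "word_wt r w = \<omega>" if w: "f w \<noteq> 0" for w
  proof (rule weight_eval_inject[OF word_wt_E assms])
    fix t
    have "tact (cartan_elt X r t) f w = weight_eval r \<omega> t * f w"
      using f by (simp add: wspace_def smul_apply)
    then show "weight_eval r (word_wt r w) t = weight_eval r \<omega> t"
      using w unfolding tact_cartan[OF ft] by simp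
  qed
  then show "f \<in> tensors (lie_size X r) n \<and> (\<forall>w. f w \<noteq> 0 \<longrightarrow> word_wt r w = \<omega>)" using ft by simp
next
  assume f: "f \<in> tensors (lie_size X r) n \<and> (\<forall>w. f w \<noteq> 0 \<longrightarrow> word_wt r w = \<omega>)"
  then have "tact (cartan_elt X r t) f w = smul (weight_eval r \<omega> t) f w" for t w
    using tact_cartan[of f X r n t w] by (cases "f w = 0") (auto simp: smul_apply)
  then show "f \<in> wspace X r n \<omega>" using f by (auto simp: wspace_def)
qed

lemma wspace_subspace: "fs.subspace (wspace X r n \<omega>)"
proof (rule fs.subspaceI)
  note t = tensors_subspace[of "lie_size X r" n]
  show "0 \<in> wspace X r n \<omega>"
    using fs.subspace_0[OF t] tact_smul[of _ 0 0] by (simp add: wspace_def)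
  show "f + g \<in> wspace X r n \<omega>" if "f \<in> wspace X r n \<omega>" "g \<in> wspace X r n \<omega>" for f g
    using that fs.subspace_add[OF t] by (simp add: wspace_def tact_add fs.scale_right_distrib)
  show "smul c f \<in> wspace X r n \<omega>" if "f \<in> wspace X r n \<omega>" for c f
    using that fs.subspace_scale[OF t] by (simp add: wspace_def tact_smul mult.commute)
qed

text \<open>
  The partition whose Young diagram has columns of lengths \<open>ks\<close>, as a weight.
\<close>

definition cols_wt :: "nat list \<Rightarrow> weight" where
  "cols_wt ks = (\<lambda>j. if j \<ge> 1 then real (length (filter (\<lambda>k. j \<le> k) ks)) else 0)"

lemma col_tensor_word:
  assumes ks: "\<forall>k\<in>set ks. k \<le> r" and w: "col_tensor ks w \<noteq> 0"
  shows "w \<in> words r (sum_list ks)" "word_wt r w = cols_wt ks"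
proof -
  have c: "count_list w i = length (filter (\<lambda>k. i < k) ks)" for i using col_tensor_support[OF w] by blast
  have l: "length w = sum_list ks" using col_tensor_support[OF w] by blast
  have low: "i < r" if "i \<in> set w" for i
  proof -
    have "count_list w i \<noteq> 0" using that by (simp add: count_list_0_iff)
    then have "filter (\<lambda>k. i < k) ks \<noteq> []" using c by auto
    then obtain k where "k \<in> set ks" "i < k" by (auto simp: filter_empty_conv)
    then show ?thesis using ks by auto
  qed
  then show "w \<in> words r (sum_list ks)" using l by (auto simp: words_def)
  have *: "(\<Sum>a\<leftarrow>w. letter_wt r a j) = (if j \<ge> 1 then real (count_list w (j - 1)) else 0)" for j
    using low
  proof (induction w)
    case (Cons a w)
    then have "letter_wt r a j = (if j = a + 1 then 1 else 0)" by (simp add: letter_wt_def eps_def)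
    then show ?case using Cons by auto
  qed simp
  show "word_wt r w = cols_wt ks"
  proof
    fix j
    have "(<) m = (\<le>) (Suc m)" for m by (auto simp: fun_eq_iff Suc_le_eq)
    then show "word_wt r w j = cols_wt ks j"
      unfolding word_wt_def * c cols_wt_def by (cases j) auto
  qed
qed

lemma col_tensor_tensors: "\<forall>k\<in>set ks. k \<le> r \<Longrightarrow> r \<le> N \<Longrightarrow> col_tensor ks \<in> tensors N (sum_list ks)"
  using col_tensor_word(1)[of ks r] by (fastforce simp: tensors_def words_def)

lemma col_tensor_neq_zero: "col_tensor ks \<noteq> 0"
  using col_tensor_nonzero[of ks] by (auto simp: zero_fun_apply)

lemma form_diff_left: "form N n (f - f') g = form N n f g - form N n f' g"
  by (simp add: form_def minus_apply left_diff_distrib sum_subtractf)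

lemma dag_dag: "dag (dag x) = x"
  by (intro eq_matI) (auto simp: dag_def)

locale hw_tensor =
  fixes X :: lie_type and r :: nat and ks :: "nat list"
  assumes cols: "\<forall>k\<in>set ks. k \<le> r"
begin

abbreviation "G \<equiv> lie_alg X r"
abbreviation "N \<equiv> lie_size X r"
abbreviation "n \<equiv> sum_list ks"
abbreviation "v0 \<equiv> col_tensor ks"
abbreviation "\<mu> \<equiv> cols_wt ks"
abbreviation "W \<equiv> cyc tact G v0"
abbreviation "h0 \<equiv> cartan_elt X r (height_elt r)"
abbreviation "c0 \<equiv> complex_of_real (wheight r \<mu>)"

sublocale L: matrix_lie N G by (rule lie_alg_matrix_lie)

sublocale T: graded_module N G tact "letter_ht r"
proof -
  interpret A: lie_module N G tact by (rule L.tensor_module)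
  interpret B: graded_lie N G "letter_ht r" by (rule lie_alg_graded) (rule dual_idx_grading)
  show "graded_module N G tact (letter_ht r)" ..
qed

lemma v0_tensors: "v0 \<in> tensors N n"
  by (rule col_tensor_tensors[OF cols lie_size_bounds(2)])

lemma \<mu>_E: "\<mu> \<in> weight_space_E r"
proof -
  have "filter (\<lambda>k. j \<le> k) ks = []" if "r < j" for j using cols that by (auto simp: filter_empty_conv)
  then show ?thesis by (auto simp: weight_space_E_def cols_wt_def not_le)
qed

lemma v0_weight: "tact (cartan_elt X r t) v0 = smul (weight_eval r \<mu> t) v0"
proof -
  have "v0 \<in> wspace X r n \<mu>"
    unfolding wspace_iff[OF \<mu>_E] using v0_tensors col_tensor_word(2)[OF cols] by blast
  then show ?thesis by (simp add: wspace_def)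
qed

lemma v0_killed:
  assumes x: "x \<in> carrier_mat N N"
    and d: "\<And>i j. i < N \<Longrightarrow> j < N \<Longrightarrow> x $$ (i,j) \<noteq> 0 \<Longrightarrow> letter_ht r i > letter_ht r j"
  shows "tact x v0 = 0"
proof (rule tact_col_tensor)
  fix a j k assume k: "k \<in> set ks" and j: "j < k" and a: "a \<ge> j"
  have "j < r" using cols k j by auto
  then have "\<not> letter_ht r a > letter_ht r j" using a by (auto simp: letter_ht_def)
  then show "ent x a j = 0" using d[of a j] x by (auto simp: ent_def)
qed

lemma v0_killed_homog:
  assumes x: "x \<in> G" and h: "homog (letter_ht r) k x" and k: "k > 0"
  shows "tact x v0 = 0"
proof (rule v0_killed[OF L.carrier[OF x]])
  fix i j assume "i < N" "j < N" "x $$ (i,j) \<noteq> 0"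
  then have "letter_ht r i - letter_ht r j = k" using h L.carrier[OF x] by (simp add: homog_def)
  then show "letter_ht r i > letter_ht r j" using k by simp
qed

lemma W_tensors: "f \<in> W \<Longrightarrow> f \<in> tensors N n"
  using cyc_tensors[of G N v0 n] L.carrier v0_tensors by auto

lemma h0_dag: "dag h0 = h0"
  by (intro eq_matI) (auto simp: dag_def cartan_elt_def mat_diag_def height_elt_def)

text \<open>
  Eigenvectors of the selfadjoint operator \<open>h0\<close> for different eigenvalues are orthogonal.
\<close>

lemma shifts_orthogonal:
  assumes "\<forall>k\<in>set ks'. k > 0" "shifts tact h0 c0 ks' l = 0"
  shows "form N n l v0 = 0"
proof -
  have hc: "h0 \<in> carrier_mat N N" by (rule L.carrier[OF cartan_in_lie_alg])
  have "form N n (shifts tact h0 c0 ks' l) v0 = of_int (prod_list ks') * form N n l v0"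
  proof (induction ks')
    case (Cons k ks')
    let ?g = "shifts tact h0 c0 ks' l"
    have "form N n (tact h0 ?g) v0 = form N n ?g (tact h0 v0)"
      using form_tact[OF hc, of n ?g v0] by (simp add: h0_dag)
    also have "\<dots> = c0 * form N n ?g v0"
      by (simp add: v0_weight weight_eval_height form_smul_right)
    finally show ?case using Cons
      by (simp add: form_diff_left form_add_left form_smul_left algebra_simps)
  qed simp
  moreover have "form N n 0 v0 = 0" by (simp add: form_def zero_fun_apply)
  ultimately show ?thesis using assms prod_list_pos[OF assms(1)] by auto
qed

lemma W_decompose:
  assumes "w \<in> W"
  obtains t l ks' where "w = smul t v0 + l" "\<forall>k\<in>set ks'. k > 0" "shifts tact h0 c0 ks' l = 0"
proof (rule T.cyc_highest[OF cartan_in_lie_alg bracket_height _ v0_killed_homog _ assms])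
  fix x assume "x \<in> G" "homog (letter_ht r) 0 x"
  then have "x = cartan_elt X r (\<lambda>k. x $$ (k - 1, k - 1))" by (rule homog_zero_cartan)
  then show "\<exists>t. tact x v0 = smul t v0" using v0_weight by metis
next
  show "tact h0 v0 = smul c0 v0" by (simp add: v0_weight weight_eval_height)
qed (assumption | rule that)+

text \<open>
  By contravariance, the orthogonal complement of a submodule is a submodule; if it contains the
  generator, it contains \<open>W\<close>.
\<close>

lemma W_orthogonal:
  assumes A: "\<And>x a. x \<in> G \<Longrightarrow> a \<in> A \<Longrightarrow> tact x a \<in> A"
    and o: "\<And>a. a \<in> A \<Longrightarrow> form N n a v0 = 0"
    and w: "w \<in> W" and a: "a \<in> A"
  shows "form N n a w = 0"
  using w a
proof (induction arbitrary: a)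
  case cyc_base
  then show ?case by (rule o)
next
  case (cyc_add f g)
  then show ?case by (simp add: form_add_right)
next
  case (cyc_smul f c)
  then show ?case by (simp add: form_smul_right)
next
  case (cyc_act x f)
  have "form N n a (tact x f) = form N n (tact (dag x) a) f"
    using form_tact[OF L.carrier[OF dag_lie_alg[OF cyc_act(1)]], of n a f] by (simp add: dag_dag)
  then show ?case using cyc_act.IH[OF A[OF dag_lie_alg[OF cyc_act(1)] cyc_act(4)]] by simp
qed

text \<open>
  A submodule \<open>A\<close> orthogonal to the generator \<open>v0\<close> is orthogonal to \<open>W\<close>, hence to itself, and vanishes
  because the form is definite. Otherwise some element of \<open>A\<close> has a nonzero component along \<open>v0\<close>; the
  lower components are removed by \<open>shifts\<close>, so \<open>v0\<close> is in \<open>A\<close>.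
\<close>

lemma W_irreducible:
  assumes A: "fs.subspace A" "A \<subseteq> W" and st: "\<And>x a. x \<in> G \<Longrightarrow> a \<in> A \<Longrightarrow> tact x a \<in> A"
  shows "A = {0} \<or> A = W"
proof (cases "\<forall>a\<in>A. form N n a v0 = 0")
  case True
  have "a = 0" if a: "a \<in> A" for a
  proof (rule form_definite[of _ N n])
    show "a \<in> tensors N n" using a A(2) W_tensors by auto
    show "form N n a a = 0" using W_orthogonal[of A a a] st True a A(2) by auto
  qed
  then show ?thesis using fs.subspace_0[OF A(1)] by auto
next
  case False
  then obtain a where a: "a \<in> A" "form N n a v0 \<noteq> 0" by blast
  have "a \<in> W" using a(1) A(2) by auto
  then obtain t l ks' where d: "a = smul t v0 + l" "\<forall>k\<in>set ks'. k > 0" "shifts tact h0 c0 ks' l = 0"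
    by (rule W_decompose)
  have "t \<noteq> 0"
  proof
    assume "t = 0"
    then have "a = l" using d(1) by simp
    then show False using a(2) shifts_orthogonal[OF d(2,3)] by simp
  qed
  have sh: "shifts tact h0 c0 ks' a \<in> A" for ks'
    by (induction ks') (auto simp: a(1) intro!: fs.subspace_diff fs.subspace_scale A(1) st cartan_in_lie_alg)
  have "shifts tact h0 c0 ks' a = smul (t * of_int (prod_list ks')) v0"
  proof -
    have "tact h0 v0 = smul c0 v0" by (simp add: v0_weight weight_eval_height)
    from T.shifts_eigen[OF cartan_in_lie_alg this] show ?thesis
      unfolding d(1) T.shifts_add[OF cartan_in_lie_alg] T.shifts_smul[OF cartan_in_lie_alg] d(3) by simp
  qed
  then have "smul (t * of_int (prod_list ks')) v0 \<in> A" using sh[of ks'] by simp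
  then have "smul (inverse (t * of_int (prod_list ks'))) (smul (t * of_int (prod_list ks')) v0) \<in> A"
    by (rule fs.subspace_scale[OF A(1)])
  moreover have "t * of_int (prod_list ks') \<noteq> 0"
    using \<open>t \<noteq> 0\<close> prod_list_pos[OF d(2)] by (metis less_irrefl mult_eq_0_iff of_int_eq_0_iff)
  ultimately have v0A: "v0 \<in> A" by (metis fs.scale_scale left_inverse fs.scale_one)
  have "w \<in> A" if "w \<in> W" for w
    using that
  proof induction
    case cyc_base
    show ?case by (rule v0A)
  qed (auto intro: fs.subspace_add fs.subspace_scale A(1) st)
  then show ?thesis using A(2) by auto
qed

end

section \<open>Uniqueness of the irreducible module\<close>

lemma (in hw_tensor) highest_vector:
  assumes V: "irreducible_rep G (d, \<rho>)" and hw: "has_highest_weight X r (d, \<rho>) \<mu>"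
  obtains v where "v \<in> coords d" "v \<noteq> 0"
    "\<And>t. mat_act d (\<rho> (cartan_elt X r t)) v = smul (weight_eval r \<mu> t) v"
    "\<And>x k. x \<in> G \<Longrightarrow> homog (letter_ht r) k x \<Longrightarrow> k > 0 \<Longrightarrow> mat_act d (\<rho> x) v = 0"
proof -
  have rep: "is_rep G (d, \<rho>)" using V by (simp add: irreducible_rep_def)
  interpret M: lie_module N G "\<lambda>x. mat_act d (\<rho> x)" by (rule rep_module[OF L.matrix_lie_axioms rep])
  have c: "\<rho> x \<in> carrier_mat d d" if "x \<in> G" for x using rep that by (simp add: is_rep_def)
  obtain u where u: "u \<in> weight_space X r (d, \<rho>) \<mu>" "u \<noteq> 0\<^sub>v d"
    and k: "\<And>\<beta> x. \<beta> \<in> positive_roots X r \<Longrightarrow> x \<in> root_space X r \<beta> \<Longrightarrow> \<rho> x *\<^sub>v u = 0\<^sub>v d"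
    using hw unfolding has_highest_weight_def by auto
  have uc: "u \<in> carrier_vec d" using u(1) by (simp add: weight_space_def)
  show thesis
  proof (rule that[of "vec_fun u"])
    show "vec_fun u \<in> coords d" by (rule vec_fun_coords[OF uc])
    show "vec_fun u \<noteq> 0" using vec_fun_inj[OF uc, of "0\<^sub>v d"] u(2) by (simp add: vec_fun_zero)
    fix t
    have e: "\<rho> (cartan_elt X r t) *\<^sub>v u = weight_eval r \<mu> t \<cdot>\<^sub>v u" using u(1) by (simp add: weight_space_def)
    have "mat_act d (\<rho> (cartan_elt X r t)) (vec_fun u) = vec_fun (\<rho> (cartan_elt X r t) *\<^sub>v u)"
      by (rule vec_fun_mult[OF uc c[OF cartan_in_lie_alg], symmetric])
    then show "mat_act d (\<rho> (cartan_elt X r t)) (vec_fun u) = smul (weight_eval r \<mu> t) (vec_fun u)"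
      unfolding e vec_fun_smult .
  next
    fix x k assume x: "x \<in> G" and h: "homog (letter_ht r) k x" and kp: "k > 0"
    show "mat_act d (\<rho> x) (vec_fun u) = 0"
    proof (rule positive_part_induct[OF x])
      fix i j assume "i < N" "j < N" "x $$ (i,j) \<noteq> 0"
      then have "letter_ht r i - letter_ht r j = k" using h L.carrier[OF x] by (simp add: homog_def)
      then show "letter_ht r i > letter_ht r j" using kp by simp
    next
      fix \<beta> y assume b: "\<beta> \<in> positive_roots X r" and y: "y \<in> root_space X r \<beta>"
      then have yG: "y \<in> G" by (simp add: root_space_def)
      show "mat_act d (\<rho> y) (vec_fun u) = 0"
        unfolding vec_fun_mult[OF uc c[OF yG], symmetric] k[OF b y] by (rule vec_fun_zero)
    qed (simp_all add: M.add_act)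
  qed
qed

text \<open>
  The relation \<open>R\<close> below is the submodule of the direct sum generated by the pair of highest weight
  vectors. It is shown to be the graph of an isomorphism onto \<open>W\<close>.
\<close>

locale hw_pair = hw_tensor +
  fixes d :: nat and \<rho> :: "complex mat \<Rightarrow> complex mat" and v :: "nat \<Rightarrow> complex"
  assumes irred: "irreducible_rep G (d, \<rho>)"
    and v_coords: "v \<in> coords d" and v_neq: "v \<noteq> 0"
    and v_weight: "\<And>t. mat_act d (\<rho> (cartan_elt X r t)) v = smul (weight_eval r \<mu> t) v"
    and v_killed: "\<And>x k. x \<in> G \<Longrightarrow> homog (letter_ht r) k x \<Longrightarrow> k > 0 \<Longrightarrow> mat_act d (\<rho> x) v = 0"
begin

abbreviation "vact \<equiv> \<lambda>x. mat_act d (\<rho> x)"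
abbreviation "R f g \<equiv> join f g \<in> cyc (sum_act vact tact) G (join v v0)"

lemma rep: "is_rep G (d, \<rho>)"
  using irred by (simp add: irreducible_rep_def)

sublocale M: lie_module N G vact
  by (rule rep_module[OF L.matrix_lie_axioms rep])

sublocale P: graded_module N G "sum_act vact tact" "letter_ht r"
proof -
  interpret A: lie_module N G "sum_act vact tact"
    by (rule sum_module[OF M.lie_module_axioms T.lie_module_axioms])
  show "graded_module N G (sum_act vact tact) (letter_ht r)" ..
qed

lemma R_add: "R f g \<Longrightarrow> R f' g' \<Longrightarrow> R (f + f') (g + g')"
  unfolding join_add[symmetric] by (rule cyc.cyc_add)

lemma R_smul: "R f g \<Longrightarrow> R (smul c f) (smul c g)"
  unfolding join_smul[symmetric] by (rule cyc.cyc_smul)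

lemma R_act: "x \<in> G \<Longrightarrow> R f g \<Longrightarrow> R (vact x f) (tact x g)"
  using cyc.cyc_act[of x G "join f g" "sum_act vact tact" "join v v0"] by (simp add: sum_act_join)

lemma R_base: "R v v0"
  by (rule cyc.cyc_base)

lemma R_diff: "R f g \<Longrightarrow> R f' g' \<Longrightarrow> R (f - f') (g - g')"
proof -
  assume "R f g" "R f' g'"
  then have "R (f + smul (-1) f') (g + smul (-1) g')" by (intro R_add R_smul)
  then show ?thesis by simp
qed

lemma R_coords: "R f g \<Longrightarrow> f \<in> coords d \<and> g \<in> W"
proof -
  assume "R f g"
  moreover have "\<forall>f g. h = join f g \<longrightarrow> f \<in> coords d \<and> g \<in> W"
    if "h \<in> cyc (sum_act vact tact) G (join v v0)" for h
    using that
  proof induction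
    case cyc_base
    then show ?case using v_coords by (auto simp: join_eq intro: cyc.cyc_base)
  next
    case (cyc_add a b)
    obtain a1 a2 where a: "a = join a1 a2" by (rule join_surj)
    obtain b1 b2 where b: "b = join b1 b2" by (rule join_surj)
    show ?case using cyc_add.IH unfolding a b join_add join_eq
      by (auto intro: fs.subspace_add[OF coords_subspace] cyc.cyc_add)
  next
    case (cyc_smul a c)
    obtain a1 a2 where a: "a = join a1 a2" by (rule join_surj)
    show ?case using cyc_smul.IH unfolding a join_smul join_eq
      by (auto intro: fs.subspace_scale[OF coords_subspace] cyc.cyc_smul)
  next
    case (cyc_act x a)
    obtain a1 a2 where a: "a = join a1 a2" by (rule join_surj)
    show ?case using cyc_act.IH cyc_act.hyps(1) unfolding a sum_act_join join_eq
      by (auto intro: mat_act_coords cyc.cyc_act)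
  qed
  ultimately show ?thesis by blast
qed

lemma R_decompose:
  assumes "R f g"
  obtains t l m ks' where "f = smul t v + l" "g = smul t v0 + m" "\<forall>k\<in>set ks'. k > 0"
    "shifts vact h0 c0 ks' l = 0" "shifts tact h0 c0 ks' m = 0"
proof (rule P.cyc_highest[OF cartan_in_lie_alg bracket_height _ _ _ assms])
  fix x assume x: "x \<in> G" "homog (letter_ht r) 0 x"
  then have "x = cartan_elt X r (\<lambda>k. x $$ (k - 1, k - 1))" by (rule homog_zero_cartan)
  then obtain t where t: "x = cartan_elt X r t" by blast
  show "\<exists>s. sum_act vact tact x (join v v0) = smul s (join v v0)"
    unfolding t sum_act_join v_weight v0_weight join_smul by blast
next
  fix x k assume "x \<in> G" "homog (letter_ht r) k x" "0 < k"
  then show "sum_act vact tact x (join v v0) = 0"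
    by (simp add: sum_act_join v_killed v0_killed_homog join_zero)
next
  show "sum_act vact tact h0 (join v v0) = smul c0 (join v v0)"
    by (simp add: sum_act_join v_weight v0_weight weight_eval_height join_smul)
next
  fix t l ks'
  assume *: "join f g = smul t (join v v0) + l" "\<forall>k\<in>set ks'. 0 < k"
    "shifts (sum_act vact tact) h0 c0 ks' l = 0"
  obtain l1 l2 where l: "l = join l1 l2" by (rule join_surj)
  have "f = smul t v + l1" "g = smul t v0 + l2" using *(1) unfolding l join_smul join_add join_eq by auto
  moreover have "shifts vact h0 c0 ks' l1 = 0" "shifts tact h0 c0 ks' l2 = 0"
    using *(3) unfolding l shifts_join join_zero[symmetric] join_eq by auto
  ultimately show thesis using *(2) by (intro that)
qed

lemma shifts_v: "shifts vact h0 c0 ks' (smul t v) = smul (t * of_int (prod_list ks')) v"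
proof -
  have "vact h0 v = smul c0 v" by (simp add: v_weight weight_eval_height)
  from M.shifts_eigen[OF cartan_in_lie_alg this] show ?thesis
    unfolding M.shifts_smul[OF cartan_in_lie_alg] by simp
qed

lemma shifts_v0: "shifts tact h0 c0 ks' (smul t v0) = smul (t * of_int (prod_list ks')) v0"
proof -
  have "tact h0 v0 = smul c0 v0" by (simp add: v0_weight weight_eval_height)
  from T.shifts_eigen[OF cartan_in_lie_alg this] show ?thesis
    unfolding T.shifts_smul[OF cartan_in_lie_alg] by simp
qed

text \<open>
  The elements related to \<open>0\<close> form a submodule of \<open>W\<close>. An element of \<open>R\<close> is a multiple of the
  generator plus lower vectors, with the same multiple in both components, so these elements are
  orthogonal to \<open>v0\<close>.
\<close>

lemma R_zero_left: assumes "R 0 g" shows "g = 0"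
proof -
  define A where "A = {g. R 0 g}"
  have AW: "a \<in> W" if "a \<in> A" for a using that R_coords by (auto simp: A_def)
  have st: "tact x a \<in> A" if "x \<in> G" "a \<in> A" for x a
    using R_act[of x 0 a] that by (simp add: A_def)
  have o: "form N n a v0 = 0" if a: "a \<in> A" for a
  proof -
    have "R 0 a" using a by (simp add: A_def)
    then obtain t l m ks' where *: "0 = smul t v + l" "a = smul t v0 + m" "\<forall>k\<in>set ks'. k > 0"
      "shifts vact h0 c0 ks' l = 0" "shifts tact h0 c0 ks' m = 0" by (rule R_decompose)
    have "shifts vact h0 c0 ks' (smul t v + l) = 0"
      using *(1) M.shifts_zero[OF cartan_in_lie_alg] by metis
    then have "smul (t * of_int (prod_list ks')) v = 0"
      unfolding M.shifts_add[OF cartan_in_lie_alg] *(4) shifts_v by simp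
    then have "t * of_int (prod_list ks') = 0" using v_neq by (simp only: fs.scale_eq_0_iff) simp
    then have "t = 0" using prod_list_pos[OF *(3)] by (metis less_irrefl mult_eq_0_iff of_int_eq_0_iff)
    then have "a = m" using *(2) by simp
    then show ?thesis using shifts_orthogonal[OF *(3,5)] by simp
  qed
  have g: "g \<in> A" using assms by (simp add: A_def)
  show ?thesis
  proof (rule form_definite)
    show "g \<in> tensors N n" by (rule W_tensors[OF AW[OF g]])
    show "form N n g g = 0" by (rule W_orthogonal[OF st o AW[OF g] g])
  qed
qed

text \<open>
  The elements related to \<open>0\<close> form a submodule of the irreducible module \<open>V\<close>, and \<open>v\<close> is not one
  of them, since the multiple of the generator would be \<open>1\<close> in one component and \<open>0\<close> in the other.
\<close>

lemma R_zero_right: assumes "R f 0" shows "f = 0"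
proof -
  define A where "A = {f. R f 0}"
  have "fs.subspace A"
  proof (rule fs.subspaceI)
    show "0 \<in> A" using R_smul[OF R_base, of 0] by (simp add: A_def)
    show "a + b \<in> A" if "a \<in> A" "b \<in> A" for a b using R_add[of a 0 b 0] that by (simp add: A_def)
    show "smul c a \<in> A" if "a \<in> A" for c a using R_smul[of a 0 c] that by (simp add: A_def)
  qed
  moreover have "A \<subseteq> coords d" using R_coords by (auto simp: A_def)
  moreover have "vact x a \<in> A" if "x \<in> G" "a \<in> A" for x a
    using R_act[of x a 0] that by (simp add: A_def)
  ultimately have "A = {0} \<or> A = coords d" by (rule irreducible_stable[OF irred])
  moreover have "v \<notin> A"
  proof
    assume "v \<in> A"
    then have "R v 0" by (simp add: A_def)
    then obtain t l m ks' where *: "v = smul t v + l" "0 = smul t v0 + m" "\<forall>k\<in>set ks'. k > 0"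
      "shifts vact h0 c0 ks' l = 0" "shifts tact h0 c0 ks' m = 0" by (rule R_decompose)
    have p: "of_int (prod_list ks') \<noteq> (0::complex)"
      using prod_list_pos[OF *(3)] by (metis less_irrefl of_int_eq_0_iff)
    have "shifts tact h0 c0 ks' (smul t v0 + m) = 0"
      using *(2) T.shifts_zero[OF cartan_in_lie_alg] by metis
    then have "smul (t * of_int (prod_list ks')) v0 = 0"
      unfolding T.shifts_add[OF cartan_in_lie_alg] *(5) shifts_v0 by simp
    then have "t * of_int (prod_list ks') = 0" using col_tensor_neq_zero by (simp only: fs.scale_eq_0_iff) simp
    then have "t = 0" using p by simp
    then have "v = l" using *(1) by simp
    then have "shifts vact h0 c0 ks' (smul 1 v) = 0" using *(4) by simp
    then have "smul (1 * of_int (prod_list ks')) v = 0" unfolding shifts_v .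
    then show False using p v_neq by (simp only: fs.scale_eq_0_iff) simp
  qed
  ultimately have "A = {0}" using v_coords by auto
  then show ?thesis using assms by (auto simp: A_def)
qed

lemma R_left_total: assumes "f \<in> coords d" shows "\<exists>g. R f g"
proof -
  define A where "A = {f. \<exists>g. R f g}"
  have "fs.subspace A"
  proof (rule fs.subspaceI)
    show "0 \<in> A" using R_smul[OF R_base, of 0] by (auto simp: A_def)
    show "a + b \<in> A" if "a \<in> A" "b \<in> A" for a b using R_add that unfolding A_def by blast
    show "smul c a \<in> A" if "a \<in> A" for c a using R_smul that unfolding A_def by blast
  qed
  moreover have "A \<subseteq> coords d" using R_coords by (auto simp: A_def)
  moreover have "vact x a \<in> A" if "x \<in> G" "a \<in> A" for x a
    using R_act[of x a] that unfolding A_def by blast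
  ultimately have "A = {0} \<or> A = coords d" by (rule irreducible_stable[OF irred])
  moreover have "v \<in> A" using R_base by (auto simp: A_def)
  ultimately have "A = coords d" using v_neq by auto
  then show ?thesis using assms by (auto simp: A_def)
qed

lemma R_right_total: assumes "g \<in> W" shows "\<exists>f. R f g"
  using assms
proof induction
  case cyc_base
  show ?case using R_base by blast
next
  case (cyc_add f g)
  then show ?case using R_add by blast
next
  case (cyc_smul f c)
  then show ?case using R_smul by blast
next
  case (cyc_act x f)
  then show ?case using R_act by blast
qed

lemma vec_fun_weight_space:
  "vec_fun ` weight_space X r (d, \<rho>) \<omega> = {f \<in> coords d. \<forall>t. vact (cartan_elt X r t) f = smul (weight_eval r \<omega> t) f}"
proof -
  have c: "\<rho> (cartan_elt X r t) \<in> carrier_mat d d" for t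
    using rep cartan_in_lie_alg by (simp add: is_rep_def)
  have eq: "\<rho> (cartan_elt X r t) *\<^sub>v u = weight_eval r \<omega> t \<cdot>\<^sub>v u \<longleftrightarrow>
      vact (cartan_elt X r t) (vec_fun u) = smul (weight_eval r \<omega> t) (vec_fun u)" if u: "u \<in> carrier_vec d" for u t
    using vec_fun_inj[of "\<rho> (cartan_elt X r t) *\<^sub>v u" d "weight_eval r \<omega> t \<cdot>\<^sub>v u"] u c[of t]
    by (simp add: vec_fun_mult vec_fun_smult)
  show ?thesis
  proof (intro equalityI subsetI)
    fix f assume "f \<in> vec_fun ` weight_space X r (d, \<rho>) \<omega>"
    then show "f \<in> {f \<in> coords d. \<forall>t. vact (cartan_elt X r t) f = smul (weight_eval r \<omega> t) f}"
      using eq by (auto simp: weight_space_def vec_fun_coords)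
  next
    fix f assume f: "f \<in> {f \<in> coords d. \<forall>t. vact (cartan_elt X r t) f = smul (weight_eval r \<omega> t) f}"
    then have e: "vec_fun (vec d f) = f" by (auto intro: vec_fun_vec)
    then have "vec d f \<in> weight_space X r (d, \<rho>) \<omega>"
      using f eq[of "vec d f"] by (simp add: weight_space_def)
    then show "f \<in> vec_fun ` weight_space X r (d, \<rho>) \<omega>" using e by (metis imageI)
  qed
qed

text \<open>
  If \<open>f\<close> and \<open>g\<close> are related, so are the results of applying \<open>h - \<omega>(h)\<close> to them, and one vanishes if
  and only if the other does.
\<close>

lemma R_weight:
  assumes "R f g"
  shows "f \<in> vec_fun ` weight_space X r (d, \<rho>) \<omega> \<longleftrightarrow> g \<in> W \<inter> wspace X r n \<omega>"
proof -
  have "R (vact (cartan_elt X r t) f - smul (weight_eval r \<omega> t) f)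
      (tact (cartan_elt X r t) g - smul (weight_eval r \<omega> t) g)" for t
    by (intro R_diff R_act R_smul assms cartan_in_lie_alg)
  then have "vact (cartan_elt X r t) f = smul (weight_eval r \<omega> t) f \<longleftrightarrow>
      tact (cartan_elt X r t) g = smul (weight_eval r \<omega> t) g" for t
    using R_zero_left[of "tact (cartan_elt X r t) g - smul (weight_eval r \<omega> t) g"]
      R_zero_right[of "vact (cartan_elt X r t) f - smul (weight_eval r \<omega> t) f"]
    by (metis eq_iff_diff_eq_0)
  then show ?thesis using R_coords[OF assms] W_tensors[of g]
    unfolding vec_fun_weight_space wspace_def by auto
qed

lemma weight_space_dim:
  "fs.dim (vec_fun ` weight_space X r (d, \<rho>) \<omega>) = fs.dim (W \<inter> wspace X r n \<omega>)"
proof (rule antisym)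
  show "fs.dim (W \<inter> wspace X r n \<omega>) \<le> fs.dim (vec_fun ` weight_space X r (d, \<rho>) \<omega>)"
  proof (rule dim_relation_le[of "{..<d}" _ R])
    fix f i assume "f \<in> vec_fun ` weight_space X r (d, \<rho>) \<omega>" "f i \<noteq> 0"
    then show "i \<in> {..<d}" unfolding vec_fun_weight_space by (auto simp: coords_def not_less[symmetric])
  next
    fix f assume "f \<in> vec_fun ` weight_space X r (d, \<rho>) \<omega>"
    then show "\<exists>g. R f g" unfolding vec_fun_weight_space by (intro R_left_total) simp
  next
    fix g assume g: "g \<in> W \<inter> wspace X r n \<omega>"
    then obtain f where "R f g" using R_right_total by blast
    then show "\<exists>f\<in>vec_fun ` weight_space X r (d, \<rho>) \<omega>. R f g" using R_weight g by blast
  qed (simp_all add: R_add R_smul R_zero_left)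
next
  show "fs.dim (vec_fun ` weight_space X r (d, \<rho>) \<omega>) \<le> fs.dim (W \<inter> wspace X r n \<omega>)"
  proof (rule dim_relation_le[of "words N n" _ "\<lambda>g f. R f g"])
    fix f i assume "f \<in> W \<inter> wspace X r n \<omega>" "f i \<noteq> 0"
    then show "i \<in> words N n" by (auto simp: wspace_def tensors_def)
  next
    fix g assume "g \<in> W \<inter> wspace X r n \<omega>"
    then show "\<exists>f. R f g" by (intro R_right_total) simp
  next
    fix f assume f: "f \<in> vec_fun ` weight_space X r (d, \<rho>) \<omega>"
    then have "f \<in> coords d" unfolding vec_fun_weight_space by simp
    then obtain g where "R f g" using R_left_total by blast
    then show "\<exists>g\<in>W \<inter> wspace X r n \<omega>. R f g" using R_weight f by blast
  qed (simp_all add: R_add R_smul R_zero_right)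
qed

lemma weight_space_trivial:
  "weight_space X r (d, \<rho>) \<omega> = {0\<^sub>v d} \<longleftrightarrow> W \<inter> wspace X r n \<omega> = {0}"
proof -
  let ?U = "weight_space X r (d, \<rho>) \<omega>"
  have Uc: "?U \<subseteq> carrier_vec d" by (auto simp: weight_space_def)
  have 0: "0 \<in> vec_fun ` ?U" unfolding vec_fun_weight_space
    using fs.subspace_0[OF coords_subspace] M.act_zero[OF cartan_in_lie_alg] by simp
  have W0: "0 \<in> W \<inter> wspace X r n \<omega>"
    using fs.subspace_0[OF cyc_subspace] fs.subspace_0[OF wspace_subspace] by blast
  have "?U = {0\<^sub>v d} \<longleftrightarrow> vec_fun ` ?U = {0}"
  proof
    assume "vec_fun ` ?U = {0}"
    then have "u = 0\<^sub>v d" if "u \<in> ?U" for u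
      using that Uc vec_fun_inj[of u d "0\<^sub>v d"] by (auto simp: vec_fun_zero)
    moreover have "?U \<noteq> {}" using 0 by auto
    ultimately show "?U = {0\<^sub>v d}" by blast
  qed (simp add: vec_fun_zero)
  also have "\<dots> \<longleftrightarrow> W \<inter> wspace X r n \<omega> = {0}"
  proof
    assume v: "vec_fun ` ?U = {0}"
    have "g = 0" if g: "g \<in> W \<inter> wspace X r n \<omega>" for g
    proof -
      obtain f where f: "R f g" using R_right_total g by blast
      then have "f = 0" using R_weight[OF f] g v by blast
      then show ?thesis using f R_zero_left by simp
    qed
    then show "W \<inter> wspace X r n \<omega> = {0}" using W0 by blast
  next
    assume w: "W \<inter> wspace X r n \<omega> = {0}"
    have "f = 0" if f: "f \<in> vec_fun ` ?U" for f
    proof -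
      have "f \<in> coords d" using f unfolding vec_fun_weight_space by simp
      then obtain g where g: "R f g" using R_left_total by blast
      then have "g = 0" using R_weight[OF g] f w by blast
      then show ?thesis using g R_zero_right by simp
    qed
    then show "vec_fun ` ?U = {0}" using 0 by blast
  qed
  finally show ?thesis .
qed

end

section \<open>Existence of the irreducible module\<close>

lemma mat_eq_mat_act:
  assumes c: "A \<in> carrier_mat d d" "B \<in> carrier_mat d d"
    and e: "\<And>f. f \<in> coords d \<Longrightarrow> mat_act d A f = mat_act d B f"
  shows "A = B"
proof (rule eq_matI)
  have col: "mat_act d M (unit j) i = M $$ (i,j)" if "i < d" "j < d" for M i j
  proof -
    have "(\<Sum>k<d. M $$ (i,k) * unit j k) = (\<Sum>k<d. if k = j then M $$ (i,j) else 0)"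
      by (intro sum.cong) (auto simp: unit_def)
    then show ?thesis using that by (simp add: mat_act_def)
  qed
  fix i j assume "i < dim_row B" "j < dim_col B"
  then have ij: "i < d" "j < d" using c by auto
  have "unit j \<in> coords d" using ij by (auto simp: coords_def unit_def)
  then show "A $$ (i,j) = B $$ (i,j)" using e[of "unit j"] col[OF ij, of A] col[OF ij, of B] by simp
qed (use c in auto)

text \<open>
  The action on \<open>W\<close>, written as matrices in a basis of \<open>W\<close>. The map \<open>\<iota>\<close> sends coordinates to
  tensors; it is injective on coordinates and intertwines the actions, so every property of the
  matrices is checked after applying \<open>\<iota>\<close>.
\<close>

lemma (in hw_tensor) irrep_exists:
  "\<exists>V. irreducible_rep G V \<and> has_highest_weight X r V \<mu>"
proof -
  have Wsub: "fs.subspace W" by (rule cyc_subspace)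
  obtain b where b: "finite b" "b \<subseteq> W" "fs.independent b" "W \<subseteq> fs.span b"
  proof (rule finite_basis[of "words N n" W])
    show "f w \<noteq> 0 \<Longrightarrow> w \<in> words N n" if "f \<in> W" for f w
      using W_tensors[OF that] by (simp add: tensors_def)
  qed auto
  define d where "d = card b"
  obtain e where e: "bij_betw e {..<d} b"
    using ex_bij_betw_nat_finite[OF b(1)] by (auto simp: d_def atLeast0LessThan)
  have eW: "e i \<in> W" if "i < d" for i using e b(2) that by (auto simp: bij_betw_def)
  define \<iota> where "\<iota> f = (\<Sum>i<d. smul (f i) (e i))" for f :: "nat \<Rightarrow> complex"
  have \<iota>_apply: "\<iota> f w = (\<Sum>i<d. f i * e i w)" for f w
    by (simp add: \<iota>_def sum_fun_apply smul_apply)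
  have \<iota>_add: "\<iota> (f + g) = \<iota> f + \<iota> g" and \<iota>_smul: "\<iota> (smul c f) = smul c (\<iota> f)" for f g c
    by (auto simp: fun_eq_iff \<iota>_apply plus_fun_apply smul_apply distrib_right sum.distrib
        sum_distrib_left mult.assoc)
  have \<iota>_W: "\<iota> f \<in> W" for f
    unfolding \<iota>_def by (intro fs.subspace_sum[OF Wsub] fs.subspace_scale[OF Wsub] eW) auto
  have \<iota>_0: "f = 0" if f: "f \<in> coords d" "\<iota> f = 0" for f
  proof -
    define g where "g v = f (inv_into {..<d} e v)" for v
    have ge: "g (e i) = f i" if "i < d" for i
      using e that by (simp add: g_def bij_betw_def inv_into_f_f)
    have "(\<Sum>v\<in>b. smul (g v) v) = (\<Sum>i<d. smul (g (e i)) (e i))"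
      by (rule sum.reindex_bij_betw[OF e, symmetric])
    also have "\<dots> = \<iota> f" unfolding \<iota>_def by (intro sum.cong) (auto simp: ge)
    finally have "(\<Sum>v\<in>b. smul (g v) v) = 0" using f(2) by simp
    then have "g v = 0" if "v \<in> b" for v using fs.independentD[OF b(3,1) subset_refl] that by blast
    then have "f i = 0" if "i < d" for i using ge[OF that] e that by (auto simp: bij_betw_def)
    then have "f i = 0" for i using f(1) by (cases "i < d") (auto simp: coords_def)
    then show ?thesis by (simp add: fun_simps)
  qed
  have \<iota>_inj: "f = g" if fg: "f \<in> coords d" "g \<in> coords d" "\<iota> f = \<iota> g" for f g
  proof -
    have "f + smul (-1) g \<in> coords d"
      by (intro fs.subspace_add[OF coords_subspace] fs.subspace_scale[OF coords_subspace] fg)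
    moreover have "\<iota> (f + smul (-1) g) = 0" unfolding \<iota>_add \<iota>_smul fg(3) by (simp add: fun_simps)
    ultimately have "f + smul (-1) g = 0" by (rule \<iota>_0)
    then show ?thesis by (simp add: fun_simps)
  qed
  have \<iota>_surj: "\<exists>f. f \<in> coords d \<and> \<iota> f = w" if w: "w \<in> W" for w
  proof -
    have "w \<in> fs.span b" using w b(4) by blast
    then obtain c where c: "w = (\<Sum>v\<in>b. smul (c v) v)" unfolding fs.span_finite[OF b(1)] by auto
    have "(\<Sum>v\<in>b. smul (c v) v) = (\<Sum>i<d. smul (c (e i)) (e i))"
      by (rule sum.reindex_bij_betw[OF e, symmetric])
    also have "\<dots> = \<iota> (\<lambda>i. if i < d then c (e i) else 0)" unfolding \<iota>_def by (intro sum.cong) auto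
    finally have "\<iota> (\<lambda>i. if i < d then c (e i) else 0) = w" using c by simp
    then show ?thesis by (intro exI[of _ "\<lambda>i. if i < d then c (e i) else 0"]) (simp add: coords_def)
  qed
  define \<kappa> where "\<kappa> w = (SOME f. f \<in> coords d \<and> \<iota> f = w)" for w
  have \<kappa>: "\<kappa> w \<in> coords d" "\<iota> (\<kappa> w) = w" if "w \<in> W" for w
    using someI_ex[OF \<iota>_surj[OF that]] by (auto simp: \<kappa>_def)
  define \<rho> where "\<rho> x = mat d d (\<lambda>(i,j). \<kappa> (tact x (e j)) i)" for x
  have \<rho>c: "\<rho> x \<in> carrier_mat d d" for x by (simp add: \<rho>_def)
  have key: "\<iota> (mat_act d (\<rho> x) f) = tact x (\<iota> f)" if x: "x \<in> G" for x f
  proof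
    fix w
    have "\<iota> (mat_act d (\<rho> x) f) w = (\<Sum>i<d. (\<Sum>j<d. \<kappa> (tact x (e j)) i * f j) * e i w)"
      unfolding \<iota>_apply by (intro sum.cong) (auto simp: mat_act_def \<rho>_def)
    also have "\<dots> = (\<Sum>i<d. \<Sum>j<d. f j * (\<kappa> (tact x (e j)) i * e i w))"
      unfolding sum_distrib_right by (intro sum.cong refl) (simp add: mult_ac)
    also have "\<dots> = (\<Sum>j<d. \<Sum>i<d. f j * (\<kappa> (tact x (e j)) i * e i w))" by (rule sum.swap)
    also have "\<dots> = (\<Sum>j<d. f j * \<iota> (\<kappa> (tact x (e j))) w)"
      by (simp add: \<iota>_apply sum_distrib_left)
    also have "\<dots> = (\<Sum>j<d. f j * tact x (e j) w)"
      by (intro sum.cong) (auto simp: \<kappa>(2) cyc.cyc_act[OF x eW])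
    also have "\<dots> = tact x (\<lambda>u. \<Sum>j<d. f j * e j u) w" by (rule tact_sum[symmetric]) simp
    also have "(\<lambda>u. \<Sum>j<d. f j * e j u) = \<iota> f" by (simp add: \<iota>_apply fun_eq_iff)
    finally show "\<iota> (mat_act d (\<rho> x) f) w = tact x (\<iota> f) w" .
  qed
  have mat_eq: "A = B" if "A \<in> carrier_mat d d" "B \<in> carrier_mat d d"
    "\<And>f. \<iota> (mat_act d A f) = \<iota> (mat_act d B f)" for A B
    by (rule mat_eq_mat_act[OF that(1,2)], rule \<iota>_inj[OF mat_act_coords mat_act_coords that(3)])
  have rep: "is_rep G (d, \<rho>)"
    unfolding is_rep_def prod.case
  proof (intro conjI ballI allI)
    show "\<rho> x \<in> carrier_mat d d" for x by (rule \<rho>c)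
    fix x assume x: "x \<in> G"
    show "\<rho> (c \<cdot>\<^sub>m x) = c \<cdot>\<^sub>m \<rho> x" for c
      by (rule mat_eq) (simp_all add: \<rho>c mat_act_smult_mat \<iota>_smul key[OF x] key[OF L.smult[OF x]] T.smult_act[OF x])
    fix y assume y: "y \<in> G"
    show "\<rho> (x + y) = \<rho> x + \<rho> y"
      by (rule mat_eq) (simp_all add: \<rho>c mat_act_add_mat \<iota>_add key[OF x] key[OF y] key[OF L.add[OF x y]] T.add_act[OF x y])
    have \<iota>_diff: "\<iota> (f - g) = \<iota> f - \<iota> g" for f g
      using \<iota>_add[of f "smul (-1) g"] \<iota>_smul[of "-1" g] by simp
    show "\<rho> (bracket x y) = bracket (\<rho> x) (\<rho> y)"
    proof (rule mat_eq)
      show "bracket (\<rho> x) (\<rho> y) \<in> carrier_mat d d"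
        unfolding bracket_def by (rule minus_carrier_mat[OF mult_carrier_mat[OF \<rho>c \<rho>c]])
      fix f
      have "mat_act d (bracket (\<rho> x) (\<rho> y)) f = mat_act d (\<rho> x) (mat_act d (\<rho> y) f) - mat_act d (\<rho> y) (mat_act d (\<rho> x) f)"
        unfolding bracket_def mat_act_diff_mat[OF mult_carrier_mat[OF \<rho>c \<rho>c] mult_carrier_mat[OF \<rho>c \<rho>c]]
          mat_act_mult_mat[OF \<rho>c \<rho>c] ..
      then show "\<iota> (mat_act d (\<rho> (bracket x y)) f) = \<iota> (mat_act d (bracket (\<rho> x) (\<rho> y)) f)"
        by (simp add: \<iota>_diff key[OF x] key[OF y] key[OF L.brack[OF x y]] T.bracket_act[OF x y])
    qed (rule \<rho>c)
  qed
  have v0W: "v0 \<in> W" by (rule cyc.cyc_base)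
  have irr: "irreducible_rep G (d, \<rho>)"
    unfolding irreducible_rep_def prod.case
  proof (intro conjI allI impI)
    show "is_rep G (d, \<rho>)" by (rule rep)
    show "0 < d"
    proof (rule ccontr)
      assume "\<not> 0 < d"
      then have "\<iota> (\<kappa> v0) = 0" by (simp add: \<iota>_def)
      then show False using \<kappa>(2)[OF v0W] col_tensor_neq_zero by simp
    qed
    fix U assume U: "subspace class_ring U (module_vec TYPE(complex) d) \<and> (\<forall>x\<in>G. \<forall>w\<in>U. \<rho> x *\<^sub>v w \<in> U)"
    note u = vec_subspaceD[OF conjunct1[OF U]]
    define A where "A = \<iota> ` vec_fun ` U"
    have S: "fs.subspace (vec_fun ` U)" by (rule vec_fun_image_subspace[OF conjunct1[OF U]])
    have "fs.subspace A"
    proof (rule fs.subspaceI)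
      have "\<iota> 0 = 0" using \<iota>_smul[of 0 0] by simp
      then show "0 \<in> A" unfolding A_def using fs.subspace_0[OF S] by (metis imageI)
      show "f + g \<in> A" if fg: "f \<in> A" "g \<in> A" for f g
      proof -
        obtain f' g' where *: "f' \<in> vec_fun ` U" "g' \<in> vec_fun ` U" "f = \<iota> f'" "g = \<iota> g'"
          using fg unfolding A_def by blast
        then show ?thesis using fs.subspace_add[OF S *(1,2)] by (simp add: A_def \<iota>_add[symmetric])
      qed
      show "smul c f \<in> A" if f: "f \<in> A" for c f
      proof -
        obtain f' where *: "f' \<in> vec_fun ` U" "f = \<iota> f'" using f unfolding A_def by blast
        then show ?thesis using fs.subspace_scale[OF S *(1)] by (simp add: A_def \<iota>_smul[symmetric])
      qed
    qed
    moreover have "A \<subseteq> W" using \<iota>_W by (auto simp: A_def)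
    moreover have "tact x a \<in> A" if x: "x \<in> G" and a: "a \<in> A" for x a
    proof -
      obtain w where w: "w \<in> U" "a = \<iota> (vec_fun w)" using a unfolding A_def by blast
      have wc: "w \<in> carrier_vec d" using w(1) u(1) by blast
      have "tact x a = \<iota> (vec_fun (\<rho> x *\<^sub>v w))" unfolding vec_fun_mult[OF wc \<rho>c] w(2) key[OF x] ..
      then show ?thesis using U x w(1) unfolding A_def by blast
    qed
    ultimately have "A = {0} \<or> A = W" by (rule W_irreducible)
    then show "U = {0\<^sub>v d} \<or> U = carrier_vec d"
    proof
      assume A: "A = {0}"
      have "w = 0\<^sub>v d" if w: "w \<in> U" for w
      proof -
        have wc: "w \<in> carrier_vec d" using w u(1) by blast
        have "\<iota> (vec_fun w) \<in> A" using w by (simp add: A_def)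
        then have "vec_fun w = 0" using A by (intro \<iota>_0 vec_fun_coords wc) simp
        then show ?thesis using vec_fun_inj[OF wc, of "0\<^sub>v d"] by (simp add: vec_fun_zero)
      qed
      then show ?thesis using u(2) by blast
    next
      assume A: "A = W"
      have "w \<in> U" if wc: "w \<in> carrier_vec d" for w
      proof -
        have "\<iota> (vec_fun w) \<in> A" using A \<iota>_W by simp
        then obtain w' where w': "w' \<in> U" "\<iota> (vec_fun w) = \<iota> (vec_fun w')" unfolding A_def by blast
        have wc': "w' \<in> carrier_vec d" using w' u(1) by blast
        have "vec_fun w = vec_fun w'" by (rule \<iota>_inj[OF vec_fun_coords[OF wc] vec_fun_coords[OF wc'] w'(2)])
        then show ?thesis using vec_fun_inj[OF wc wc'] w'(1) by simp
      qed
      then show ?thesis using u(1) by blast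
    qed
  qed
  let ?u = "vec d (\<kappa> v0)"
  have uc: "?u \<in> carrier_vec d" by simp
  have vu: "vec_fun ?u = \<kappa> v0" by (rule vec_fun_vec[OF \<kappa>(1)[OF v0W]])
  have act_u: "\<iota> (vec_fun (\<rho> x *\<^sub>v ?u)) = tact x v0" if "x \<in> G" for x
    unfolding vec_fun_mult[OF uc \<rho>c] vu key[OF that] \<kappa>(2)[OF v0W] ..
  have "has_highest_weight X r (d, \<rho>) \<mu>"
    unfolding has_highest_weight_def prod.case
  proof (intro bexI conjI ballI)
    show "?u \<in> weight_space X r (d, \<rho>) \<mu>"
      unfolding weight_space_def prod.case
    proof (intro CollectI conjI allI)
      fix t
      have c: "\<rho> (cartan_elt X r t) *\<^sub>v ?u \<in> carrier_vec d"
        by (rule mult_mat_vec_carrier[OF \<rho>c uc])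
      have c': "weight_eval r \<mu> t \<cdot>\<^sub>v ?u \<in> carrier_vec d" by simp
      have "\<iota> (vec_fun (\<rho> (cartan_elt X r t) *\<^sub>v ?u)) = \<iota> (vec_fun (weight_eval r \<mu> t \<cdot>\<^sub>v ?u))"
        unfolding act_u[OF cartan_in_lie_alg] v0_weight vec_fun_smult vu \<iota>_smul \<kappa>(2)[OF v0W] ..
      then have "vec_fun (\<rho> (cartan_elt X r t) *\<^sub>v ?u) = vec_fun (weight_eval r \<mu> t \<cdot>\<^sub>v ?u)"
        by (rule \<iota>_inj[OF vec_fun_coords[OF c] vec_fun_coords[OF c']])
      then show "\<rho> (cartan_elt X r t) *\<^sub>v ?u = weight_eval r \<mu> t \<cdot>\<^sub>v ?u" using vec_fun_inj[OF c c'] by simp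
    qed simp
    show "?u \<noteq> 0\<^sub>v d"
    proof
      assume "?u = 0\<^sub>v d"
      then have "\<kappa> v0 = 0" using vu vec_fun_zero by metis
      then have "v0 = \<iota> 0" using \<kappa>(2)[OF v0W] by simp
      also have "\<iota> 0 = 0" using \<iota>_smul[of 0 0] by simp
      finally show False using col_tensor_neq_zero by simp
    qed
    fix \<beta> x assume \<beta>: "\<beta> \<in> positive_roots X r" and x: "x \<in> root_space X r \<beta>"
    have xG: "x \<in> G" using x by (simp add: root_space_def)
    have "tact x v0 = 0" by (rule v0_killed[OF L.carrier[OF xG] positive_root_space_entry[OF \<beta> x]])
    then have "\<iota> (vec_fun (\<rho> x *\<^sub>v ?u)) = 0" by (simp add: act_u[OF xG])
    then have "vec_fun (\<rho> x *\<^sub>v ?u) = 0"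
      by (rule \<iota>_0[OF vec_fun_coords[OF mult_mat_vec_carrier[OF \<rho>c uc]]])
    then show "\<rho> x *\<^sub>v ?u = 0\<^sub>v d"
      using vec_fun_inj[OF mult_mat_vec_carrier[OF \<rho>c uc], of "0\<^sub>v d"] by (simp add: vec_fun_zero)
  qed
  then show ?thesis using irr by blast
qed

lemma weight_space_subspace:
  assumes V: "is_rep (lie_alg X r) (d, \<rho>)"
  shows "subspace class_ring (weight_space X r (d, \<rho>) \<omega>) (module_vec TYPE(complex) d)"
proof (rule vec_subspaceI)
  have c: "\<rho> (cartan_elt X r t) \<in> carrier_mat d d" for t
    using V cartan_in_lie_alg by (simp add: is_rep_def)
  show "weight_space X r (d, \<rho>) \<omega> \<subseteq> carrier_vec d" by (auto simp: weight_space_def)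
  show "0\<^sub>v d \<in> weight_space X r (d, \<rho>) \<omega>"
  proof -
    have "\<rho> (cartan_elt X r t) *\<^sub>v 0\<^sub>v d = weight_eval r \<omega> t \<cdot>\<^sub>v 0\<^sub>v d" for t
      by (rule eq_vecI) (use c[of t] in \<open>simp_all add: scalar_prod_def\<close>)
    then show ?thesis by (simp add: weight_space_def)
  qed
  show "v + w \<in> weight_space X r (d, \<rho>) \<omega>"
    if "v \<in> weight_space X r (d, \<rho>) \<omega>" "w \<in> weight_space X r (d, \<rho>) \<omega>" for v w
    using that
    by (auto simp: weight_space_def mult_add_distrib_mat_vec[OF c] smult_add_distrib_vec[of v d w])
  show "k \<cdot>\<^sub>v v \<in> weight_space X r (d, \<rho>) \<omega>" if "v \<in> weight_space X r (d, \<rho>) \<omega>" for k v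
    using that by (simp add: weight_space_def mult_mat_vec[OF c] smult_smult_assoc mult.commute)
qed

text \<open>
  Whatever irreducible module is chosen, its weight spaces correspond to those of \<open>W\<close>.
\<close>

lemma (in hw_tensor) irrep_multiplicities:
  assumes lam: "partition_weight r lam = \<mu>"
  shows "K_mult X r lam \<omega> = fs.dim (W \<inter> wspace X r n \<omega>)"
    and "\<omega> \<in> weights X r lam \<longleftrightarrow> \<omega> \<in> weight_space_E r \<and> W \<inter> wspace X r n \<omega> \<noteq> {0}"
proof -
  obtain d \<rho> where V: "irrep X r lam = (d, \<rho>)" by (cases "irrep X r lam")
  have "irreducible_rep G (irrep X r lam) \<and> has_highest_weight X r (irrep X r lam) \<mu>"
    unfolding irrep_def lam by (rule someI_ex[OF irrep_exists])
  then have irr: "irreducible_rep G (d, \<rho>)" and hw: "has_highest_weight X r (d, \<rho>) \<mu>" by (simp_all add: V)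
  obtain v where v: "v \<in> coords d" "v \<noteq> 0"
    "\<And>t. mat_act d (\<rho> (cartan_elt X r t)) v = smul (weight_eval r \<mu> t) v"
    "\<And>x k. x \<in> G \<Longrightarrow> homog (letter_ht r) k x \<Longrightarrow> k > 0 \<Longrightarrow> mat_act d (\<rho> x) v = 0"
    using highest_vector[OF irr hw] by blast
  interpret hw_pair X r ks d \<rho> v by unfold_locales (use irr v in auto)
  show "K_mult X r lam \<omega> = fs.dim (W \<inter> wspace X r n \<omega>)"
    using vectorspace_dim_eq[OF weight_space_subspace[OF rep]] weight_space_dim
    by (simp add: K_mult_def weight_mult_def V)
  show "\<omega> \<in> weights X r lam \<longleftrightarrow> \<omega> \<in> weight_space_E r \<and> W \<inter> wspace X r n \<omega> \<noteq> {0}"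
    unfolding weights_def V using weight_space_trivial by simp
qed

section \<open>Branching to general linear subalgebras\<close>

text \<open>
  The first \<open>r\<close> letters have the largest degree. Hence elements of negative degree map every tensor to
  one that vanishes on words in these letters, elements of positive degree kill tensors in these
  letters, and those of degree \<open>0\<close> act on them as \<open>gl(r)\<close>. So the part of the cyclic module that
  involves only the first \<open>r\<close> letters is the cyclic module for \<open>gl(r)\<close>, by \<open>triangular\<close>.
\<close>

lemma top_component:
  assumes G: "graded_lie N G \<delta>" and r: "r \<le> N"
    and top: "\<And>i. i < r \<Longrightarrow> \<delta> i = (1::int)" and low: "\<And>i. r \<le> i \<Longrightarrow> i < N \<Longrightarrow> \<delta> i < 1"
    and surj: "\<And>B. B \<in> carrier_mat r r \<Longrightarrow> \<exists>x\<in>G. homog \<delta> 0 x \<and> corner r x = B"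
    and v: "v \<in> tensors r n"
  shows "cyc tact G v \<inter> tensors r n = cyc tact (carrier_mat r r) v"
proof -
  interpret graded_lie N G \<delta> by (rule G)
  interpret M: lie_module N G tact by (rule tensor_module)
  interpret graded_module N G tact \<delta> ..
  let ?A = "cyc tact (carrier_mat r r) v"
  have At: "a \<in> tensors r n" if "a \<in> ?A" for a using cyc_tensors[OF subset_refl v] that by blast
  have block: "tact x a = tact (corner r x) a"
    if x: "x \<in> G" "homog \<delta> k x" "k \<ge> 0" and a: "a \<in> tensors r n" for x k a
  proof (rule tact_corner[OF a r carrier[OF x(1)]])
    fix i j assume "r \<le> i" "i < N" "j < r"
    then have "\<delta> i - \<delta> j \<noteq> k" using top[of j] low[of i] x(3) by simp
    then show "x $$ (i,j) = 0"
      using x(2) carrier[OF x(1)] \<open>i < N\<close> less_le_trans[OF \<open>j < r\<close> r] by (auto simp: homog_def)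
  qed
  define L where "L = {f. \<forall>w\<in>words r n. f w = (0::complex)}"
  have dec: "f \<in> ?A" if f: "f \<in> cyc tact G v" "f \<in> tensors r n" for f
  proof -
    obtain a l where al: "a \<in> ?A" "l \<in> L" "f = a + l"
    proof (rule triangular[of ?A L v f])
      show "fs.subspace ?A" by (rule cyc_subspace)
      show "fs.subspace L" by (rule fs.subspaceI) (auto simp: L_def fun_simps)
      show "v \<in> ?A" by (rule cyc.cyc_base)
      show "f \<in> cyc tact G v" by (rule f(1))
    next
      fix x a assume x: "x \<in> G" "homog \<delta> 0 x" and a: "a \<in> ?A"
      have "tact (corner r x) a \<in> ?A" by (rule cyc.cyc_act[OF _ a]) (simp add: corner_def)
      then show "tact x a \<in> ?A" using block[OF x _ At[OF a]] by simp
    next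
      fix x k a assume x: "x \<in> G" "homog \<delta> k x" "0 < k" and a: "a \<in> ?A"
      have "corner r x = 0\<^sub>m r r"
      proof (rule eq_matI)
        fix i j assume "i < dim_row (0\<^sub>m r r :: complex mat)" "j < dim_col (0\<^sub>m r r :: complex mat)"
        then have ij: "i < r" "j < r" by auto
        then have "\<delta> i - \<delta> j \<noteq> k" using top x(3) by simp
        then have "x $$ (i,j) = 0" using x(2) carrier[OF x(1)] less_le_trans[OF ij(1) r]
            less_le_trans[OF ij(2) r] by (auto simp: homog_def)
        then show "corner r x $$ (i,j) = 0\<^sub>m r r $$ (i,j)" using ij by (simp add: corner_def)
      qed (simp_all add: corner_def)
      moreover have "tact (0\<^sub>m r r) a = 0"
      proof
        fix w
        have "ent (0\<^sub>m r r) i j = 0" for i j by (simp add: ent_def)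
        then show "tact (0\<^sub>m r r) a w = 0 w"
          unfolding tact_positions by (simp add: zero_fun_apply)
      qed
      ultimately show "tact x a = 0" using block[OF x(1,2) _ At[OF a]] x(3) by simp
    next
      fix x k and a l :: "nat list \<Rightarrow> complex" assume x: "x \<in> G" "homog \<delta> k x" "k < 0"
      have "tact x (a + l) w = 0" if w: "w \<in> words r n" for w
      proof -
        have "ent x (w ! p) j = 0" if p: "p < length w" "j < N" for p j
        proof -
          have "w ! p \<in> set w" by (rule nth_mem[OF p(1)])
          then have wp: "w ! p < r" using w unfolding words_def by blast
          have "\<delta> j \<le> 1" using top[of j] low[of j] p(2) by (cases "j < r") auto
          then have "\<delta> (w ! p) - \<delta> j \<noteq> k" using top[OF wp] x(3) by simp
          then show ?thesis using x(2) carrier[OF x(1)] less_le_trans[OF wp r] p(2)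
            by (auto simp: ent_def homog_def)
        qed
        then show ?thesis using carrier[OF x(1)] unfolding tact_positions by simp
      qed
      then show "tact x (a + l) \<in> L" by (simp add: L_def)
    qed
    have "l w = 0" for w
    proof (cases "w \<in> words r n")
      case True
      then show ?thesis using al(2) by (simp add: L_def)
    next
      case False
      then have "f w = 0" "a w = 0" using f(2) At[OF al(1)] by (auto simp: tensors_def)
      then show ?thesis using al(3) by (simp add: plus_fun_apply)
    qed
    then have "l = 0" by (simp add: fun_simps)
    then show ?thesis using al by simp
  qed
  have "f \<in> cyc tact G v" if "f \<in> ?A" for f
    using that
  proof induction
    case (cyc_act B f)
    obtain x where x: "x \<in> G" "homog \<delta> 0 x" "corner r x = B" using surj[OF cyc_act(1)] by blast
    have "tact x f = tact B f" using block[OF x(1,2) _ At[OF cyc_act(2)]] x(3) by simp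
    then show ?case using cyc.cyc_act[OF x(1) cyc_act(3)] by simp
  qed (auto intro: cyc.intros)
  then show ?thesis using dec At by blast
qed

definition coord_sum :: "nat \<Rightarrow> weight \<Rightarrow> real" where
  "coord_sum r \<omega> = (\<Sum>j = 1..r. \<omega> j)"

lemma coord_sum_letter_wt: "coord_sum r (letter_wt r i) = (if i < r then 1 else if i < 2 * r then -1 else 0)"
proof -
  have e: "coord_sum r (eps k) = 1" if "k \<in> {1..r}" for k
    using that by (simp add: coord_sum_def eps_def)
  have m: "coord_sum r (- \<omega>) = - coord_sum r \<omega>" for \<omega> by (simp add: coord_sum_def sum_negf)
  show ?thesis by (auto simp: letter_wt_def e m) (simp add: coord_sum_def zero_fun_apply)
qed

lemma coord_sum_word_wt: "coord_sum r (word_wt r w) = (\<Sum>a\<leftarrow>w. coord_sum r (letter_wt r a))"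
proof (induction w)
  case (Cons a w)
  have "coord_sum r (word_wt r (a # w)) = coord_sum r (letter_wt r a) + coord_sum r (word_wt r w)"
    by (simp add: coord_sum_def word_wt_def sum.distrib)
  then show ?case using Cons by simp
qed (simp add: coord_sum_def word_wt_def)

lemma coord_sum_words: "w \<in> words r n \<Longrightarrow> coord_sum r (word_wt r w) = real n"
proof -
  assume w: "w \<in> words r n"
  then have "(\<Sum>a\<leftarrow>w. coord_sum r (letter_wt r a)) = (\<Sum>a\<leftarrow>w. 1)"
    by (intro arg_cong[of _ _ sum_list] map_cong) (auto simp: words_def coord_sum_letter_wt)
  then show ?thesis using w by (simp add: coord_sum_word_wt words_def sum_list_triv)
qed

text \<open>
  Only the first \<open>r\<close> letters have coordinate sum \<open>1\<close>; the others have coordinate sum \<open>-1\<close> or \<open>0\<close>.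
\<close>

lemma coord_sum_max:
  "coord_sum r (word_wt r w) \<le> real (length w)"
  "coord_sum r (word_wt r w) = real (length w) \<Longrightarrow> set w \<subseteq> {..<r}"
proof -
  show le: "coord_sum r (word_wt r w) \<le> real (length w)" for w
    unfolding coord_sum_word_wt by (induction w) (auto simp: coord_sum_letter_wt)
  show "set w \<subseteq> {..<r}" if "coord_sum r (word_wt r w) = real (length w)"
    using that
  proof (induction w)
    case (Cons a w)
    have "coord_sum r (word_wt r (a # w)) = coord_sum r (letter_wt r a) + coord_sum r (word_wt r w)" by (simp add: coord_sum_word_wt)
    then have "coord_sum r (letter_wt r a) = 1 \<and> coord_sum r (word_wt r w) = real (length w)"
      using Cons.prems le[of w] by (auto simp: coord_sum_letter_wt split: if_splits)
    then show ?case using Cons.IH by (auto simp: coord_sum_letter_wt split: if_splits)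
  qed simp
qed

lemma word_wt_low: "w \<in> words N n \<Longrightarrow> w' \<in> words r n \<Longrightarrow> word_wt r w = word_wt r w' \<Longrightarrow> w \<in> words r n"
  using coord_sum_words[of w' r n] coord_sum_max(2)[of r w] by (auto simp: words_def)

lemma word_wt_Suc:
  assumes "w \<in> words r n" shows "word_wt (Suc r) w = word_wt r w"
proof -
  have "letter_wt (Suc r) a = letter_wt r a" if "a \<in> set w" for a using that assms by (auto simp: words_def letter_wt_def)
  then show ?thesis unfolding word_wt_def by (auto intro!: arg_cong[of _ _ sum_list] map_cong)
qed

lemma word_wt_low_Suc:
  assumes w: "w \<in> words (Suc r) n" and w': "w' \<in> words r n" and e: "word_wt (Suc r) w = word_wt r w'"
  shows "w \<in> words r n"
proof -
  have c: "word_wt (Suc r) u (Suc r) = real (count_list u r)" if "set u \<subseteq> {..<Suc r}" for u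
    using that by (induction u) (auto simp: word_wt_def letter_wt_def eps_def)
  have "word_wt (Suc r) w (Suc r) = 0"
    unfolding e using word_wt_E[of r w'] by (simp add: weight_space_E_def)
  then have "count_list w r = 0" using c[of w] w by (simp add: words_def)
  then have "r \<notin> set w" by (simp add: count_list_0_iff)
  then show ?thesis using w by (auto simp: words_def less_Suc_eq)
qed

text \<open>
  The multiplicity of a weight in the concrete module.
\<close>

definition wt_dim :: "lie_type \<Rightarrow> nat \<Rightarrow> nat list \<Rightarrow> weight \<Rightarrow> nat" where
  "wt_dim X r ks \<omega> = fs.dim (cyc tact (lie_alg X r) (col_tensor ks) \<inter> wspace X r (sum_list ks) \<omega>)"

lemma wt_dim_type_A:
  assumes ks: "\<forall>k\<in>set ks. k \<le> r" and X: "X \<noteq> Type_A" and w: "w \<in> words r (sum_list ks)"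
  shows "wt_dim X r ks (word_wt r w) = wt_dim Type_A r ks (word_wt r w)"
proof -
  let ?n = "sum_list ks" and ?N = "lie_size X r" and ?\<omega> = "word_wt r w"
  have rN: "r \<le> ?N" by (rule lie_size_bounds)
  have top: "cyc tact (lie_alg X r) (col_tensor ks) \<inter> tensors r ?n = cyc tact (carrier_mat r r) (col_tensor ks)"
  proof (rule top_component[of ?N _ "levi_deg r"])
    show "graded_lie ?N (lie_alg X r) (levi_deg r)" by (rule lie_alg_graded) (rule dual_idx_grading)
    show "\<exists>x\<in>lie_alg X r. homog (levi_deg r) 0 x \<and> corner r x = B" if "B \<in> carrier_mat r r" for B
      using levi_deg_corner[OF X that] by blast
    show "col_tensor ks \<in> tensors r ?n" by (rule col_tensor_tensors[OF ks]) simp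
  qed (use rN in \<open>auto simp: levi_deg_def\<close>)
  have ws: "f \<in> wspace X r ?n ?\<omega> \<longleftrightarrow> f \<in> wspace Type_A r ?n ?\<omega>" for f
  proof -
    have "words r ?n \<subseteq> words ?N ?n" using rN by (auto simp: words_def)
    then show ?thesis unfolding wspace_iff[OF word_wt_E] lie_alg_A
      using word_wt_low[OF _ w] by (auto simp: tensors_def)
  qed
  have wt: "f \<in> tensors r ?n" if "f \<in> wspace Type_A r ?n ?\<omega>" for f
    using that by (simp add: wspace_def lie_alg_A)
  have "cyc tact (lie_alg X r) (col_tensor ks) \<inter> wspace X r ?n ?\<omega> =
      cyc tact (lie_alg Type_A r) (col_tensor ks) \<inter> wspace Type_A r ?n ?\<omega>"
    unfolding lie_alg_A(1) top[symmetric] using ws wt by blast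
  then show ?thesis by (simp add: wt_dim_def)
qed

lemma wt_dim_Suc:
  assumes ks: "\<forall>k\<in>set ks. k \<le> r" and w: "w \<in> words r (sum_list ks)"
  shows "wt_dim Type_A (Suc r) ks (word_wt r w) = wt_dim Type_A r ks (word_wt r w)"
proof -
  let ?n = "sum_list ks" and ?\<omega> = "word_wt r w" and ?\<delta> = "\<lambda>i. if i < r then 1 else 0 :: int"
  have top: "cyc tact (lie_alg Type_A (Suc r)) (col_tensor ks) \<inter> tensors r ?n = cyc tact (carrier_mat r r) (col_tensor ks)"
  proof (rule top_component[of "Suc r" _ ?\<delta>])
    show "graded_lie (Suc r) (lie_alg Type_A (Suc r)) ?\<delta>"
      using lie_alg_graded[of Type_A "Suc r" ?\<delta>] by (simp add: lie_alg_A)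
    show "\<exists>x\<in>lie_alg Type_A (Suc r). homog ?\<delta> 0 x \<and> corner r x = B" if B: "B \<in> carrier_mat r r" for B
    proof
      let ?x = "mat (Suc r) (Suc r) (\<lambda>(i,j). if i < r \<and> j < r then B $$ (i,j) else 0)"
      show "?x \<in> lie_alg Type_A (Suc r)" by (simp add: lie_alg_A)
      show "homog ?\<delta> 0 ?x \<and> corner r ?x = B"
        using B by (auto simp: homog_def corner_def)
    qed
    show "col_tensor ks \<in> tensors r ?n" by (rule col_tensor_tensors[OF ks]) simp
  qed auto
  have E: "?\<omega> \<in> weight_space_E (Suc r)" using word_wt_E[of r w] by (auto simp: weight_space_E_def)
  have ws: "f \<in> wspace Type_A (Suc r) ?n ?\<omega> \<longleftrightarrow> f \<in> wspace Type_A r ?n ?\<omega>" for f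
  proof -
    have sub: "words r ?n \<subseteq> words (Suc r) ?n" by (auto simp: words_def)
    have "u \<in> words (Suc r) ?n \<and> word_wt (Suc r) u = ?\<omega> \<longleftrightarrow> u \<in> words r ?n \<and> word_wt r u = ?\<omega>" for u
      using word_wt_low_Suc[of u r ?n w] w word_wt_Suc[of u r ?n] sub by auto
    then show ?thesis unfolding wspace_iff[OF E] wspace_iff[OF word_wt_E] lie_alg_A tensors_def
      by (simp only: mem_Collect_eq) blast
  qed
  have wt: "f \<in> tensors r ?n" if "f \<in> wspace Type_A r ?n ?\<omega>" for f
    using that by (simp add: wspace_def lie_alg_A)
  have "cyc tact (lie_alg Type_A (Suc r)) (col_tensor ks) \<inter> wspace Type_A (Suc r) ?n ?\<omega> =
      cyc tact (lie_alg Type_A r) (col_tensor ks) \<inter> wspace Type_A r ?n ?\<omega>"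
    unfolding lie_alg_A(1)[of r] top[symmetric] using ws wt by blast
  then show ?thesis by (simp add: wt_dim_def)
qed

text \<open>
  A tensor in a weight space is supported on the words of that weight.
\<close>

lemma wt_dim_le:
  assumes "\<omega> \<in> weight_space_E r"
  shows "wt_dim X r ks \<omega> \<le> card {w \<in> words (lie_size X r) (sum_list ks). word_wt r w = \<omega>}"
  unfolding wt_dim_def
proof (rule dim_support_le)
  fix f w assume "f \<in> cyc tact (lie_alg X r) (col_tensor ks) \<inter> wspace X r (sum_list ks) \<omega>" "f w \<noteq> 0"
  then show "w \<in> {w \<in> words (lie_size X r) (sum_list ks). word_wt r w = \<omega>}"
    using wspace_iff[OF assms] by (auto simp: tensors_def)
qed simp

definition columns :: "(nat \<Rightarrow> nat) \<Rightarrow> nat list" where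
  "columns lam = map (\<lambda>j. card {i. 1 \<le> i \<and> j \<le> lam i}) [1..<lam 1 + 1]"

lemma partition_decreasing: "is_partition lam \<Longrightarrow> 1 \<le> i \<Longrightarrow> i \<le> j \<Longrightarrow> lam j \<le> lam i"
proof (induction "j - i" arbitrary: j)
  case (Suc d)
  then obtain j' where j: "j = Suc j'" "i \<le> j'" by (cases j) auto
  then have "lam j' \<le> lam i" using Suc by auto
  moreover have "lam j \<le> lam j'" using Suc.prems j by (auto simp: is_partition_def)
  ultimately show ?case by simp
qed simp

text \<open>
  The columns of a Young diagram form the conjugate partition, and conjugation is an involution.
\<close>

lemma columns_count:
  assumes lam: "is_partition lam" and i: "1 \<le> i"
  shows "length (filter (\<lambda>k. i \<le> k) (columns lam)) = lam i"
proof -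
  have iff: "i \<le> card {k. 1 \<le> k \<and> j \<le> lam k} \<longleftrightarrow> j \<le> lam i" if j: "1 \<le> j" for j
  proof
    have "{k. 1 \<le> k \<and> j \<le> lam k} \<subseteq> {k. 1 \<le> k \<and> lam k \<noteq> 0}" using j by auto
    then have fin: "finite {k. 1 \<le> k \<and> j \<le> lam k}"
      using lam by (auto simp: is_partition_def intro: finite_subset)
    {
      assume "j \<le> lam i"
      then have "{1..i} \<subseteq> {k. 1 \<le> k \<and> j \<le> lam k}"
        using partition_decreasing[OF lam] by (auto intro: order_trans)
      from card_mono[OF fin this] show "i \<le> card {k. 1 \<le> k \<and> j \<le> lam k}" by simp
    }
    assume c: "i \<le> card {k. 1 \<le> k \<and> j \<le> lam k}"
    show "j \<le> lam i"
    proof (rule ccontr)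
      assume n: "\<not> j \<le> lam i"
      have "{k. 1 \<le> k \<and> j \<le> lam k} \<subseteq> {1..<i}"
      proof
        fix k assume k: "k \<in> {k. 1 \<le> k \<and> j \<le> lam k}"
        have "k < i"
        proof (rule ccontr)
          assume "\<not> k < i"
          then show False using partition_decreasing[OF lam i, of k] k n by auto
        qed
        then show "k \<in> {1..<i}" using k by simp
      qed
      from card_mono[OF _ this] show False using c i by simp
    qed
  qed
  have "length (filter (\<lambda>k. i \<le> k) (columns lam)) = length (filter (\<lambda>j. j \<le> lam i) [1..<lam 1 + 1])"
    unfolding columns_def filter_map length_map o_def
  proof (rule arg_cong[of _ _ length], rule filter_cong[OF refl])
    fix j assume "j \<in> set [1..<lam 1 + 1]"
    then have "1 \<le> j" by auto
    then show "i \<le> card {k. 1 \<le> k \<and> j \<le> lam k} \<longleftrightarrow> j \<le> lam i" by (rule iff)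
  qed
  also have "\<dots> = card (set (filter (\<lambda>j. j \<le> lam i) [1..<lam 1 + 1]))"
    by (rule distinct_card[symmetric]) simp
  also have "set (filter (\<lambda>j. j \<le> lam i) [1..<lam 1 + 1]) = {1..lam i}"
    using partition_decreasing[OF lam _ i] by auto
  finally show ?thesis by simp
qed

lemma partition_weight_columns:
  assumes lam: "is_partition lam" and r: "\<forall>k\<in>set (columns lam). k \<le> r"
  shows "partition_weight r lam = cols_wt (columns lam)"
proof -
  interpret hw_tensor X r "columns lam" for X using r by unfold_locales
  have "cols_wt (columns lam) j = 0" if "j \<notin> {1..r}" for j using \<mu>_E that by (simp add: weight_space_E_def)
  then show ?thesis
    using columns_count[OF lam] by (auto simp: partition_weight_def fun_eq_iff) (simp add: cols_wt_def)
qed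

section \<open>The contribution of a weight\<close>

definition theta_exp :: "lie_type \<Rightarrow> nat \<Rightarrow> nat \<Rightarrow> weight \<Rightarrow> real" where
  "theta_exp X r i \<mu> = inner_E r \<mu> (fund_coweight X r i)"

lemma theta_exp_add: "theta_exp X r i (\<mu> + \<nu>) = theta_exp X r i \<mu> + theta_exp X r i \<nu>"
  by (simp add: theta_exp_def inner_E_def plus_fun_apply distrib_right sum.distrib)

lemma sum_eps: "(\<Sum>k = 1..i. eps k j) = (if 1 \<le> j \<and> j \<le> i then 1 else 0)"
  by (simp add: eps_def)

lemma inner_eps: "inner_E r \<mu> (\<lambda>j. \<Sum>k = 1..i. eps k j) = coord_sum i \<mu>" if "i \<le> r"
proof -
  have "inner_E r \<mu> (\<lambda>j. \<Sum>k = 1..i. eps k j) = (\<Sum>j\<in>{1..r}. if j \<in> {1..i} then \<mu> j else 0)"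
    unfolding inner_E_def sum_eps by (intro sum.cong) auto
  also have "\<dots> = (\<Sum>j\<in>{1..r} \<inter> {1..i}. \<mu> j)" by (rule sum.inter_restrict[symmetric]) simp
  also have "{1..r} \<inter> {1..i} = {1..i}" using that by auto
  finally show ?thesis by (simp add: coord_sum_def)
qed

lemma inner_scale: "inner_E r \<mu> (\<lambda>j. c * \<nu> j) = c * inner_E r \<mu> \<nu>"
  by (simp add: inner_E_def sum_distrib_left mult.left_commute)

lemma inner_half: "inner_E r \<mu> (\<lambda>j. \<nu> j / 2) = inner_E r \<mu> \<nu> / 2"
  by (simp add: inner_E_def sum_divide_distrib)

lemma inner_sub: "inner_E r \<mu> (\<lambda>j. \<nu> j - \<nu>' j) = inner_E r \<mu> \<nu> - inner_E r \<mu> \<nu>'"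
  by (simp add: inner_E_def right_diff_distrib sum_subtractf)

lemma inner_plus: "inner_E r \<mu> (\<lambda>j. \<nu> j + \<nu>' j) = inner_E r \<mu> \<nu> + inner_E r \<mu> \<nu>'"
  by (simp add: inner_E_def distrib_left sum.distrib)

lemma inner_single: "k \<in> {1..r} \<Longrightarrow> inner_E r \<mu> (eps k) = \<mu> k"
  by (simp add: inner_E_def eps_def if_distrib[of "(*) _"] cong: if_cong)

lemma norm_simple_root:
  assumes "1 \<le> i" "i < r"
  shows "inner_E r (simple_root X r i) (simple_root X r i) = 2"
proof -
  have "simple_root X r i = (\<lambda>j. eps i j - eps (i + 1) j)" using assms by (simp add: simple_root_def)
  then show ?thesis using assms by (simp add: inner_sub inner_single) (simp add: eps_def)
qed

lemma norm_last_root: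
  assumes "2 \<le> r"
  shows "inner_E r (simple_root Type_B r r) (simple_root Type_B r r) = 1"
    "inner_E r (simple_root Type_C r r) (simple_root Type_C r r) = 4"
    "inner_E r (simple_root Type_D r r) (simple_root Type_D r r) = 2"
  using assms by (auto simp: simple_root_def inner_scale inner_plus inner_single) (auto simp: eps_def)

lemma theta_exp_inner:
  assumes "1 \<le> i" "i < r" "X = Type_D \<Longrightarrow> i \<noteq> r - 1"
  shows "theta_exp X r i \<mu> = coord_sum i \<mu>"
  using assms unfolding theta_exp_def fund_coweight_def norm_simple_root[OF assms(1,2)] inner_scale
  by (auto simp: fund_weight_def inner_eps simp del: One_nat_def)

lemma theta_exp_last:
  assumes "2 \<le> r"
  shows "theta_exp Type_B r r \<mu> = coord_sum r \<mu>" "theta_exp Type_C r r \<mu> = coord_sum r \<mu> / 2"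
    "theta_exp Type_D r r \<mu> = coord_sum r \<mu> / 2" "theta_exp Type_D r (r - 1) \<mu> = (coord_sum (r - 1) \<mu> - \<mu> r) / 2"
proof -
  note n = norm_last_root[OF assms]
  show "theta_exp Type_B r r \<mu> = coord_sum r \<mu>" "theta_exp Type_C r r \<mu> = coord_sum r \<mu> / 2"
    "theta_exp Type_D r r \<mu> = coord_sum r \<mu> / 2"
    unfolding theta_exp_def fund_coweight_def n inner_scale
    by (simp_all add: fund_weight_def inner_half inner_eps del: One_nat_def)
  have m: "inner_E r (simple_root Type_D r (r - 1)) (simple_root Type_D r (r - 1)) = 2"
    using assms by (intro norm_simple_root) auto
  show "theta_exp Type_D r (r - 1) \<mu> = (coord_sum (r - 1) \<mu> - \<mu> r) / 2"
    unfolding theta_exp_def fund_coweight_def m inner_scale using assms less_imp_neq[of "r - 1" r]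
    by (simp add: fund_weight_def inner_sub inner_half inner_eps inner_single diff_divide_distrib
        del: One_nat_def)
qed

lemma coord_sum_split: "1 \<le> r \<Longrightarrow> coord_sum r \<mu> = coord_sum (r - 1) \<mu> + \<mu> r"
  by (cases r) (simp_all add: coord_sum_def)

definition theta_pow :: "lie_type \<Rightarrow> nat \<Rightarrow> (nat \<Rightarrow> real) \<Rightarrow> weight \<Rightarrow> real" where
  "theta_pow X r \<theta> \<mu> = (\<Prod>i\<in>index_set X r. \<theta> i powr theta_exp X r i \<mu>)"

text \<open>
  If \<open>\<mu>\<close> has coordinate sum \<open>0\<close>, its coefficients on the simple roots are the partial sums of its
  coordinates, in all four types. This is why weights of coordinate sum \<open>n\<close> contribute the same in
  all types.
\<close>

lemma theta_pow_balanced: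
  assumes \<theta>: "\<And>i. i \<ge> 1 \<Longrightarrow> \<theta> i > 0" and r: "2 \<le> r" and 0: "coord_sum r \<mu> = 0"
  shows "theta_pow X r \<theta> \<mu> = (\<Prod>i = 1..<r. \<theta> i powr coord_sum i \<mu>)"
proof -
  have e: "theta_exp X r i \<mu> = coord_sum i \<mu>" if "i \<in> {1..<r}" for i
  proof (cases "X = Type_D \<and> i = r - 1")
    case True
    have "coord_sum (r - 1) \<mu> + \<mu> r = 0" using coord_sum_split[of r \<mu>] r 0 by simp
    then have "(coord_sum (r - 1) \<mu> - \<mu> r) / 2 = coord_sum (r - 1) \<mu>" by (simp add: field_simps)
    then show ?thesis using True theta_exp_last(4)[OF r, of \<mu>] by simp
  qed (use that in \<open>auto intro: theta_exp_inner\<close>)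
  show ?thesis
  proof (cases "X = Type_A")
    case True
    then have "index_set X r = {1..<r}" by (simp add: index_set_def)
    then show ?thesis unfolding theta_pow_def by (intro prod.cong) (simp_all only: e)
  next
    case False
    have "theta_exp X r r \<mu> = 0" using theta_exp_last(1-3)[OF r, of \<mu>] 0 False by (cases X) auto
    then have last: "\<theta> r powr theta_exp X r r \<mu> = 1" using \<theta>[of r] r by simp
    have "index_set X r = insert r {1..<r}" using False r by (auto simp: index_set_def)
    then have "theta_pow X r \<theta> \<mu> = (\<Prod>i = 1..<r. \<theta> i powr theta_exp X r i \<mu>)"
      unfolding theta_pow_def by (simp add: last)
    also have "\<dots> = (\<Prod>i = 1..<r. \<theta> i powr coord_sum i \<mu>)"
      by (intro prod.cong refl) (simp only: e)
    finally show ?thesis .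
  qed
qed

lemma theta_pow_pos: "(\<And>i. i \<ge> 1 \<Longrightarrow> \<theta> i > 0) \<Longrightarrow> theta_pow X r \<theta> \<mu> > 0"
  unfolding theta_pow_def by (intro prod_pos) (fastforce simp: index_set_def split: if_splits)

lemma theta_pow_add: "(\<And>i. i \<ge> 1 \<Longrightarrow> \<theta> i > 0) \<Longrightarrow> theta_pow X r \<theta> (\<mu> + \<nu>) = theta_pow X r \<theta> \<mu> * theta_pow X r \<theta> \<nu>"
  unfolding theta_pow_def theta_exp_add powr_add prod.distrib ..

text \<open>
  The contribution is multiplicative. Comparing every letter with the first one makes the
  contribution of a letter independent of the partition.
\<close>

lemma theta_pow_word:
  assumes \<theta>: "\<And>i. i \<ge> 1 \<Longrightarrow> \<theta> i > 0"
  shows "theta_pow X r \<theta> (\<lambda>j. \<mu> j - word_wt r w j) =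
    theta_pow X r \<theta> (\<lambda>j. \<mu> j - real (length w) * eps 1 j) * (\<Prod>a\<leftarrow>w. theta_pow X r \<theta> (eps 1 - letter_wt r a))"
proof (induction w arbitrary: \<mu>)
  case Nil
  then show ?case by (simp add: word_wt_def)
next
  case (Cons a w)
  have 1: "(\<lambda>j. \<mu> j - word_wt r (a # w) j) = (\<lambda>j. (\<mu> j - eps 1 j) - word_wt r w j) + (eps 1 - letter_wt r a)"
    by (simp add: fun_eq_iff word_wt_def plus_fun_apply minus_apply)
  have 2: "(\<lambda>j. \<mu> j - eps 1 j - real (length w) * eps 1 j) = (\<lambda>j. \<mu> j - real (length (a # w)) * eps 1 j)"
    by (simp add: fun_eq_iff algebra_simps)
  have "theta_pow X r \<theta> (\<lambda>j. \<mu> j - word_wt r (a # w) j) =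
      theta_pow X r \<theta> (\<lambda>j. (\<mu> j - eps 1 j) - word_wt r w j) * theta_pow X r \<theta> (eps 1 - letter_wt r a)"
    unfolding 1 by (rule theta_pow_add[OF \<theta>])
  also have "theta_pow X r \<theta> (\<lambda>j. (\<mu> j - eps 1 j) - word_wt r w j) =
      theta_pow X r \<theta> (\<lambda>j. \<mu> j - real (length (a # w)) * eps 1 j) * (\<Prod>a\<leftarrow>w. theta_pow X r \<theta> (eps 1 - letter_wt r a))"
    unfolding Cons.IH[of "\<lambda>j. \<mu> j - eps 1 j"] 2 ..
  finally show ?case by (simp add: mult_ac)
qed

lemma sum_words_prod:
  fixes g :: "nat \<Rightarrow> real"
  shows "(\<Sum>w\<in>words N n. \<Prod>a\<leftarrow>w. g a) = (\<Sum>a<N. g a) ^ n"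
proof (induction n)
  case 0
  have "words N 0 = {[]}" by (auto simp: words_def)
  then show ?case by simp
next
  case (Suc n)
  have "(\<Sum>w\<in>words N (Suc n). \<Prod>a\<leftarrow>w. g a) = (\<Sum>a<N. \<Sum>w\<in>words N n. g a * (\<Prod>a\<leftarrow>w. g a))"
    unfolding sum_words_Suc by simp
  then show ?case unfolding sum_distrib_left[symmetric] Suc by (simp add: sum_distrib_right[symmetric])
qed

text \<open>
  Weights of the tensor power that are not weights of the module are harmless, as their
  multiplicity is \<open>0\<close>.
\<close>

lemma S_sum_words:
  assumes lam: "partition_weight r lam = cols_wt ks" and ks: "\<forall>k\<in>set ks. k \<le> r"
  shows "S_sum X r lam \<theta> = (\<Sum>\<omega>\<in>word_wt r ` words (lie_size X r) (sum_list ks).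
    real (wt_dim X r ks \<omega>) * theta_pow X r \<theta> (\<lambda>j. cols_wt ks j - \<omega> j))"
proof -
  interpret hw_tensor X r ks using ks by unfold_locales
  note m = irrep_multiplicities[OF lam]
  have "S_sum X r lam \<theta> = (\<Sum>\<omega>\<in>weights X r lam. real (wt_dim X r ks \<omega>) * theta_pow X r \<theta> (\<lambda>j. cols_wt ks j - \<omega> j))"
    unfolding S_sum_def lam m(1) theta_pow_def theta_exp_def wt_dim_def ..
  also have "\<dots> = (\<Sum>\<omega>\<in>word_wt r ` words N n. real (wt_dim X r ks \<omega>) * theta_pow X r \<theta> (\<lambda>j. cols_wt ks j - \<omega> j))"
  proof (rule sum.mono_neutral_left)
    show "weights X r lam \<subseteq> word_wt r ` words N n"
    proof
      fix \<omega> assume "\<omega> \<in> weights X r lam"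
      then have \<omega>: "\<omega> \<in> weight_space_E r" "W \<inter> wspace X r n \<omega> \<noteq> {0}" using m(2) by auto
      moreover have "0 \<in> W \<inter> wspace X r n \<omega>"
        using fs.subspace_0[OF cyc_subspace] fs.subspace_0[OF wspace_subspace] by blast
      ultimately obtain f where f: "f \<in> wspace X r n \<omega>" "f \<noteq> 0" by blast
      then obtain w where "f w \<noteq> 0" by (auto simp: fun_simps)
      then show "\<omega> \<in> word_wt r ` words N n"
        using f(1) wspace_iff[OF \<omega>(1)] by (auto simp: tensors_def)
    qed
    show "\<forall>\<omega>\<in>word_wt r ` words N n - weights X r lam.
        real (wt_dim X r ks \<omega>) * theta_pow X r \<theta> (\<lambda>j. cols_wt ks j - \<omega> j) = 0"
    proof
      fix \<omega> assume "\<omega> \<in> word_wt r ` words N n - weights X r lam"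
      then have "W \<inter> wspace X r n \<omega> = {0}" using m(2) word_wt_E by auto
      moreover have "fs.dim {0 :: nat list \<Rightarrow> complex} = 0"
        using dim_support_le[of "{}" "{0 :: nat list \<Rightarrow> complex}"] by (simp add: zero_fun_apply)
      ultimately show "real (wt_dim X r ks \<omega>) * theta_pow X r \<theta> (\<lambda>j. cols_wt ks j - \<omega> j) = 0"
        by (simp add: wt_dim_def)
    qed
  qed simp
  finally show ?thesis .
qed

text \<open>
  The multiplicity of a weight is at most the number of words of that weight.
\<close>

lemma sum_weights_le:
  assumes \<theta>: "\<And>i. i \<ge> 1 \<Longrightarrow> \<theta> i > 0"
    and A: "A \<subseteq> word_wt r ` words (lie_size X r) (sum_list ks)"
    and B: "\<And>w. w \<in> words (lie_size X r) (sum_list ks) \<Longrightarrow> word_wt r w \<in> A \<Longrightarrow> w \<in> B" and fB: "finite B"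
  shows "(\<Sum>\<omega>\<in>A. real (wt_dim X r ks \<omega>) * theta_pow X r \<theta> (\<lambda>j. cols_wt ks j - \<omega> j))
    \<le> (\<Sum>w\<in>B. theta_pow X r \<theta> (\<lambda>j. cols_wt ks j - word_wt r w j))"
proof -
  let ?W = "words (lie_size X r) (sum_list ks)" and ?m = "\<lambda>\<omega>. theta_pow X r \<theta> (\<lambda>j. cols_wt ks j - \<omega> j)"
  let ?B = "{w \<in> ?W. word_wt r w \<in> A}"
  have fA: "finite A" using A by (rule finite_subset) simp
  have pos: "?m \<omega> \<ge> 0" for \<omega> using theta_pow_pos[of \<theta> X r] \<theta> by (simp add: less_imp_le)
  have "(\<Sum>\<omega>\<in>A. real (wt_dim X r ks \<omega>) * ?m \<omega>) \<le> (\<Sum>\<omega>\<in>A. real (card {w \<in> ?W. word_wt r w = \<omega>}) * ?m \<omega>)"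
  proof (rule sum_mono)
    fix \<omega> assume "\<omega> \<in> A"
    then have "\<omega> \<in> weight_space_E r" using A word_wt_E by auto
    then show "real (wt_dim X r ks \<omega>) * ?m \<omega> \<le> real (card {w \<in> ?W. word_wt r w = \<omega>}) * ?m \<omega>"
      using wt_dim_le pos by (intro mult_right_mono) auto
  qed
  also have "\<dots> = (\<Sum>\<omega>\<in>A. \<Sum>w\<in>{w \<in> ?B. word_wt r w = \<omega>}. ?m (word_wt r w))"
  proof (rule sum.cong[OF refl])
    fix \<omega> assume "\<omega> \<in> A"
    then have "{w \<in> ?B. word_wt r w = \<omega>} = {w \<in> ?W. word_wt r w = \<omega>}" by auto
    then show "real (card {w \<in> ?W. word_wt r w = \<omega>}) * ?m \<omega> = (\<Sum>w\<in>{w \<in> ?B. word_wt r w = \<omega>}. ?m (word_wt r w))"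
      by simp
  qed
  also have "\<dots> = (\<Sum>w\<in>?B. ?m (word_wt r w))"
    by (rule sum.group) (use fA in auto)
  also have "\<dots> \<le> (\<Sum>w\<in>B. ?m (word_wt r w))"
    by (rule sum_mono2[OF fB]) (use B pos in auto)
  finally show ?thesis .
qed

section \<open>Convergence\<close>

definition theta_prod :: "(nat \<Rightarrow> real) \<Rightarrow> nat \<Rightarrow> real" where
  "theta_prod \<theta> a = (\<Prod>i = 1..a. \<theta> i)"

lemma coord_sum_diff: "coord_sum r (\<lambda>j. \<mu> j - \<nu> j) = coord_sum r \<mu> - coord_sum r \<nu>"
  by (simp add: coord_sum_def sum_subtractf)

lemma coord_sum_eps: "1 \<le> k \<Longrightarrow> coord_sum r (eps k) = (if k \<le> r then 1 else 0)"
  by (simp add: coord_sum_def eps_def)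

lemma cols_wt_coord_sum:
  assumes "\<forall>k\<in>set ks. k \<le> r"
  shows "coord_sum r (cols_wt ks) = real (sum_list ks)"
  using col_tensor_word[OF assms, of "concat (map (\<lambda>k. [0..<k]) ks)"] coord_sum_words[of _ r "sum_list ks"]
  by (metis col_tensor_nonzero zero_neq_one)

lemma cols_le: "sum_list ks \<le> r \<Longrightarrow> \<forall>k\<in>set ks. k \<le> r" for ks :: "nat list"
  by (auto dest: member_le_sum_list)

locale theta_seq =
  fixes \<theta> :: "nat \<Rightarrow> real" and q :: real
  assumes \<theta>_pos: "\<And>i. i \<ge> 1 \<Longrightarrow> \<theta> i > 0" and \<theta>_le: "\<And>i. i \<ge> 1 \<Longrightarrow> \<theta> i \<le> q" and q1: "q < 1"
begin

lemma q0: "q > 0"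
  using \<theta>_pos[of 1] \<theta>_le[of 1] by simp

lemma theta_pow_eq:
  "2 \<le> r \<Longrightarrow> coord_sum r \<mu> = 0 \<Longrightarrow> theta_pow X r \<theta> \<mu> = (\<Prod>i = 1..<r. \<theta> i powr coord_sum i \<mu>)"
  by (rule theta_pow_balanced[OF \<theta>_pos])

lemma theta_pow_nonneg: "theta_pow X r \<theta> \<mu> \<ge> 0"
  by (rule less_imp_le[OF theta_pow_pos[OF \<theta>_pos]])

lemma letter_low:
  assumes r: "2 \<le> r" and a: "a < r"
  shows "theta_pow X r \<theta> (eps 1 - letter_wt r a) = theta_prod \<theta> a"
proof -
  have e: "eps 1 - letter_wt r a = (\<lambda>j. eps 1 j - eps (a + 1) j)"
    using a by (simp add: letter_wt_def fun_eq_iff minus_apply)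
  have 0: "coord_sum r (eps 1 - letter_wt r a) = 0" unfolding e coord_sum_diff using r a by (simp add: coord_sum_eps)
  have "theta_pow X r \<theta> (eps 1 - letter_wt r a) = (\<Prod>i = 1..<r. \<theta> i powr coord_sum i (eps 1 - letter_wt r a))"
    by (rule theta_pow_eq[OF r 0])
  also have "\<dots> = (\<Prod>i = 1..<r. if i \<in> {1..a} then \<theta> i else 1)"
  proof (rule prod.cong[OF refl])
    fix i assume i: "i \<in> {1..<r}"
    then have "coord_sum i (eps 1 - letter_wt r a) = (if i \<le> a then 1 else 0)"
      unfolding e coord_sum_diff by (simp add: coord_sum_eps)
    then show "\<theta> i powr coord_sum i (eps 1 - letter_wt r a) = (if i \<in> {1..a} then \<theta> i else 1)"
      using \<theta>_pos[of i] i by simp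
  qed
  also have "\<dots> = (\<Prod>i\<in>{1..<r} \<inter> {1..a}. \<theta> i)" by (rule prod.inter_restrict[symmetric]) simp
  also have "{1..<r} \<inter> {1..a} = {1..a}" using a by auto
  finally show ?thesis by (simp add: theta_prod_def)
qed

text \<open>
  For a letter outside the first \<open>r\<close>, all simple roots but possibly the last two occur in
  \<open>\<epsilon>\<^sub>1\<close> minus the weight of the letter.
\<close>

lemma letter_high:
  assumes X: "X \<noteq> Type_A" and r: "2 \<le> r" and a: "r \<le> a"
  shows "theta_pow X r \<theta> (eps 1 - letter_wt r a) \<le> q ^ (r - 2)"
proof -
  define \<nu> where "\<nu> = - letter_wt r a"
  have \<mu>: "eps 1 - letter_wt r a = (\<lambda>j. eps 1 j + \<nu> j)" by (simp add: \<nu>_def fun_eq_iff minus_apply)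
  have \<nu>: "0 \<le> \<nu> j" "\<nu> j \<le> 1" for j
    using a by (auto simp: \<nu>_def letter_wt_def eps_def zero_fun_apply)
  have ws: "coord_sum i (eps 1 - letter_wt r a) \<ge> 1" if "1 \<le> i" for i
  proof -
    have "coord_sum i (eps 1 - letter_wt r a) = coord_sum i (eps 1) + coord_sum i \<nu>"
      unfolding \<mu> by (simp add: coord_sum_def sum.distrib)
    moreover have "coord_sum i \<nu> \<ge> 0" unfolding coord_sum_def by (intro sum_nonneg \<nu>)
    ultimately show ?thesis using that by (simp add: coord_sum_eps)
  qed
  have e1: "theta_exp X r i (eps 1 - letter_wt r a) \<ge> 1" if "1 \<le> i" "i < r - 1" for i
    using theta_exp_inner[of i r X "eps 1 - letter_wt r a"] ws[of i] that by auto
  have e0: "theta_exp X r i (eps 1 - letter_wt r a) \<ge> 0" if i: "1 \<le> i" "i \<le> r" for i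
  proof -
    have 1: "coord_sum (r - 1) (eps 1 - letter_wt r a) \<ge> 1" "coord_sum r (eps 1 - letter_wt r a) \<ge> 1" using ws r by auto
    have 2: "(eps 1 - letter_wt r a) r \<le> 1" unfolding \<mu> using r \<nu>(2)[of r] by (simp add: eps_def)
    consider "i = r" | "i = r - 1" "X = Type_D" | "i < r" "X = Type_D \<Longrightarrow> i \<noteq> r - 1" using i by linarith
    then show ?thesis
    proof cases
      case 1
      then show ?thesis using theta_exp_last(1-3)[OF r, of "eps 1 - letter_wt r a"] \<open>coord_sum r _ \<ge> 1\<close> X by (cases X) auto
    next
      case 2
      then show ?thesis using theta_exp_last(4)[OF r, of "eps 1 - letter_wt r a"] 1(1) \<open>(eps 1 - letter_wt r a) r \<le> 1\<close> by simp
    next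
      case 3
      then show ?thesis using theta_exp_inner[of i r X "eps 1 - letter_wt r a"] ws[of i] i by auto
    qed
  qed
  have I: "index_set X r = {1..r}" using X by (simp add: index_set_def)
  have "theta_pow X r \<theta> (eps 1 - letter_wt r a) \<le> (\<Prod>i\<in>{1..r}. if i \<in> {1..<r - 1} then q else 1)"
    unfolding theta_pow_def I
  proof (rule prod_mono, rule conjI)
    fix i assume i: "i \<in> {1..r}"
    let ?e = "theta_exp X r i (eps 1 - letter_wt r a)"
    have t: "0 < \<theta> i" "\<theta> i \<le> q" "\<theta> i \<le> 1" using \<theta>_pos[of i] \<theta>_le[of i] q1 i by auto
    show "0 \<le> \<theta> i powr ?e" by simp
    show "\<theta> i powr ?e \<le> (if i \<in> {1..<r - 1} then q else 1)"
    proof (cases "i \<in> {1..<r - 1}")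
      case True
      have "\<theta> i powr ?e \<le> \<theta> i powr 1" using e1[of i] True t by (intro powr_mono') auto
      then show ?thesis using True t by simp
    next
      case False
      have "\<theta> i powr ?e \<le> \<theta> i powr 0" using e0[of i] i t by (intro powr_mono') auto
      then show ?thesis unfolding if_not_P[OF False] using t by simp
    qed
  qed
  also have "\<dots> = (\<Prod>i\<in>{1..r} \<inter> {1..<r - 1}. q)" by (rule prod.inter_restrict[symmetric]) simp
  also have "{1..r} \<inter> {1..<r - 1} = {1..<r - 1}" by auto
  also have "(\<Prod>i\<in>{1..<r - 1}. q) = q ^ (r - 2)" by (simp add: numeral_2_eq_2)
  finally show ?thesis .
qed

text \<open>
  The contribution of \<open>\<lambda> - n\<epsilon>\<^sub>1\<close>. Its partial sums vanish from the number of rows on, so it does not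
  depend on \<open>r\<close> once \<open>r\<close> is large.
\<close>

definition shift_factor :: "nat list \<Rightarrow> real" where
  "shift_factor ks = (\<Prod>i = 1..<sum_list ks + 2. \<theta> i powr coord_sum i (\<lambda>j. cols_wt ks j - real (sum_list ks) * eps 1 j))"

lemma shift_balanced:
  assumes "sum_list ks \<le> r" "1 \<le> r"
  shows "coord_sum r (\<lambda>j. cols_wt ks j - real (sum_list ks) * eps 1 j) = 0"
proof -
  have "coord_sum r (\<lambda>j. c * eps 1 j) = c" for c
    using coord_sum_eps[of 1 r] assms(2) by (simp add: coord_sum_def sum_distrib_left[symmetric])
  then show ?thesis unfolding coord_sum_diff cols_wt_coord_sum[OF cols_le[OF assms(1)]] by simp
qed

lemma theta_pow_shift:
  assumes r: "sum_list ks + 2 \<le> r"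
  shows "theta_pow X r \<theta> (\<lambda>j. cols_wt ks j - real (sum_list ks) * eps 1 j) = shift_factor ks"
proof -
  have "theta_pow X r \<theta> (\<lambda>j. cols_wt ks j - real (sum_list ks) * eps 1 j) =
    (\<Prod>i = 1..<r. \<theta> i powr coord_sum i (\<lambda>j. cols_wt ks j - real (sum_list ks) * eps 1 j))"
    by (rule theta_pow_eq[OF _ shift_balanced]) (use r in auto)
  also have "\<dots> = shift_factor ks" unfolding shift_factor_def
  proof (rule prod.mono_neutral_right)
    show "\<forall>i\<in>{1..<r} - {1..<sum_list ks + 2}.
        \<theta> i powr coord_sum i (\<lambda>j. cols_wt ks j - real (sum_list ks) * eps 1 j) = 1"
    proof
      fix i assume i: "i \<in> {1..<r} - {1..<sum_list ks + 2}"
      then have le: "sum_list ks \<le> i" "1 \<le> i" by auto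
      then have "coord_sum i (\<lambda>j. cols_wt ks j - real (sum_list ks) * eps 1 j) = 0" "\<theta> i > 0"
        by (rule shift_balanced) (rule \<theta>_pos[OF le(2)])
      then show "\<theta> i powr coord_sum i (\<lambda>j. cols_wt ks j - real (sum_list ks) * eps 1 j) = 1" by simp
    qed
  qed (use r in auto)
  finally show ?thesis .
qed

lemma shift_factor_pos: "shift_factor ks > 0"
proof -
  have "theta_pow Type_A (sum_list ks + 2) \<theta> (\<lambda>j. cols_wt ks j - real (sum_list ks) * eps 1 j) > 0"
    by (rule theta_pow_pos[OF \<theta>_pos])
  then show ?thesis unfolding theta_pow_shift[OF order_refl] .
qed

lemma sum_words_theta_pow:
  assumes r: "sum_list ks + 2 \<le> r"
  shows "(\<Sum>w\<in>words M (sum_list ks). theta_pow X r \<theta> (\<lambda>j. cols_wt ks j - word_wt r w j)) =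
    shift_factor ks * (\<Sum>a<M. theta_pow X r \<theta> (eps 1 - letter_wt r a)) ^ sum_list ks"
proof -
  have "theta_pow X r \<theta> (\<lambda>j. cols_wt ks j - word_wt r w j) =
      shift_factor ks * (\<Prod>a\<leftarrow>w. theta_pow X r \<theta> (eps 1 - letter_wt r a))" if "w \<in> words M (sum_list ks)" for w
  proof -
    have "length w = sum_list ks" using that by (simp add: words_def)
    then show ?thesis using theta_pow_word[OF \<theta>_pos, where X = X and r = r and \<mu> = "cols_wt ks" and w = w] theta_pow_shift[OF r, of X] by simp
  qed
  then show ?thesis by (simp add: sum_distrib_left[symmetric] sum_words_prod)
qed

lemma low_sum: "2 \<le> r \<Longrightarrow> (\<Sum>a<r. theta_pow X r \<theta> (eps 1 - letter_wt r a)) = (\<Sum>a<r. theta_prod \<theta> a)"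
  by (intro sum.cong) (auto simp: letter_low simp del: One_nat_def)

lemma theta_prod_le: "0 \<le> theta_prod \<theta> a \<and> theta_prod \<theta> a \<le> q ^ a"
proof -
  have "0 \<le> \<theta> i \<and> \<theta> i \<le> q" if "i \<in> {1..a}" for i using \<theta>_pos[of i] \<theta>_le[of i] that by auto
  then have "(\<Prod>i = 1..a. \<theta> i) \<le> (\<Prod>i = 1..a. q)" "(\<Prod>i = 1..a. \<theta> i) \<ge> 0"
    by (auto intro!: prod_mono prod_nonneg simp del: prod_constant)
  then show ?thesis by (simp add: theta_prod_def)
qed

lemma summable_theta_prod: "summable (theta_prod \<theta>)"
proof (rule summable_comparison_test)
  show "summable (\<lambda>a. q ^ a)" using q0 q1 by (intro summable_geometric) simp
  show "\<exists>N. \<forall>a\<ge>N. norm (theta_prod \<theta> a) \<le> q ^ a" using theta_prod_le by auto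
qed

lemma high_sum:
  assumes X: "X \<noteq> Type_A" and r: "2 \<le> r"
  shows "(\<Sum>a<r. theta_prod \<theta> a) \<le> (\<Sum>a<lie_size X r. theta_pow X r \<theta> (eps 1 - letter_wt r a))"
    "(\<Sum>a<lie_size X r. theta_pow X r \<theta> (eps 1 - letter_wt r a)) \<le> (\<Sum>a<r. theta_prod \<theta> a) + real (r + 1) * q ^ (r - 2)"
proof -
  let ?N = "lie_size X r" and ?t = "\<lambda>a. theta_pow X r \<theta> (eps 1 - letter_wt r a)"
  have N: "r \<le> ?N" "?N \<le> 2 * r + 1" using lie_size_bounds(1)[OF X, of r] lie_size_bounds(2)[of r X] by auto
  have "{..<?N} = {..<r} \<union> {r..<?N}" using N by auto
  then have s: "(\<Sum>a<?N. ?t a) = (\<Sum>a<r. theta_prod \<theta> a) + (\<Sum>a\<in>{r..<?N}. ?t a)"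
    using low_sum[OF r, of X] by (simp add: sum.union_disjoint ivl_disj_int)
  have "(\<Sum>a\<in>{r..<?N}. ?t a) \<ge> 0" by (intro sum_nonneg theta_pow_nonneg)
  then show "(\<Sum>a<r. theta_prod \<theta> a) \<le> (\<Sum>a<?N. ?t a)" using s by simp
  have "(\<Sum>a\<in>{r..<?N}. ?t a) \<le> (\<Sum>a\<in>{r..<?N}. q ^ (r - 2))"
    by (intro sum_mono letter_high[OF X r]) simp
  also have "\<dots> = real (?N - r) * q ^ (r - 2)" by simp
  also have "\<dots> \<le> real (r + 1) * q ^ (r - 2)" using N q0 by (intro mult_right_mono) auto
  finally show "(\<Sum>a<?N. ?t a) \<le> (\<Sum>a<r. theta_prod \<theta> a) + real (r + 1) * q ^ (r - 2)" using s by simp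
qed

text \<open>
  Weights of words in the first \<open>r\<close> letters contribute the same in both types; the difference comes
  from words with another letter.
\<close>

lemma S_sum_bounds:
  assumes lam: "is_partition lam" and ks: "ks = columns lam" and r: "sum_list ks + 2 \<le> r"
    and X: "X \<noteq> Type_A"
  shows "S_sum Type_A r lam \<theta> \<le> S_sum X r lam \<theta>"
    "S_sum X r lam \<theta> \<le> S_sum Type_A r lam \<theta> + shift_factor ks *
      ((\<Sum>a<lie_size X r. theta_pow X r \<theta> (eps 1 - letter_wt r a)) ^ sum_list ks - (\<Sum>a<r. theta_prod \<theta> a) ^ sum_list ks)"
proof -
  let ?n = "sum_list ks" and ?N = "lie_size X r"
  have ksr: "\<forall>k\<in>set ks. k \<le> r" by (rule cols_le) (use r in simp)
  have pw: "partition_weight r lam = cols_wt ks" using partition_weight_columns[OF lam] ksr ks by simp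
  let ?f = "\<lambda>X \<omega>. real (wt_dim X r ks \<omega>) * theta_pow X r \<theta> (\<lambda>j. cols_wt ks j - \<omega> j)"
  let ?A = "word_wt r ` words r ?n" and ?X = "word_wt r ` words ?N ?n"
  have rN: "r \<le> ?N" by (rule lie_size_bounds)
  then have wsub: "words r ?n \<subseteq> words ?N ?n" by (auto simp: words_def)
  have sub: "?A \<subseteq> ?X" using wsub by blast
  have eq: "?f X \<omega> = ?f Type_A \<omega>" if \<omega>: "\<omega> \<in> ?A" for \<omega>
  proof -
    obtain w where w: "w \<in> words r ?n" "\<omega> = word_wt r w" using \<omega> by blast
    have 0: "coord_sum r (\<lambda>j. cols_wt ks j - \<omega> j) = 0"
      unfolding coord_sum_diff cols_wt_coord_sum[OF ksr] w(2) coord_sum_words[OF w(1)] by simp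
    have r2: "2 \<le> r" using r by simp
    show ?thesis
      unfolding theta_pow_eq[OF r2 0] unfolding w(2) wt_dim_type_A[OF ksr X w(1)] ..
  qed
  have nonneg: "?f X \<omega> \<ge> 0" for \<omega> by (simp add: theta_pow_nonneg)
  have SA: "S_sum Type_A r lam \<theta> = (\<Sum>\<omega>\<in>?A. ?f X \<omega>)"
    unfolding S_sum_words[OF pw ksr] lie_alg_A by (intro sum.cong refl eq[symmetric])
  have SX: "S_sum X r lam \<theta> = (\<Sum>\<omega>\<in>?X - ?A. ?f X \<omega>) + S_sum Type_A r lam \<theta>"
    unfolding SA S_sum_words[OF pw ksr, of X] by (rule sum.subset_diff[OF sub]) simp
  show "S_sum Type_A r lam \<theta> \<le> S_sum X r lam \<theta>"
    unfolding SX using nonneg by (simp add: sum_nonneg)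
  have "(\<Sum>\<omega>\<in>?X - ?A. ?f X \<omega>) \<le> (\<Sum>w\<in>words ?N ?n - words r ?n. theta_pow X r \<theta> (\<lambda>j. cols_wt ks j - word_wt r w j))"
    by (rule sum_weights_le[OF \<theta>_pos]) auto
  also have "\<dots> = (\<Sum>w\<in>words ?N ?n. theta_pow X r \<theta> (\<lambda>j. cols_wt ks j - word_wt r w j))
      - (\<Sum>w\<in>words r ?n. theta_pow X r \<theta> (\<lambda>j. cols_wt ks j - word_wt r w j))"
    by (rule sum_diff) (use wsub in auto)
  also have "\<dots> = shift_factor ks *
      ((\<Sum>a<?N. theta_pow X r \<theta> (eps 1 - letter_wt r a)) ^ ?n - (\<Sum>a<r. theta_prod \<theta> a) ^ ?n)"
    unfolding sum_words_theta_pow[OF r] using low_sum[of r X] r by (simp add: right_diff_distrib)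
  finally show "S_sum X r lam \<theta> \<le> S_sum Type_A r lam \<theta> + shift_factor ks *
      ((\<Sum>a<?N. theta_pow X r \<theta> (eps 1 - letter_wt r a)) ^ ?n - (\<Sum>a<r. theta_prod \<theta> a) ^ ?n)"
    unfolding SX by simp
qed

lemma S_sum_A_bounded:
  assumes lam: "is_partition lam" and ks: "ks = columns lam" and r: "sum_list ks + 2 \<le> r"
  shows "0 \<le> S_sum Type_A r lam \<theta>"
    "S_sum Type_A r lam \<theta> \<le> shift_factor ks * suminf (theta_prod \<theta>) ^ sum_list ks"
proof -
  let ?n = "sum_list ks"
  have ksr: "\<forall>k\<in>set ks. k \<le> r" by (rule cols_le) (use r in simp)
  have pw: "partition_weight r lam = cols_wt ks" using partition_weight_columns[OF lam] ksr ks by simp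
  show "0 \<le> S_sum Type_A r lam \<theta>"
    unfolding S_sum_words[OF pw ksr] by (intro sum_nonneg mult_nonneg_nonneg theta_pow_nonneg) simp
  have "S_sum Type_A r lam \<theta> \<le> (\<Sum>w\<in>words r ?n. theta_pow Type_A r \<theta> (\<lambda>j. cols_wt ks j - word_wt r w j))"
    unfolding S_sum_words[OF pw ksr] by (rule sum_weights_le[OF \<theta>_pos]) (auto simp: lie_alg_A)
  also have "\<dots> = shift_factor ks * (\<Sum>a<r. theta_prod \<theta> a) ^ ?n"
    unfolding sum_words_theta_pow[OF r] using low_sum[of r Type_A] r by simp
  also have "\<dots> \<le> shift_factor ks * suminf (theta_prod \<theta>) ^ ?n"
    using theta_prod_le shift_factor_pos[of ks]
    by (intro mult_left_mono power_mono sum_le_suminf summable_theta_prod sum_nonneg) auto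
  finally show "S_sum Type_A r lam \<theta> \<le> shift_factor ks * suminf (theta_prod \<theta>) ^ ?n" .
qed

text \<open>
  Weights for \<open>r\<close> are weights for \<open>r + 1\<close> with the same multiplicity and the same contribution, since
  the additional exponent is \<open>0\<close>.
\<close>

lemma S_sum_A_mono:
  assumes lam: "is_partition lam" and ks: "ks = columns lam" and r: "sum_list ks + 2 \<le> r"
  shows "S_sum Type_A r lam \<theta> \<le> S_sum Type_A (Suc r) lam \<theta>"
proof -
  let ?n = "sum_list ks"
  have ksr: "\<forall>k\<in>set ks. k \<le> r" by (rule cols_le) (use r in simp)
  then have ksr': "\<forall>k\<in>set ks. k \<le> Suc r" by auto
  have pw: "partition_weight r lam = cols_wt ks" "partition_weight (Suc r) lam = cols_wt ks"
    using partition_weight_columns[OF lam] ksr ksr' ks by simp_all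
  let ?f = "\<lambda>r \<omega>. real (wt_dim Type_A r ks \<omega>) * theta_pow Type_A r \<theta> (\<lambda>j. cols_wt ks j - \<omega> j)"
  have eq: "?f r \<omega> = ?f (Suc r) \<omega>" if \<omega>: "\<omega> \<in> word_wt r ` words r ?n" for \<omega>
  proof -
    obtain w where w: "w \<in> words r ?n" "\<omega> = word_wt r w" using \<omega> by blast
    have w': "w \<in> words (Suc r) ?n" using w(1) by (auto simp: words_def)
    have 0: "coord_sum r (\<lambda>j. cols_wt ks j - \<omega> j) = 0"
      unfolding coord_sum_diff cols_wt_coord_sum[OF ksr] w(2) coord_sum_words[OF w(1)] by simp
    have 1: "coord_sum (Suc r) (\<lambda>j. cols_wt ks j - \<omega> j) = 0"
      unfolding coord_sum_diff cols_wt_coord_sum[OF ksr'] w(2) word_wt_Suc[OF w(1), symmetric] coord_sum_words[OF w'] by simp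
    have r2: "2 \<le> r" "2 \<le> Suc r" using r by auto
    have "theta_pow Type_A (Suc r) \<theta> (\<lambda>j. cols_wt ks j - \<omega> j) = theta_pow Type_A r \<theta> (\<lambda>j. cols_wt ks j - \<omega> j)"
      unfolding theta_pow_eq[OF r2(1) 0] theta_pow_eq[OF r2(2) 1]
      using r \<theta>_pos[of r] 0 by (simp add: prod.atLeastLessThan_Suc)
    then show ?thesis unfolding w(2) using wt_dim_Suc[OF ksr w(1)] by simp
  qed
  have "S_sum Type_A r lam \<theta> = (\<Sum>\<omega>\<in>word_wt r ` words r ?n. ?f (Suc r) \<omega>)"
    unfolding S_sum_words[OF pw(1) ksr] lie_alg_A by (intro sum.cong refl eq)
  also have "\<dots> \<le> (\<Sum>\<omega>\<in>word_wt (Suc r) ` words (Suc r) ?n. ?f (Suc r) \<omega>)"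
  proof (rule sum_mono2)
    show "word_wt r ` words r ?n \<subseteq> word_wt (Suc r) ` words (Suc r) ?n"
    proof
      fix \<omega> assume "\<omega> \<in> word_wt r ` words r ?n"
      then obtain w where w: "w \<in> words r ?n" "\<omega> = word_wt r w" by blast
      then have "w \<in> words (Suc r) ?n" "\<omega> = word_wt (Suc r) w" by (auto simp: words_def word_wt_Suc)
      then show "\<omega> \<in> word_wt (Suc r) ` words (Suc r) ?n" by blast
    qed
    show "?f (Suc r) \<omega> \<ge> 0" for \<omega> by (simp add: theta_pow_nonneg)
  qed simp
  also have "\<dots> = S_sum Type_A (Suc r) lam \<theta>"
    unfolding S_sum_words[OF pw(2) ksr'] lie_alg_A ..
  finally show ?thesis .
qed

lemma S_sum_A_convergent:
  assumes lam: "is_partition lam"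
  shows "(\<lambda>r. S_sum Type_A r lam \<theta>) \<longlonglongrightarrow> S_limit_A lam \<theta>"
proof -
  define ks where "ks = columns lam"
  define M where "M = sum_list ks + 2"
  have "convergent (\<lambda>r. S_sum Type_A r lam \<theta>)"
  proof (rule Bseq_monoseq_convergent'_inc[of _ M])
    show "Bseq (\<lambda>r. S_sum Type_A (r + M) lam \<theta>)"
    proof (rule BseqI')
      fix r
      have "M \<le> r + M" by simp
      then show "norm (S_sum Type_A (r + M) lam \<theta>) \<le> shift_factor ks * suminf (theta_prod \<theta>) ^ sum_list ks"
        using S_sum_A_bounded[OF lam ks_def, of "r + M"] by (simp add: M_def)
    qed
    fix m n :: nat assume "M \<le> m" "m \<le> n"
    from this(2,1) show "S_sum Type_A m lam \<theta> \<le> S_sum Type_A n lam \<theta>"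
    proof (induction n rule: dec_induct)
      case (step n)
      then have "sum_list ks + 2 \<le> n" by (simp add: M_def)
      from S_sum_A_mono[OF lam ks_def this] show ?case using step by simp
    qed simp
  qed
  then show ?thesis by (simp add: S_limit_A_def convergent_LIMSEQ_iff)
qed

text \<open>
  The sum of type \<open>X\<close> lies between the sum of type \<open>A\<close> and that sum plus an error that vanishes in the
  limit.
\<close>

lemma S_sum_convergent:
  assumes lam: "is_partition lam" and X: "X \<noteq> Type_A"
  shows "(\<lambda>r. S_sum X r lam \<theta>) \<longlonglongrightarrow> S_limit_A lam \<theta>"
proof -
  define ks where "ks = columns lam"
  define n where "n = sum_list ks"
  define a where "a r = (\<Sum>i<r. theta_prod \<theta> i)" for r
  define b where "b r = real (r + 1) * q ^ (r - 2)" for r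
  have a: "a \<longlonglongrightarrow> suminf (theta_prod \<theta>)"
    unfolding a_def by (rule summable_LIMSEQ[OF summable_theta_prod])
  have "(\<lambda>m. real m * q ^ m + 3 * q ^ m) \<longlonglongrightarrow> 0 + 3 * 0"
    using q0 q1 by (intro tendsto_add tendsto_mult tendsto_const powser_times_n_limit_0 LIMSEQ_power_zero) auto
  moreover have "(\<lambda>m. b (m + 2)) = (\<lambda>m. real m * q ^ m + 3 * q ^ m)"
    by (auto simp: b_def algebra_simps)
  ultimately have b: "b \<longlonglongrightarrow> 0" by (intro LIMSEQ_offset[of b 2]) simp
  have "(\<lambda>r. S_sum Type_A r lam \<theta> + shift_factor ks * ((a r + b r) ^ n - a r ^ n)) \<longlonglongrightarrow>
      S_limit_A lam \<theta> + shift_factor ks * ((suminf (theta_prod \<theta>) + 0) ^ n - suminf (theta_prod \<theta>) ^ n)"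
    by (intro tendsto_intros S_sum_A_convergent[OF lam] a b)
  then have up: "(\<lambda>r. S_sum Type_A r lam \<theta> + shift_factor ks * ((a r + b r) ^ n - a r ^ n)) \<longlonglongrightarrow>
      S_limit_A lam \<theta>" by simp
  show ?thesis
  proof (rule tendsto_sandwich[OF _ _ S_sum_A_convergent[OF lam] up])
    have ev: "\<forall>\<^sub>F r in sequentially. n + 2 \<le> r" by (rule eventually_ge_at_top)
    show "\<forall>\<^sub>F r in sequentially. S_sum Type_A r lam \<theta> \<le> S_sum X r lam \<theta>"
      by (rule eventually_mono[OF ev]) (rule S_sum_bounds(1)[OF lam ks_def _ X], simp add: n_def)
    show "\<forall>\<^sub>F r in sequentially. S_sum X r lam \<theta> \<le>
        S_sum Type_A r lam \<theta> + shift_factor ks * ((a r + b r) ^ n - a r ^ n)"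
    proof (rule eventually_mono[OF ev])
      fix r assume r: "n + 2 \<le> r"
      let ?c = "\<Sum>a<lie_size X r. theta_pow X r \<theta> (eps 1 - letter_wt r a)"
      have r2: "2 \<le> r" using r by simp
      have "0 \<le> a r" unfolding a_def by (intro sum_nonneg) (use theta_prod_le in auto)
      then have c: "0 \<le> ?c" "?c \<le> a r + b r"
        using high_sum[OF X r2] unfolding a_def b_def by auto
      have "?c ^ n \<le> (a r + b r) ^ n" by (rule power_mono[OF c(2,1)])
      then have "shift_factor ks * (?c ^ n - a r ^ n) \<le> shift_factor ks * ((a r + b r) ^ n - a r ^ n)"
        using shift_factor_pos[of ks] by (intro mult_left_mono) auto
      then show "S_sum X r lam \<theta> \<le> S_sum Type_A r lam \<theta> + shift_factor ks * ((a r + b r) ^ n - a r ^ n)"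
        using S_sum_bounds(2)[OF lam ks_def _ X, of r] r unfolding n_def a_def by linarith
    qed
  qed
qed

end

theorem corollary4p2p5:
  fixes X :: lie_type and lam :: "nat \<Rightarrow> nat" and \<theta> :: "nat \<Rightarrow> real"
  assumes "X \<in> {Type_C, Type_B, Type_D}"
    and "is_partition lam"
    and "\<And>i. i \<ge> 1 \<Longrightarrow> \<theta> i > 0"
    and "bdd_above (\<theta> ` {1..})"
    and "(SUP i\<in>{1..}. \<theta> i) < 1"
  shows "(\<lambda>r. S_sum X r lam \<theta>) \<longlonglongrightarrow> S_limit_A lam \<theta>"
proof -
  interpret theta_seq \<theta> "SUP i\<in>{1..}. \<theta> i"
    by unfold_locales (use assms in \<open>auto intro: cSUP_upper\<close>)
  show ?thesis by (rule S_sum_convergent) (use assms(1,2) in auto)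
qed

end
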